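(* Let $G$ be the $xy$-sum of connected graphs $G_1,G_2\in\mathcal{G}^\circ_{xy}$. If $G_1\in\mathcal{C}^\circ_0(\widehat{g}^+)$ and $G_2\in\mathcal{C}^\circ_1(\widehat{g}^+)$, then $G\in\mathcal{C}^\circ_2(\widehat{g}^+)$. Conversely, for every $2$-connected graph $G\in\mathcal{C}^\circ_2(\widehat{g}^+)$ such that $\{x,y\}$ is a $2$-vertex-cut, there are connected graphs $G_1\in\mathcal{C}^\circ_0(\widehat{g}^+)$ and $G_2\in\mathcal{C}^\circ_1(\widehat{g}^+)$ in $\mathcal{G}^\circ_{xy}$ whose $xy$-sum is $G$.
   Context: All graphs are finite and simple. The Euler genus $\widehat{g}(G)$ is the minimum Euler genus of a surface in which $G$ embeds. $\mathcal{G}_{xy}$ is the class of graphs with two distinguished vertices $x,y$ (terminals). The set $\mathcal{M}(G)$ of minor-operations consists of deleting any edge, or contracting any edge other than $xy$ (a vertex obtained by contracting an edge incident with a terminal becomes a terminal; parallel edges are removed); $\mu G$ is the result of $\mu\in\mathcal{M}(G)$. $\mathcal{G}^\circ_{xy}$ is the subclass of graphs not containing the edge $xy$. $G^+$ is $G$ with the edge $xy$ added (if absent); $\widehat{g}^+(G)=\widehat{g}(G^+)$. For $G_1,G_2\in\mathcal{G}_{xy}$ with $V(G_1)\cap V(G_2)=\{x,y\}$, their $xy$-sum is $(V(G_1)\cup V(G_2),E(G_1)\cup E(G_2))$. $G$ is $\widehat{g}^+$-critical if $\widehat{g}^+(\mu G)<\widehat{g}^+(G)$ for every $\mu\in\mathcal{M}(G)$.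 $\mathcal{C}^\circ_k(\widehat{g}^+)$ is the class of $\widehat{g}^+$-critical graphs in $\mathcal{G}^\circ_{xy}$ with $\widehat{g}^+(G)=k+1$. *)

theory Defs
  imports "Graph_Theory.Graph_Theory"
begin

section \<open>Closed surfaces and the Euler genus\<close>

text \<open>
  A closed surface is given in the classical way, by a finite family of polygons whose sides are
  glued together in pairs.  A flag is one half of a side of one of the polygons.  The map
  \<open>along\<close> exchanges the two halves of a side, \<open>corner\<close> exchanges the two half-sides that meet in a
  corner of a polygon, and \<open>glue\<close> sends a half-side to the half-side it is identified with.
  Thus \<open>along\<close> and \<open>corner\<close> describe the disjoint polygons (monogons and digons are allowed), and
  \<open>glue\<close> describes the gluing.  Both orientable and nonorientable surfaces arise.
\<close>

record 'f polygon_gluing =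
  flags :: "'f set"
  along :: "'f \<Rightarrow> 'f"
  corner :: "'f \<Rightarrow> 'f"
  glue :: "'f \<Rightarrow> 'f"

definition cells :: "'f polygon_gluing \<Rightarrow> ('f \<Rightarrow> 'f) set \<Rightarrow> 'f set set" where
  "cells S T = flags S // {(f, t f) | f t. f \<in> flags S \<and> t \<in> T}\<^sup>*"

definition vertex_cells :: "'f polygon_gluing \<Rightarrow> 'f set set" where
  "vertex_cells S = cells S {corner S, glue S}"

definition edge_cells :: "'f polygon_gluing \<Rightarrow> 'f set set" where
  "edge_cells S = cells S {along S, glue S}"

definition face_cells :: "'f polygon_gluing \<Rightarrow> 'f set set" where
  "face_cells S = cells S {along S, corner S}"

definition fpf_involution_on :: "'f set \<Rightarrow> ('f \<Rightarrow> 'f) \<Rightarrow> bool" where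
  "fpf_involution_on F t \<longleftrightarrow> (\<forall>f\<in>F. t f \<in> F \<and> t f \<noteq> f \<and> t (t f) = f)"

text \<open>
  The condition on \<open>along\<close> and \<open>glue\<close> says that whole sides are glued to whole sides, and that no
  side is glued to itself.
\<close>

definition closed_surface :: "'f polygon_gluing \<Rightarrow> bool" where
  "closed_surface S \<longleftrightarrow>
     finite (flags S) \<and>
     fpf_involution_on (flags S) (along S) \<and>
     fpf_involution_on (flags S) (corner S) \<and>
     fpf_involution_on (flags S) (glue S) \<and>
     (\<forall>f\<in>flags S. glue S (along S f) = along S (glue S f) \<and> glue S f \<noteq> along S f) \<and>
     card (cells S {along S, corner S, glue S}) = 1"

definition euler_char :: "'f polygon_gluing \<Rightarrow> int" where
  "euler_char S =
     int (card (vertex_cells S)) - int (card (edge_cells S)) + int (card (face_cells S))"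

definition surface_euler_genus :: "'f polygon_gluing \<Rightarrow> int" where
  "surface_euler_genus S = 2 - euler_char S"

text \<open>
  A finite simple graph is a \<^const>\<open>pair_graph\<close>: an edge \<open>uv\<close> is the pair of arcs \<open>(u,v)\<close>, \<open>(v,u)\<close>.
  It is drawn in the surface as a subgraph of the 1-skeleton of the cell decomposition.  The
  graph need not be connected or fill up the 1-skeleton, so its faces need not be discs.
  As \<open>\<eta>\<close> is injective, different edges of the graph use different edges of the 1-skeleton.
\<close>

definition embeds_in :: "'a pair_pre_digraph \<Rightarrow> 'f polygon_gluing \<Rightarrow> bool" where
  "embeds_in G S \<longleftrightarrow>
     (\<exists>\<eta>. inj_on \<eta> (pverts G) \<and> \<eta> ` pverts G \<subseteq> vertex_cells S \<and>
       (\<forall>(u, v)\<in>parcs G. \<exists>e\<in>edge_cells S. {c \<in> vertex_cells S. c \<inter> e \<noteq> {}} = {\<eta> u, \<eta> v}))"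

definition euler_genus :: "'a pair_pre_digraph \<Rightarrow> nat" where
  "euler_genus G =
     (LEAST k. \<exists>S :: nat polygon_gluing.
        closed_surface S \<and> surface_euler_genus S = int k \<and> embeds_in G S)"


section \<open>Graphs with two terminals\<close>

definition Gxy :: "'a \<Rightarrow> 'a \<Rightarrow> 'a pair_pre_digraph set" where
  "Gxy x y = {G. pair_graph G \<and> x \<in> pverts G \<and> y \<in> pverts G \<and> x \<noteq> y}"

definition Gxy_o :: "'a \<Rightarrow> 'a \<Rightarrow> 'a pair_pre_digraph set" where
  "Gxy_o x y = {G \<in> Gxy x y. (x, y) \<notin> parcs G}"

definition add_xy :: "'a \<Rightarrow> 'a \<Rightarrow> 'a pair_pre_digraph \<Rightarrow> 'a pair_pre_digraph" where
  "add_xy x y G = \<lparr>pverts = pverts G, parcs = parcs G \<union> {(x, y), (y, x)}\<rparr>"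

definition euler_genus_plus :: "'a \<Rightarrow> 'a \<Rightarrow> 'a pair_pre_digraph \<Rightarrow> nat" where
  "euler_genus_plus x y G = euler_genus (add_xy x y G)"

definition xy_sum ::
    "'a \<Rightarrow> 'a \<Rightarrow> 'a pair_pre_digraph \<Rightarrow> 'a pair_pre_digraph \<Rightarrow> 'a pair_pre_digraph \<Rightarrow> bool" where
  "xy_sum x y G\<^sub>1 G\<^sub>2 G \<longleftrightarrow>
     pverts G\<^sub>1 \<inter> pverts G\<^sub>2 = {x, y} \<and>
     G = \<lparr>pverts = pverts G\<^sub>1 \<union> pverts G\<^sub>2, parcs = parcs G\<^sub>1 \<union> parcs G\<^sub>2\<rparr>"

text \<open>
  \<open>Contract u v\<close> contracts the edge \<open>uv\<close> and calls the new vertex \<open>u\<close>.  It is a minor-operation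
  only if \<open>v\<close> is not a terminal; an edge other than \<open>xy\<close> has such an end, and with this
  choice the terminals of the contracted graph are again \<open>x\<close> and \<open>y\<close>.
\<close>

datatype 'a minor_operation = Delete 'a 'a | Contract 'a 'a

definition minor_operations :: "'a \<Rightarrow> 'a \<Rightarrow> 'a pair_pre_digraph \<Rightarrow> 'a minor_operation set" where
  "minor_operations x y G =
     {Delete u v | u v. (u, v) \<in> parcs G} \<union>
     {Contract u v | u v. (u, v) \<in> parcs G \<and> v \<notin> {x, y}}"

fun apply_op :: "'a minor_operation \<Rightarrow> 'a pair_pre_digraph \<Rightarrow> 'a pair_pre_digraph" where
  "apply_op (Delete u v) G = \<lparr>pverts = pverts G, parcs = parcs G - {(u, v), (v, u)}\<rparr>"
| "apply_op (Contract u v) G =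
     (let q = id(v := u)
      in \<lparr>pverts = q ` pverts G, parcs = {(q a, q b) | a b. (a, b) \<in> parcs G \<and> q a \<noteq> q b}\<rparr>)"

definition critical ::
    "'a \<Rightarrow> 'a \<Rightarrow> ('a pair_pre_digraph \<Rightarrow> nat) \<Rightarrow> 'a pair_pre_digraph \<Rightarrow> bool" where
  "critical x y P G \<longleftrightarrow> (\<forall>\<mu>\<in>minor_operations x y G. P (apply_op \<mu> G) < P G)"

definition critical_class_o ::
    "'a \<Rightarrow> 'a \<Rightarrow> nat \<Rightarrow> ('a pair_pre_digraph \<Rightarrow> nat) \<Rightarrow> 'a pair_pre_digraph set" where
  "critical_class_o x y k P = {G \<in> Gxy_o x y. critical x y P G \<and> P G = k + 1}"


section \<open>Connectivity\<close>

abbreviation graph_connected :: "'a pair_pre_digraph \<Rightarrow> bool" where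
  "graph_connected G \<equiv> Digraph_Component.connected (with_proj G)"

definition two_connected :: "'a pair_pre_digraph \<Rightarrow> bool" where
  "two_connected G \<longleftrightarrow>
     card (pverts G) > 2 \<and> graph_connected G \<and>
     (\<forall>v\<in>pverts G. Digraph_Component.connected (with_proj G \<restriction> (pverts G - {v})))"

text \<open>In the library the graph without vertices is not connected, hence the second conjunct.\<close>

definition vertex_cut :: "'a pair_pre_digraph \<Rightarrow> 'a set \<Rightarrow> bool" where
  "vertex_cut G X \<longleftrightarrow>
     X \<subseteq> pverts G \<and> pverts G - X \<noteq> {} \<and>
     \<not> Digraph_Component.connected (with_proj G \<restriction> (pverts G - X))"

end

theory Submission
  imports Defs
begin

text \<open>
  Everything follows from additivity: if \<open>G\<close> is the \<open>xy\<close>-sum of \<open>G\<^sub>1\<close> and \<open>G\<^sub>2\<close>, then the Euler genus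
  of \<open>G\<^sup>+\<close> is the sum of those of \<open>G\<^sub>1\<^sup>+\<close> and \<open>G\<^sub>2\<^sup>+\<close>.  A minor-operation on \<open>G\<close> acts in one of the
  summands, so \<open>G\<close> is critical if and only if both summands are, and a critical graph with an edge
  has positive genus, so that \<open>3\<close> splits as \<open>1 + 2\<close>.

  An embedding is treated as a matching of the flags at the corners, with the sides and their
  gluing fixed; it is modified by replacing two pairs of the matching at a time.  For the
  inequality \<open>\<le>\<close>, two embeddings are merged along the edge \<open>xy\<close>.  For \<open>\<ge>\<close>, delete the edges outside
  the graph, double the edge \<open>xy\<close> so that a digonal face appears, and give each copy to one side.
  Among all embeddings choose one with the most faces and, subject to this, the fewest corners
  between the two sides.  Then every face that meets both sides has exactly one such corner
  at \<open>x\<close> and one at \<open>y\<close>.  Thus each side contributes strands of faces that lead from \<open>x\<close> to \<open>y\<close>,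
  and these can be paired up anew within each side so that \<open>x\<close> and \<open>y\<close> both split into one
  vertex per side; two strands of the same side then bound a face, as two strands of different
  sides did before, so no face is lost.
\<close>

section \<open>Counting classes\<close>

text \<open>The pairing at \<open>x\<close> dictates the pairing at \<open>y\<close>: two strands
  joined at one end have to be joined at the other as well, or a face could be lost. On each side,
  however, this one pairing must close the rotation at \<open>x\<close> and also the rotation at
  \<open>y\<close> into a single vertex. The combinatorial core is therefore that any two perfect
  matchings of a finite set have a common third one that forms a single cycle with each of them. The
  digon serves two purposes. It guarantees that both sides occur at both \<open>x\<close> and
  \<open>y\<close>, so that every flag there lies on an arc between mixed corners; and it offers to
  either side a place where a cut-off part of a vertex can be reattached. Components may fall apart
  on the way, so the genus is extended additively to disconnected gluings by
  \<open>2 C - V + E - F\<close>. The separation raises \<open>V\<close> by at least two and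
  \<open>C\<close> by at most one, keeps \<open>E\<close> and does not lower \<open>F\<close>, so
  this value does not grow. Closed surfaces enter only at the two ends of the argument, where
  components are joined by extra edges at no cost.\<close>

definition lnk :: "'f set \<Rightarrow> ('f \<Rightarrow> 'f) \<Rightarrow> ('f \<times> 'f) set" where
  "lnk X t = {(f, t f) | f. f \<in> X}"

definition ncl :: "'f set \<Rightarrow> ('f \<times> 'f) set \<Rightarrow> nat" where
  "ncl X R = card (X // R)"

lemma equiv_rtrancl: "sym r \<Longrightarrow> equiv UNIV (r\<^sup>*)"
  by (simp add: equiv_def refl_rtrancl sym_rtrancl trans_rtrancl)

lemma equivUD:
  assumes "equiv UNIV R"
  shows "(u, u) \<in> R" "(u, v) \<in> R \<Longrightarrow> (v, u) \<in> R"
    "(u, v) \<in> R \<Longrightarrow> (v, w) \<in> R \<Longrightarrow> (u, w) \<in> R"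
  using assms by (auto simp: equiv_def refl_on_def dest: symD transD)

lemma rtrancl_Image_subset:
  assumes "r \<subseteq> X \<times> X" "x \<in> X"
  shows "r\<^sup>* `` {x} \<subseteq> X"
proof -
  have "(x, z) \<in> r\<^sup>* \<Longrightarrow> z \<in> X" for z
    by (induction rule: rtrancl_induct) (use assms in auto)
  then show ?thesis by auto
qed

lemma rtrancl_closed:
  assumes "(a, b) \<in> r\<^sup>*" "a \<in> W" "\<And>u v. (u, v) \<in> r \<Longrightarrow> u \<in> W \<Longrightarrow> v \<in> W"
  shows "b \<in> W"
  using assms(1) by (induction rule: rtrancl_induct) (use assms in auto)

lemma finite_quotient_UNIV: "finite X \<Longrightarrow> finite (X // R)"
  by (simp add: quotient_def)

lemma ncl_antimono:
  assumes "finite X" "equiv UNIV R" "equiv UNIV R'" "R \<subseteq> R'"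
  shows "ncl X R' \<le> ncl X R"
proof -
  have "X // R' \<subseteq> (\<lambda>W. R' `` W) ` (X // R)"
  proof
    fix W assume "W \<in> X // R'"
    then obtain x where x: "x \<in> X" "W = R' `` {x}" by (auto simp: quotient_def)
    have "R' `` (R `` {x}) = R' `` {x}"
      using equivUD(1)[OF assms(2)] equivUD(3)[OF assms(3)] assms(4) by blast
    then show "W \<in> (\<lambda>W. R' `` W) ` (X // R)"
      using x by (metis image_eqI quotientI)
  qed
  then show ?thesis
    unfolding ncl_def by (meson assms(1) finite_quotient_UNIV finite_imageI card_mono card_image_le le_trans)
qed

definition join :: "('f \<times> 'f) set \<Rightarrow> 'f \<Rightarrow> 'f \<Rightarrow> ('f \<times> 'f) set" where
  "join R a b = R \<union> (R `` {a}) \<times> (R `` {b}) \<union> (R `` {b}) \<times> (R `` {a})"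

text \<open>One more symmetric link unites at most two classes. Vertices, faces and components are
  counted by adding links one at a time in this way.\<close>

lemma rtrancl_add_link:
  assumes "sym r"
  shows "(r \<union> {(a, b), (b, a)})\<^sup>* = join (r\<^sup>*) a b" (is "?L = ?R")
proof
  have s: "(v, u) \<in> r\<^sup>*" if "(u, v) \<in> r\<^sup>*" for u v
    using that sym_rtrancl[OF assms] by (meson symD)
  show "?L \<subseteq> ?R"
  proof (rule subrelI)
    fix u v assume "(u, v) \<in> ?L"
    then show "(u, v) \<in> ?R"
    proof (induction rule: rtrancl_induct)
      case base then show ?case by (auto simp: join_def)
    next
      case (step y z)
      then show ?case
        unfolding join_def
        by (auto intro: rtrancl_into_rtrancl dest: s rtrancl_trans)
    qed
  qed
  have m: "(u, v) \<in> ?L" if "(u, v) \<in> r\<^sup>*" for u v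
    using that by (meson Un_upper1 rtrancl_mono subsetD)
  show "?R \<subseteq> ?L"
  proof (rule subrelI)
    fix u v assume "(u, v) \<in> ?R"
    then consider "(u, v) \<in> r\<^sup>*" | "(a, u) \<in> r\<^sup>*" "(b, v) \<in> r\<^sup>*"
      | "(b, u) \<in> r\<^sup>*" "(a, v) \<in> r\<^sup>*"
      by (auto simp: join_def)
    then show "(u, v) \<in> ?L"
    proof cases
      case 1 then show ?thesis by (rule m)
    next
      case 2
      have "(u, a) \<in> ?L" "(b, v) \<in> ?L" using 2 s m by blast+
      moreover have "(a, b) \<in> ?L" by auto
      ultimately show ?thesis by (meson rtrancl_trans)
    next
      case 3
      have "(u, b) \<in> ?L" "(a, v) \<in> ?L" using 3 s m by blast+
      moreover have "(b, a) \<in> ?L" by auto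
      ultimately show ?thesis by (meson rtrancl_trans)
    qed
  qed
qed

lemma join_same:
  assumes "equiv UNIV R" "(a, b) \<in> R"
  shows "join R a b = R"
proof -
  have "(v, w) \<in> R" if "(a, v) \<in> R \<and> (b, w) \<in> R \<or> (b, v) \<in> R \<and> (a, w) \<in> R" for v w
    using that equivUD[OF assms(1)] assms(2) by meson
  then show ?thesis by (auto simp: join_def)
qed

lemma equiv_join: 
  assumes "equiv UNIV R"
  shows "equiv UNIV (join R a b)"
proof -
  have "sym R" "R\<^sup>* = R"
    using assms by (auto simp: equiv_def refl_on_def rtrancl_trancl_reflcl trancl_id)
  then have "join R a b = (R \<union> {(a, b), (b, a)})\<^sup>*"
    using rtrancl_add_link by metis
  moreover have "sym (R \<union> {(a, b), (b, a)})" using \<open>sym R\<close> by (auto simp: sym_def)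
  ultimately show ?thesis using equiv_rtrancl by metis
qed

lemma ncl_join:
  assumes "finite X" "equiv UNIV R" "a \<in> X" "b \<in> X" "(a, b) \<notin> R"
  shows "ncl X (join R a b) + 1 = ncl X R"
proof -
  let ?A = "R `` {a}" and ?B = "R `` {b}" and ?J = "join R a b"
  have cls: "?J `` {x} = (if x \<in> ?A \<or> x \<in> ?B then ?A \<union> ?B else R `` {x})" for x
  proof -
    have "y \<in> ?J `` {x} \<longleftrightarrow> (x, y) \<in> R \<or> (a, x) \<in> R \<and> (b, y) \<in> R \<or> (b, x) \<in> R \<and> (a, y) \<in> R" for y
      by (auto simp: join_def)
    moreover have "(x, y) \<in> R \<longleftrightarrow> (v, y) \<in> R" if "(v, x) \<in> R" for v y
      using equivUD(2,3)[OF assms(2)] that by meson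
    moreover have "\<not> ((a, x) \<in> R \<and> (b, x) \<in> R)"
      using equivUD(2,3)[OF assms(2)] assms(5) by meson
    ultimately show ?thesis by (intro set_eqI) auto
  qed
  have AB: "?A \<noteq> ?B" "?A \<in> X // R" "?B \<in> X // R"
    using assms equiv_class_eq_iff[OF assms(2)] by (auto intro: quotientI)
  have eqA: "R `` {x} = ?A \<longleftrightarrow> x \<in> ?A" "R `` {x} = ?B \<longleftrightarrow> x \<in> ?B" for x
    using equiv_class_eq_iff[OF assms(2)] by (auto dest: sym)
  have q: "X // ?J = insert (?A \<union> ?B) (X // R - {?A, ?B})"
  proof (intro equalityI subsetI)
    fix W assume "W \<in> X // ?J"
    then obtain x where "x \<in> X" "W = ?J `` {x}" by (auto simp: quotient_def)
    then show "W \<in> insert (?A \<union> ?B) (X // R - {?A, ?B})"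
      unfolding cls using eqA[of x] by (auto intro: quotientI)
  next
    fix W assume "W \<in> insert (?A \<union> ?B) (X // R - {?A, ?B})"
    then consider "W = ?A \<union> ?B" | x where "x \<in> X" "W = R `` {x}" "W \<noteq> ?A" "W \<noteq> ?B"
      by (auto simp: quotient_def)
    then show "W \<in> X // ?J"
    proof cases
      case 1
      moreover have "a \<in> ?A" using assms(2) by (auto simp: equiv_def refl_on_def)
      ultimately have "W = ?J `` {a}" using cls[of a] by simp
      then show ?thesis using assms(3) by (auto intro: quotientI)
    next
      case 2
      then have "W = ?J `` {x}" using cls[of x] eqA[of x] by auto
      then show ?thesis using 2 by (auto intro: quotientI)
    qed
  qed
  have ni: "?A \<union> ?B \<notin> X // R - {?A, ?B}"
  proof
    assume "?A \<union> ?B \<in> X // R - {?A, ?B}"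
    then obtain x where "?A \<union> ?B = R `` {x}" "R `` {x} \<noteq> ?A" by (auto simp: quotient_def)
    moreover have "a \<in> ?A" using assms(2) by (auto simp: equiv_def refl_on_def)
    ultimately show False using equiv_class_eq_iff[OF assms(2)] by blast
  qed
  have fin: "finite (X // R)" using assms(1) by (rule finite_quotient_UNIV)
  have "card (X // R - {?A, ?B}) = card (X // R) - 2"
    using AB fin by (subst card_Diff_subset) auto
  moreover have "card (X // R) \<ge> 2"
    using AB fin card_mono[of "X // R" "{?A, ?B}"] by auto
  ultimately show ?thesis
    unfolding ncl_def q using ni fin by simp
qed

lemma ncl_join_ge:
  assumes "finite X" "equiv UNIV R" "a \<in> X" "b \<in> X"
  shows "ncl X R \<le> ncl X (join R a b) + 1"
proof (cases "(a, b) \<in> R")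
  case True
  then show ?thesis using join_same[OF assms(2)] by simp
next
  case False
  then show ?thesis using ncl_join[OF assms False] by simp
qed

section \<open>Cutting a union of two matchings\<close>

lemma lnk_Un: "lnk (X \<union> Y) t = lnk X t \<union> lnk Y t"
  by (auto simp: lnk_def)

lemma lnk_cong: "(\<And>f. f \<in> X \<Longrightarrow> t f = t' f) \<Longrightarrow> lnk X t = lnk X t'"
  by (auto simp: lnk_def)

lemma lnk_iff: "(u, v) \<in> lnk X t \<longleftrightarrow> u \<in> X \<and> v = t u"
  by (auto simp: lnk_def)

lemma fpfD:
  assumes "fpf_involution_on X t" "f \<in> X"
  shows "t f \<in> X" "t f \<noteq> f" "t (t f) = f"
  using assms by (auto simp: fpf_involution_on_def)

lemma sym_lnk: "fpf_involution_on X t \<Longrightarrow> sym (lnk X t)"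
  by (auto simp: sym_def lnk_def fpf_involution_on_def)

lemma lnk_subset: "fpf_involution_on X t \<Longrightarrow> lnk X t \<subseteq> X \<times> X"
  by (auto simp: lnk_def fpf_involution_on_def)

text \<open>
  The graph formed by a perfect matching and a matching that leaves exactly \<open>U\<close> uncovered has
  maximum degree two, and \<open>U\<close> is the set of ends of its path components.
\<close>

lemma path_ends:
  assumes "finite X" "fpf_involution_on X t" "fpf_involution_on (X - U) c" "U \<subseteq> X" "a \<in> U"
  shows "\<exists>z\<in>U. z \<noteq> a \<and> (lnk X t \<union> lnk (X - U) c)\<^sup>* `` {a} \<inter> U = {a, z}"
  using assms
proof (induction "card X" arbitrary: X U a rule: less_induct)
  case less
  let ?K = "lnk X t \<union> lnk (X - U) c"
  define b where "b = t a"
  have aX: "a \<in> X" using less.prems by auto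
  have b: "b \<in> X" "b \<noteq> a" "t b = a" using fpfD[OF less.prems(2) aX] by (auto simp: b_def)
  have ab: "(a, b) \<in> ?K" using aX by (auto simp: lnk_def b_def)
  show ?case
  proof (cases "b \<in> U")
    case True
    have "?K\<^sup>* `` {a} \<subseteq> {a, b}"
    proof
      fix v assume "v \<in> ?K\<^sup>* `` {a}"
      then have "(a, v) \<in> ?K\<^sup>*" by auto
      then show "v \<in> {a, b}"
        by (rule rtrancl_closed) (use True b less.prems in \<open>auto simp: lnk_def b_def\<close>)
    qed
    moreover have "{a, b} \<subseteq> ?K\<^sup>* `` {a}" using ab by auto
    ultimately show ?thesis using True b less.prems by (intro bexI[of _ b]) auto
  next
    case False
    define d where "d = c b"
    have bXU: "b \<in> X - U" using False b by auto
    have d: "d \<in> X" "d \<notin> U" "d \<noteq> b" "c d = b"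
      using fpfD[OF less.prems(3) bXU] by (auto simp: d_def)
    have da: "d \<noteq> a" using d less.prems by auto
    \<comment> \<open>The path starts with \<open>a\<close>, \<open>b\<close>, \<open>d\<close>. Its
      first two flags are removed, and \<open>d\<close>, no longer covered by \<open>c\<close>,
      becomes the end at which the shorter path starts.\<close>
    define X' where "X' = X - {a, b}"
    define U' where "U' = insert d (U - {a})"
    let ?K' = "lnk X' t \<union> lnk (X' - U') c"
    have "X' - U' = X - U - {b, d}" using less.prems by (auto simp: X'_def U'_def)
    have t': "fpf_involution_on X' t"
      unfolding fpf_involution_on_def
    proof
      fix f assume f: "f \<in> X'"
      then have "f \<in> X" "f \<noteq> a" "f \<noteq> b" by (auto simp: X'_def)
      moreover have "t f \<noteq> a" "t f \<noteq> b"
        using fpfD[OF less.prems(2) \<open>f \<in> X\<close>] \<open>f \<noteq> a\<close> \<open>f \<noteq> b\<close> b by (auto simp: b_def)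
      ultimately show "t f \<in> X' \<and> t f \<noteq> f \<and> t (t f) = f"
        using fpfD[OF less.prems(2)] by (auto simp: X'_def)
    qed
    have c': "fpf_involution_on (X' - U') c"
      unfolding fpf_involution_on_def
    proof
      fix f assume f: "f \<in> X' - U'"
      then have f: "f \<in> X - U" "f \<noteq> b" "f \<noteq> d" by (auto simp: \<open>X' - U' = _\<close>)
      moreover have "c f \<noteq> b" "c f \<noteq> d"
        using fpfD[OF less.prems(3) f(1)] f d by (auto simp: d_def)
      ultimately show "c f \<in> X' - U' \<and> c f \<noteq> f \<and> c (c f) = f"
        using fpfD[OF less.prems(3)] by (auto simp: \<open>X' - U' = _\<close>)
    qed
    have "card X' < card X"
      unfolding X'_def using less.prems(1) aX by (intro psubset_card_mono) auto
    moreover have "finite X'" "U' \<subseteq> X'" "d \<in> U'"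
      using less.prems d da False by (auto simp: X'_def U'_def)
    ultimately obtain z where z: "z \<in> U'" "z \<noteq> d" "?K'\<^sup>* `` {d} \<inter> U' = {d, z}"
      using less.hyps[of X' U' d] t' c' by auto
    have KK: "?K' \<subseteq> ?K" using \<open>X' - U' = _\<close> by (auto simp: lnk_def X'_def)
    have KX': "?K' \<subseteq> X' \<times> X'"
      using lnk_subset[OF t'] lnk_subset[OF c'] by auto
    have eq: "?K\<^sup>* `` {a} = {a, b} \<union> ?K'\<^sup>* `` {d}"
    proof
      have "(b, d) \<in> ?K" using bXU by (auto simp: lnk_def d_def)
      then have "(a, d) \<in> ?K\<^sup>*" using ab by (meson r_into_rtrancl rtrancl_into_rtrancl)
      moreover have "?K'\<^sup>* \<subseteq> ?K\<^sup>*" using KK by (rule rtrancl_mono)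
      ultimately show "{a, b} \<union> ?K'\<^sup>* `` {d} \<subseteq> ?K\<^sup>* `` {a}"
        using ab by (auto dest: rtrancl_trans)
      show "?K\<^sup>* `` {a} \<subseteq> {a, b} \<union> ?K'\<^sup>* `` {d}"
      proof
        fix v assume "v \<in> ?K\<^sup>* `` {a}"
        then have "(a, v) \<in> ?K\<^sup>*" by auto
        then show "v \<in> {a, b} \<union> ?K'\<^sup>* `` {d}"
        proof (rule rtrancl_closed)
          fix u w assume uw: "(u, w) \<in> ?K" and u: "u \<in> {a, b} \<union> ?K'\<^sup>* `` {d}"
          consider "u = a" | "u = b" | "u = d" | "u \<noteq> a" "u \<noteq> b" "u \<noteq> d" "(d, u) \<in> ?K'\<^sup>*"
            using u by auto
          then show "w \<in> {a, b} \<union> ?K'\<^sup>* `` {d}"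
          proof cases
            case 1 then show ?thesis using uw less.prems by (auto simp: lnk_def b_def)
          next
            case 2 then show ?thesis using uw b by (auto simp: lnk_def d_def)
          next
            case 3
            have "(d, t d) \<in> ?K'" using d da by (auto simp: lnk_def X'_def)
            then show ?thesis using 3 uw d by (auto simp: lnk_def)
          next
            case 4
            have "u \<in> X'" using rtrancl_Image_subset[OF KX'] 4 \<open>U' \<subseteq> X'\<close> \<open>d \<in> U'\<close> by blast
            have "(u, w) \<in> ?K'"
              using uw 4 \<open>u \<in> X'\<close> by (auto simp: lnk_def X'_def U'_def)
            then show ?thesis using 4 by (auto intro: rtrancl_into_rtrancl)
          qed
        qed simp
      qed
    qed
    have dd: "?K'\<^sup>* `` {d} \<subseteq> X'"
      using rtrancl_Image_subset[OF KX'] \<open>U' \<subseteq> X'\<close> \<open>d \<in> U'\<close> by blast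
    have "?K'\<^sup>* `` {d} \<inter> U = ?K'\<^sup>* `` {d} \<inter> U' - {d}"
      using dd d(2) by (auto simp: U'_def X'_def)
    then have "?K'\<^sup>* `` {d} \<inter> U = {z}" using z(2,3) by auto
    then have "?K\<^sup>* `` {a} \<inter> U = {a, z}"
      unfolding eq Int_Un_distrib2 using False less.prems(5) by auto
    moreover have "z \<in> U" "z \<noteq> a" using z da by (auto simp: U'_def)
    ultimately show ?thesis by blast
  qed
qed

lemma path_partner:
  assumes "finite X" "fpf_involution_on X t" "fpf_involution_on (X - U) c" "U \<subseteq> X" "a \<in> U"
  shows "\<exists>!z. z \<in> U \<and> z \<noteq> a \<and> (a, z) \<in> (lnk X t \<union> lnk (X - U) c)\<^sup>*"
proof -
  obtain z where z: "z \<in> U" "z \<noteq> a" "(lnk X t \<union> lnk (X - U) c)\<^sup>* `` {a} \<inter> U = {a, z}"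
    using path_ends[OF assms] by blast
  then have "w \<in> U \<and> w \<noteq> a \<and> (a, w) \<in> (lnk X t \<union> lnk (X - U) c)\<^sup>* \<longleftrightarrow> w = z" for w
    by (metis (no_types, lifting) Image_singleton_iff IntD1 IntI insertCI insertE singletonD)
  then show ?thesis by simp
qed

section \<open>Switching two corners\<close>

text \<open>Together with the corner map \<open>c\<close>, the choice \<open>t = g\<close> yields
  the vertices and \<open>t = l\<close> the faces; \<open>orel X l g\<close> yields the edges. The
  closure is reflexive off \<open>X\<close> too, so that it can be an equivalence on the whole
  type.\<close>

definition orel :: "'f set \<Rightarrow> ('f \<Rightarrow> 'f) \<Rightarrow> ('f \<Rightarrow> 'f) \<Rightarrow> ('f \<times> 'f) set" where
  "orel X t c = (lnk X t \<union> lnk X c)\<^sup>*"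

definition crel :: "'f set \<Rightarrow> ('f \<Rightarrow> 'f) \<Rightarrow> ('f \<Rightarrow> 'f) \<Rightarrow> ('f \<Rightarrow> 'f) \<Rightarrow> ('f \<times> 'f) set" where
  "crel X l g c = (lnk X l \<union> lnk X g \<union> lnk X c)\<^sup>*"

text \<open>The elementary surgery on an embedding: one of the two ways to rematch the four flags of
  two corners. The other one is \<open>sw c a (c b)\<close>.\<close>

definition sw :: "('f \<Rightarrow> 'f) \<Rightarrow> 'f \<Rightarrow> 'f \<Rightarrow> 'f \<Rightarrow> 'f" where
  "sw c a b = c(a := b, b := a, c a := c b, c b := c a)"

lemma join_cong:
  assumes "equiv UNIV R" "(b, b') \<in> R"
  shows "join R a b = join R a b'"
  using equiv_class_eq_iff[OF assms(1), of b b'] assms(2) by (simp add: join_def)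

lemma join_mem: 
  assumes "equiv UNIV R"
  shows "(a, b) \<in> join R a b" "(b, a) \<in> join R a b" "R \<subseteq> join R a b"
  using equivUD(1)[OF assms] by (auto simp: join_def)

lemma join_least:
  assumes "equiv UNIV R'" "R \<subseteq> R'" "(a, b) \<in> R'"
  shows "join R a b \<subseteq> R'"
proof (rule subrelI)
  fix u v assume "(u, v) \<in> join R a b"
  then have "(u, v) \<in> R' \<or> (a, u) \<in> R' \<and> (b, v) \<in> R' \<or> (b, u) \<in> R' \<and> (a, v) \<in> R'"
    using assms(2) by (auto simp: join_def)
  then show "(u, v) \<in> R'" using equivUD(2,3)[OF assms(1)] assms(3) by meson
qed

lemma equiv_orel:
  "fpf_involution_on X t \<Longrightarrow> fpf_involution_on X c \<Longrightarrow> equiv UNIV (orel X t c)"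
  unfolding orel_def by (intro equiv_rtrancl sym_Un sym_lnk)

lemma equiv_crel:
  "fpf_involution_on X l \<Longrightarrow> fpf_involution_on X g \<Longrightarrow> fpf_involution_on X c \<Longrightarrow> equiv UNIV (crel X l g c)"
  unfolding crel_def by (intro equiv_rtrancl sym_Un sym_lnk)

lemma orel_subset:
  assumes "fpf_involution_on X t" "fpf_involution_on X c" "(u, v) \<in> orel X t c" "u \<in> X"
  shows "v \<in> X"
  using rtrancl_Image_subset[of "lnk X t \<union> lnk X c" X u] assms lnk_subset[OF assms(1)] lnk_subset[OF assms(2)]
  by (auto simp: orel_def)

lemma orel_stepI: "f \<in> X \<Longrightarrow> (f, t f) \<in> orel X t c" "f \<in> X \<Longrightarrow> (f, c f) \<in> orel X t c"
  by (auto simp: orel_def lnk_def)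

lemma crel_stepI: "f \<in> X \<Longrightarrow> (f, l f) \<in> crel X l g c" "f \<in> X \<Longrightarrow> (f, g f) \<in> crel X l g c"
  "f \<in> X \<Longrightarrow> (f, c f) \<in> crel X l g c"
  by (auto simp: crel_def lnk_def)

lemma orel_subset_crel: "orel X l c \<subseteq> crel X l g c" "orel X g c \<subseteq> crel X l g c"
  unfolding orel_def crel_def by (auto intro!: rtrancl_mono)

lemma orel_least:
  assumes "equiv UNIV R" "\<And>f. f \<in> X \<Longrightarrow> (f, t f) \<in> R" "\<And>f. f \<in> X \<Longrightarrow> (f, c f) \<in> R"
  shows "orel X t c \<subseteq> R"
proof -
  have "R\<^sup>* = R"
    using assms(1) by (auto simp: equiv_def refl_on_def rtrancl_trancl_reflcl trancl_id)
  moreover have "lnk X t \<union> lnk X c \<subseteq> R" using assms by (auto simp: lnk_def)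
  ultimately show ?thesis unfolding orel_def by (metis rtrancl_mono)
qed

lemma crel_least:
  assumes "equiv UNIV R" "\<And>f. f \<in> X \<Longrightarrow> (f, l f) \<in> R" "\<And>f. f \<in> X \<Longrightarrow> (f, g f) \<in> R"
    "\<And>f. f \<in> X \<Longrightarrow> (f, c f) \<in> R"
  shows "crel X l g c \<subseteq> R"
proof -
  have "R\<^sup>* = R"
    using assms(1) by (auto simp: equiv_def refl_on_def rtrancl_trancl_reflcl trancl_id)
  moreover have "lnk X l \<union> lnk X g \<union> lnk X c \<subseteq> R" using assms by (auto simp: lnk_def)
  ultimately show ?thesis unfolding crel_def by (metis rtrancl_mono)
qed

locale switch =
  fixes X :: "'f set" and c :: "'f \<Rightarrow> 'f" and a b :: 'f
  assumes fin: "finite X" and c: "fpf_involution_on X c"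
    and aX: "a \<in> X" and bX: "b \<in> X" and ba: "b \<noteq> a" and bca: "b \<noteq> c a"
begin

abbreviation "ends \<equiv> {a, c a, b, c b}"

abbreviation "cutrel t \<equiv> (lnk X t \<union> lnk (X - ends) c)\<^sup>*"

lemma ends_in: "c a \<in> X" "c b \<in> X" "c (c a) = a" "c (c b) = b" "c a \<noteq> a" "c b \<noteq> b" "c b \<noteq> a" "c a \<noteq> c b"
  using fpfD[OF c aX] fpfD[OF c bX] ba bca by auto

lemma sw_simps [simp]: "sw c a b a = b" "sw c a b b = a" "sw c a b (c a) = c b" "sw c a b (c b) = c a"
  "f \<notin> ends \<Longrightarrow> sw c a b f = c f"
  using ends_in ba bca by (auto simp: sw_def)

lemma c_ends: "f \<in> X \<Longrightarrow> f \<notin> ends \<Longrightarrow> c f \<notin> ends"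
  using imageI[of "c f" ends c] fpfD(3)[OF c, of f] ends_in by auto

lemma c_cut: "fpf_involution_on (X - ends) c"
  using c_ends fpfD[OF c] unfolding fpf_involution_on_def by auto

lemma fpf_sw: "fpf_involution_on X (sw c a b)"
  unfolding fpf_involution_on_def
proof
  fix f assume f: "f \<in> X"
  show "sw c a b f \<in> X \<and> sw c a b f \<noteq> f \<and> sw c a b (sw c a b f) = f"
  proof (cases "f \<in> ends")
    case True
    then show ?thesis using ends_in aX bX ba bca by auto
  next
    case False
    then show ?thesis using c_ends[OF f False] fpfD[OF c f] by simp
  qed
qed

lemma lnk_c: "lnk X c = lnk (X - ends) c \<union> {(a, c a), (c a, a)} \<union> {(b, c b), (c b, b)}"
  using ends_in aX bX by (auto simp: lnk_def)

lemma lnk_sw: "lnk X (sw c a b) = lnk (X - ends) c \<union> {(a, b), (b, a)} \<union> {(c a, c b), (c b, c a)}"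
proof -
  have "lnk X (sw c a b) = lnk (X - ends) (sw c a b) \<union> lnk ends (sw c a b)"
    unfolding lnk_Un[symmetric] by (rule arg_cong[where f = "\<lambda>Y. lnk Y _"]) (use ends_in aX bX in auto)
  moreover have "lnk (X - ends) (sw c a b) = lnk (X - ends) c" by (rule lnk_cong) simp
  moreover have "lnk ends (sw c a b) = {(a, b), (b, a)} \<union> {(c a, c b), (c b, c a)}"
    by (auto simp: lnk_iff)
  ultimately show ?thesis by blast
qed

end

locale switch_with = switch X c a b for X :: "'f set" and c a b +
  fixes t :: "'f \<Rightarrow> 'f"
  assumes t: "fpf_involution_on X t"
begin

abbreviation "K \<equiv> cutrel t"

lemma sym_cut: "sym (lnk X t \<union> lnk (X - ends) c)"
  by (intro sym_Un sym_lnk t c_cut)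

lemma equiv_K: "equiv UNIV K"
  by (rule equiv_rtrancl[OF sym_cut])

lemmas K_sym = equivUD(2)[OF equiv_K]
  and K_trans = equivUD(3)[OF equiv_K]

text \<open>Before and after the switch the orbits arise from the same relation \<open>K\<close>, in
  which both corners are cut open, by adding two links. Comparing the two amounts to knowing how
  \<open>K\<close> connects the four ends.\<close>

lemma orel_c: "orel X t c = join (join K a (c a)) b (c b)"
proof -
  have "orel X t c = ((lnk X t \<union> lnk (X - ends) c) \<union> {(a, c a), (c a, a)} \<union> {(b, c b), (c b, b)})\<^sup>*"
    unfolding orel_def lnk_c by (simp add: Un_assoc)
  also have "\<dots> = join (((lnk X t \<union> lnk (X - ends) c) \<union> {(a, c a), (c a, a)})\<^sup>*) b (c b)"
    using sym_cut by (intro rtrancl_add_link) (auto simp: sym_def)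
  also have "\<dots> = join (join K a (c a)) b (c b)"
    using sym_cut by (subst rtrancl_add_link) auto
  finally show ?thesis .
qed

lemma orel_sw: "orel X t (sw c a b) = join (join K a b) (c a) (c b)"
proof -
  have "orel X t (sw c a b) = ((lnk X t \<union> lnk (X - ends) c) \<union> {(a, b), (b, a)} \<union> {(c a, c b), (c b, c a)})\<^sup>*"
    unfolding orel_def lnk_sw by (simp add: Un_assoc)
  also have "\<dots> = join (((lnk X t \<union> lnk (X - ends) c) \<union> {(a, b), (b, a)})\<^sup>*) (c a) (c b)"
    using sym_cut by (intro rtrancl_add_link) (auto simp: sym_def)
  also have "\<dots> = join (join K a b) (c a) (c b)"
    using sym_cut by (subst rtrancl_add_link) auto
  finally show ?thesis .
qed

lemma K_partner:
  assumes "u \<in> ends"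
  shows "\<exists>!z. z \<in> ends \<and> z \<noteq> u \<and> (u, z) \<in> K"
  using path_partner[OF fin t c_cut _ assms] ends_in aX bX by blast

text \<open>Each of the four ends is an end of a path of the cut structure, and such a path has
  exactly one other end. This leaves the three perfect matchings of four points.\<close>

lemma K_pairing:
  "(a, c a) \<in> K \<and> (b, c b) \<in> K \<and> (a, b) \<notin> K \<and> (a, c b) \<notin> K \<and> (c a, b) \<notin> K \<and> (c a, c b) \<notin> K \<or>
   (a, b) \<in> K \<and> (c a, c b) \<in> K \<and> (a, c a) \<notin> K \<and> (a, c b) \<notin> K \<and> (b, c a) \<notin> K \<and> (b, c b) \<notin> K \<or>
   (a, c b) \<in> K \<and> (c a, b) \<in> K \<and> (a, c a) \<notin> K \<and> (a, b) \<notin> K \<and> (c b, c a) \<notin> K \<and> (c b, b) \<notin> K"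
proof -
  have un: "z = w" if "u \<in> ends" "z \<in> ends" "w \<in> ends" "z \<noteq> u" "w \<noteq> u" "(u, z) \<in> K" "(u, w) \<in> K" for u z w
    using K_partner[OF that(1)] that by blast
  obtain z where z: "z \<in> ends" "z \<noteq> a" "(a, z) \<in> K" using K_partner[of a] by blast
  obtain w where w: "w \<in> ends" "w \<noteq> c a" "(c a, w) \<in> K" using K_partner[of "c a"] by blast
  obtain v where v: "v \<in> ends" "v \<noteq> b" "(b, v) \<in> K" using K_partner[of b] by blast
  note ne = ends_in ba bca ba[symmetric] bca[symmetric]
  have in_ends: "a \<in> ends" "b \<in> ends" "c a \<in> ends" "c b \<in> ends" by auto
  consider "z = c a" | "z = b" | "z = c b" using z by auto
  then show ?thesis
  proof cases
    case 1
    have "(a, b) \<notin> K" using un[OF in_ends(1) in_ends(3) in_ends(2)] 1 z ne by auto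
    moreover have "(a, c b) \<notin> K" using un[OF in_ends(1) in_ends(3) in_ends(4)] 1 z ne by auto
    moreover have "(c a, b) \<notin> K" "(c a, c b) \<notin> K"
      using calculation 1 z(3) K_trans K_sym by blast+
    moreover have "(b, c b) \<in> K"
      using v calculation K_sym by auto
    ultimately show ?thesis using 1 z by auto
  next
    case 2
    have "(a, c a) \<notin> K" using un[OF in_ends(1) in_ends(2) in_ends(3)] 2 z ne by auto
    moreover have "(a, c b) \<notin> K" using un[OF in_ends(1) in_ends(2) in_ends(4)] 2 z ne by auto
    moreover have "(b, c a) \<notin> K" "(b, c b) \<notin> K"
      using calculation 2 z(3) K_trans K_sym by blast+
    moreover have "(c a, c b) \<in> K"
      using w calculation K_sym by auto
    ultimately show ?thesis using 2 z by auto
  next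
    case 3
    have "(a, b) \<notin> K" using un[OF in_ends(1) in_ends(4) in_ends(2)] 3 z ne by auto
    moreover have "(a, c a) \<notin> K" using un[OF in_ends(1) in_ends(4) in_ends(3)] 3 z ne by auto
    moreover have "(c b, c a) \<notin> K" "(c b, b) \<notin> K"
      using calculation 3 z(3) K_trans K_sym by blast+
    moreover have "(c a, b) \<in> K"
      using v calculation K_sym by auto
    ultimately show ?thesis using 3 z by auto
  qed
qed

text \<open>The two corners lie on different cycles, and the switch merges these.\<close>

lemma parallel:
  assumes "(a, c a) \<in> K"
  shows "orel X t c = K" "orel X t (sw c a b) = join K a b" "(a, b) \<notin> K"
    "ncl X (orel X t (sw c a b)) + 1 = ncl X (orel X t c)"
proof -
  have p: "(b, c b) \<in> K" "(a, b) \<notin> K" using K_pairing assms by blast+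
  show o: "orel X t c = K" unfolding orel_c join_same[OF equiv_K assms] join_same[OF equiv_K p(1)] ..
  have "(c a, c b) \<in> join K a b" using assms p by (auto simp: join_def)
  then show s: "orel X t (sw c a b) = join K a b"
    unfolding orel_sw by (intro join_same equiv_join equiv_K)
  show "(a, b) \<notin> K" by (rule p)
  show "ncl X (orel X t (sw c a b)) + 1 = ncl X (orel X t c)"
    unfolding o s by (rule ncl_join[OF fin equiv_K aX bX p(2)])
qed

text \<open>Both corners lie on one cycle, and the new pairs close each of its two paths
  separately.\<close>

lemma splitting:
  assumes "(a, b) \<in> K"
  shows "orel X t (sw c a b) = K" "orel X t c = join K a (c a)" "(a, c a) \<notin> K"
    "ncl X (orel X t (sw c a b)) = ncl X (orel X t c) + 1"
proof -
  have p: "(c a, c b) \<in> K" "(a, c a) \<notin> K" using K_pairing assms by blast+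
  show o: "orel X t (sw c a b) = K" unfolding orel_sw join_same[OF equiv_K assms] join_same[OF equiv_K p(1)] ..
  have "(b, c b) \<in> join K a (c a)" using assms p by (auto simp: join_def)
  then show s: "orel X t c = join K a (c a)"
    unfolding orel_c by (intro join_same equiv_join equiv_K)
  show "(a, c a) \<notin> K" by (rule p)
  show "ncl X (orel X t (sw c a b)) = ncl X (orel X t c) + 1"
    unfolding o s using ncl_join[OF fin equiv_K aX ends_in(1) p(2)] by simp
qed

text \<open>The switch reverses one of the two paths of a single cycle, which therefore remains a
  single cycle with the same flags. This is where nonorientable surgery comes in.\<close>

lemma crossing:
  assumes "(a, c b) \<in> K"
  shows "orel X t (sw c a b) = orel X t c"
proof -
  have p: "(c a, b) \<in> K" using K_pairing assms by blast
  have "(b, c b) \<in> join K a (c a)" using assms p K_sym by (auto simp: join_def)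
  then have 1: "orel X t c = join K a (c a)"
    unfolding orel_c by (intro join_same equiv_join equiv_K)
  have "(c a, c b) \<in> join K a b" using assms p K_sym by (auto simp: join_def)
  then have 2: "orel X t (sw c a b) = join K a b"
    unfolding orel_sw by (intro join_same equiv_join equiv_K)
  show ?thesis unfolding 1 2 using join_cong[OF equiv_K p] by simp
qed

lemma switch_cases:
  obtains (par) "(a, c a) \<in> K" | (spl) "(a, b) \<in> K" | (cro) "(a, c b) \<in> K"
  using K_pairing by blast

lemma ncl_sw_ge: "ncl X (orel X t c) \<le> ncl X (orel X t (sw c a b)) + 1"
  by (cases rule: switch_cases) (use parallel(4) splitting(4) crossing in auto)

text \<open>Only the parallel case leaves \<open>a\<close> and \<open>b\<close> in different orbits
  before the switch.\<close>

lemma merging: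
  assumes "(a, b) \<notin> orel X t c"
  shows "(a, c a) \<in> K" "orel X t (sw c a b) = join (orel X t c) a b"
    "ncl X (orel X t (sw c a b)) + 1 = ncl X (orel X t c)"
proof -
  have eq: "equiv UNIV (orel X t c)" by (rule equiv_orel[OF t c])
  show K: "(a, c a) \<in> K"
  proof (cases rule: switch_cases)
    case spl
    then have "(a, b) \<in> orel X t c"
      using splitting(2)[OF spl] join_mem(3)[OF equiv_K] by blast
    then show ?thesis using assms by simp
  next
    case cro
    have "(a, b) \<in> orel X t (sw c a b)"
      unfolding orel_sw using join_mem[OF equiv_join[OF equiv_K]] join_mem[OF equiv_K] by blast
    then show ?thesis using assms crossing[OF cro] by simp
  qed
  show "orel X t (sw c a b) = join (orel X t c) a b"
    "ncl X (orel X t (sw c a b)) + 1 = ncl X (orel X t c)"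
    using parallel[OF K] by simp_all
qed

lemma K_subset_sw: "K \<subseteq> orel X t (sw c a b)" "K \<subseteq> orel X t c"
  unfolding orel_sw orel_c using join_mem(3)[OF equiv_join[OF equiv_K]] join_mem(3)[OF equiv_K] by blast+

end

section \<open>Gluings that need not be connected\<close>

definition gluing :: "'f set \<Rightarrow> ('f \<Rightarrow> 'f) \<Rightarrow> ('f \<Rightarrow> 'f) \<Rightarrow> ('f \<Rightarrow> 'f) \<Rightarrow> bool" where
  "gluing X l g c \<longleftrightarrow> finite X \<and> fpf_involution_on X l \<and> fpf_involution_on X g \<and>
     fpf_involution_on X c \<and> (\<forall>f\<in>X. g (l f) = l (g f) \<and> g f \<noteq> l f)"

text \<open>For a disconnected gluing this is the sum of the Euler genera of the components.\<close>

definition eg :: "'f set \<Rightarrow> ('f \<Rightarrow> 'f) \<Rightarrow> ('f \<Rightarrow> 'f) \<Rightarrow> ('f \<Rightarrow> 'f) \<Rightarrow> int" where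
  "eg X l g c = 2 * int (ncl X (crel X l g c)) - int (ncl X (orel X g c))
     + int (ncl X (orel X l g)) - int (ncl X (orel X l c))"

lemma gluingD:
  assumes "gluing X l g c"
  shows "finite X" "fpf_involution_on X l" "fpf_involution_on X g" "fpf_involution_on X c"
    "f \<in> X \<Longrightarrow> g (l f) = l (g f)" "f \<in> X \<Longrightarrow> g f \<noteq> l f"
  using assms by (auto simp: gluing_def)

lemma gluing_corner: "gluing X l g c \<Longrightarrow> fpf_involution_on X c' \<Longrightarrow> gluing X l g c'"
  by (simp add: gluing_def)

locale gluing_switch = switch X c a b for X :: "'f set" and c a b +
  fixes l g :: "'f \<Rightarrow> 'f"
  assumes gl: "gluing X l g c"
begin

sublocale V: switch_with X c a b g
  by unfold_locales (rule gluingD(3)[OF gl])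

sublocale F: switch_with X c a b l
  by unfold_locales (rule gluingD(2)[OF gl])

lemma gluing_sw: "gluing X l g (sw c a b)"
  by (rule gluing_corner[OF gl fpf_sw])

lemma equiv_crel_c: "equiv UNIV (crel X l g c)" "equiv UNIV (crel X l g (sw c a b))"
  using gluingD[OF gl] fpf_sw by (auto intro: equiv_crel)

text \<open>Once \<open>a\<close> and \<open>c a\<close> are related, the switched links relate
  \<open>b\<close> and \<open>c b\<close> as well. So a switch can disconnect a component only by
  separating \<open>a\<close> from \<open>c a\<close>.\<close>

lemma crel_c_subset:
  assumes R: "equiv UNIV R" and sub: "crel X l g (sw c a b) \<subseteq> R" and a: "(a, c a) \<in> R"
  shows "crel X l g c \<subseteq> R"
proof (rule crel_least[OF R])
  fix f assume f: "f \<in> X"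
  show "(f, l f) \<in> R" "(f, g f) \<in> R" using crel_stepI[OF f] sub by blast+
  have *: "(a, b) \<in> R" "(c a, c b) \<in> R"
    using crel_stepI(3)[OF aX, where c = "sw c a b"] crel_stepI(3)[OF ends_in(1), where c = "sw c a b"] sub aX ends_in by auto
  have b: "(b, c b) \<in> R" using * a equivUD[OF R] by meson
  show "(f, c f) \<in> R"
  proof (cases "f \<in> ends")
    case True
    then show ?thesis using a b equivUD(2)[OF R] ends_in by auto
  next
    case False
    then show ?thesis using crel_stepI(3)[OF f, where c = "sw c a b"] sub by auto
  qed
qed

lemma ncl_crel_sw_le:
  assumes "(a, c a) \<in> crel X l g (sw c a b)"
  shows "ncl X (crel X l g (sw c a b)) \<le> ncl X (crel X l g c)"
  by (rule ncl_antimono[OF fin equiv_crel_c crel_c_subset[OF equiv_crel_c(2) _ assms]]) simp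

text \<open>The faces of \<open>a\<close> and \<open>b\<close> are merged and not cut, so both old
  components survive entirely inside the new one.\<close>

lemma ncl_crel_sw_components:
  assumes "(a, b) \<notin> crel X l g c"
  shows "ncl X (crel X l g (sw c a b)) + 1 \<le> ncl X (crel X l g c)"
proof -
  have f: "(a, b) \<notin> orel X l c" using assms orel_subset_crel by blast
  have "(a, c a) \<in> crel X l g (sw c a b)"
    using F.merging(1)[OF f] F.K_subset_sw(1) orel_subset_crel by blast
  then have "crel X l g c \<subseteq> crel X l g (sw c a b)"
    by (intro crel_c_subset equiv_crel_c) auto
  moreover have "(a, b) \<in> crel X l g (sw c a b)" using crel_stepI(3)[OF aX, where c = "sw c a b"] by simp
  ultimately have "join (crel X l g c) a b \<subseteq> crel X l g (sw c a b)"
    by (intro join_least equiv_crel_c)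
  then have "ncl X (crel X l g (sw c a b)) \<le> ncl X (join (crel X l g c) a b)"
    by (intro ncl_antimono fin equiv_join equiv_crel_c)
  then show ?thesis
    using ncl_join[OF fin equiv_crel_c(1) aX bX assms] by simp
qed

lemma crel_sw_subset: "crel X l g (sw c a b) \<subseteq> join (crel X l g c) a b"
proof (rule crel_least[OF equiv_join[OF equiv_crel_c(1)]])
  let ?J = "join (crel X l g c) a b"
  note J = join_mem[OF equiv_crel_c(1)] and e = equivUD[OF equiv_join[OF equiv_crel_c(1)]]
  fix f assume f: "f \<in> X"
  show "(f, l f) \<in> ?J" "(f, g f) \<in> ?J" using crel_stepI[OF f] J(3) by blast+
  have *: "(a, c a) \<in> ?J" "(b, c b) \<in> ?J" using crel_stepI(3)[OF aX] crel_stepI(3)[OF bX] J(3) by blast+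
  have "(c a, c b) \<in> ?J" using * J(1) e by meson
  moreover have "(f, c f) \<in> ?J" using crel_stepI(3)[OF f, of c l g] J(3) by blast
  ultimately show "(f, sw c a b f) \<in> ?J"
    using J(1,2) e(2) by (cases "f \<in> ends") auto
qed

text \<open>A connected sum at two corners: one vertex and one face are lost, and so is a component,
  which counts twice.\<close>

lemma eg_sw_components:
  assumes "(a, b) \<notin> crel X l g c"
  shows "eg X l g (sw c a b) \<le> eg X l g c"
proof -
  have "(a, b) \<notin> orel X g c" "(a, b) \<notin> orel X l c"
    using assms orel_subset_crel by blast+
  then show ?thesis
    unfolding eg_def using V.merging(3) F.merging(3) ncl_crel_sw_components[OF assms] by fastforce
qed

text \<open>Identifying two vertices across a common face loses a vertex and gains a face. Nothing
  is disconnected, because the merged vertex still contains all four ends.\<close>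

lemma eg_sw_face:
  assumes "(a, b) \<notin> orel X g c" "(a, b) \<in> F.K"
  shows "eg X l g (sw c a b) \<le> eg X l g c"
proof -
  have "(a, c a) \<in> crel X l g (sw c a b)"
    using V.merging(1)[OF assms(1)] V.K_subset_sw(1) orel_subset_crel by blast
  then show ?thesis
    unfolding eg_def using V.merging(3)[OF assms(1)] F.splitting(4)[OF assms(2)] ncl_crel_sw_le by linarith
qed

text \<open>The gained vertex pays for a face that may be lost. If the surface falls apart, the face
  must have been split as well, and the new vertex and the new face together pay for the one new
  component.\<close>

lemma eg_sw_split_vertex:
  assumes "(a, b) \<in> V.K"
  shows "eg X l g (sw c a b) \<le> eg X l g c"
proof (cases "(a, c a) \<in> crel X l g (sw c a b)")
  case True
  then show ?thesis
    unfolding eg_def using V.splitting(4)[OF assms] F.ncl_sw_ge ncl_crel_sw_le by linarith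
next
  case False
  then have n: "(a, c a) \<notin> orel X l (sw c a b)" using orel_subset_crel by blast
  have "(a, b) \<in> F.K"
  proof (cases rule: F.switch_cases)
    case par
    then show ?thesis using n F.K_subset_sw(1) by blast
  next
    case cro
    then show ?thesis using n F.crossing orel_stepI(2)[OF aX] by metis
  qed simp
  moreover have "crel X l g c \<subseteq> join (crel X l g (sw c a b)) a (c a)"
    using join_mem[OF equiv_crel_c(2)] by (intro crel_c_subset equiv_join equiv_crel_c) blast+
  then have "ncl X (join (crel X l g (sw c a b)) a (c a)) \<le> ncl X (crel X l g c)"
    by (intro ncl_antimono fin equiv_join equiv_crel_c)
  then have "ncl X (crel X l g (sw c a b)) \<le> ncl X (crel X l g c) + 1"
    using ncl_join[OF fin equiv_crel_c(2) aX ends_in(1) False] by simp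
  ultimately show ?thesis
    unfolding eg_def using V.splitting(4)[OF assms] F.splitting(4) by fastforce
qed

end

lemma gluing_switchI:
  assumes "gluing X l g c" "a \<in> X" "b \<in> X" "b \<noteq> a" "b \<noteq> c a"
  shows "gluing_switch X c a b l g"
  using assms gluingD[OF assms(1)] by unfold_locales

section \<open>Detaching ends of edges, and nonnegativity of the genus\<close>

text \<open>\<open>c d = g d\<close> says that the end of an edge at \<open>d\<close> is a vertex of
  its own. Since \<open>g\<close> links \<open>d\<close> and \<open>g d\<close> directly, the switch
  at these two flags always splits the vertex, which does not raise the genus.\<close>

lemma detach_step:
  assumes gl: "gluing X l g c" and d: "d \<in> X"
  shows "\<exists>c'. fpf_involution_on X c' \<and> eg X l g c' \<le> eg X l g c \<and> c' d = g d \<and> c' (g d) = d \<and>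
    (\<forall>f\<in>X. c f = g f \<longrightarrow> c' f = g f) \<and>
    (\<forall>u v. u \<notin> {d, g d} \<longrightarrow> v \<notin> {d, g d} \<longrightarrow> ((u, v) \<in> orel X g c' \<longleftrightarrow> (u, v) \<in> orel X g c))"
proof (cases "c d = g d")
  case True
  then show ?thesis using gluingD(4)[OF gl] fpfD[OF gluingD(4)[OF gl] d] by (intro exI[of _ c]) auto
next
  case False
  note gf = fpfD[OF gluingD(3)[OF gl]] and cf = fpfD[OF gluingD(4)[OF gl]]
  interpret gluing_switch X c d "g d" l g
    using gl d False gf[OF d] by (intro gluing_switchI) auto
  have K: "(d, g d) \<in> V.K" using d by (auto simp: lnk_def)
  have cls: "v \<in> {d, g d}" if "(d, v) \<in> V.K" for v
    using that by (rule rtrancl_closed) (use gf[OF d] in \<open>auto simp: lnk_def\<close>)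
  \<comment> \<open>An end that is already detached is not torn open again: if such an
    \<open>f\<close> were among the four ends, \<open>c d = g d\<close> would follow.\<close>
  have keep: "sw c d (g d) f = g f" if f: "f \<in> X" "c f = g f" for f
  proof -
    have "f \<notin> ends"
    proof
      assume "f \<in> ends"
      then consider "f = d" | "f = c d" | "f = g d" | "f = c (g d)" by auto
      then show False
      proof cases
        case 2 then show False using f False cf[OF d] gf[OF cf(1)[OF d]] by auto
      next
        case 3 then show False using f False cf[OF bX] gf[OF d] by metis
      next
        case 4 then show False using f False cf[OF bX] gf[OF d] gf[OF f(1)] by metis
      qed (use f False in auto)
    qed
    then show ?thesis using f by simp
  qed
  have "(u, v) \<in> orel X g (sw c d (g d)) \<longleftrightarrow> (u, v) \<in> orel X g c"
    if "u \<notin> {d, g d}" "v \<notin> {d, g d}" for u v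
    unfolding V.splitting(1)[OF K] V.splitting(2)[OF K] join_def using cls that by auto
  then show ?thesis
    using fpf_sw eg_sw_split_vertex[OF K] keep by (intro exI[of _ "sw c d (g d)"]) auto
qed

text \<open>This replaces the deletion of edges. The flags in \<open>N\<close> remain, but at
  vertices of degree one, and all other flags are distributed to vertices as before; thus flags,
  sides and gluing can stay fixed throughout.\<close>

lemma detach:
  assumes gl: "gluing X l g c" and N: "N \<subseteq> X" "g ` N \<subseteq> N"
  shows "\<exists>c'. fpf_involution_on X c' \<and> eg X l g c' \<le> eg X l g c \<and> (\<forall>f\<in>N. c' f = g f) \<and>
    (\<forall>u v. u \<notin> N \<longrightarrow> v \<notin> N \<longrightarrow> ((u, v) \<in> orel X g c' \<longleftrightarrow> (u, v) \<in> orel X g c))"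
proof -
  have "finite N" using N gluingD(1)[OF gl] finite_subset by blast
  have "\<exists>c'. fpf_involution_on X c' \<and> eg X l g c' \<le> eg X l g c \<and> (\<forall>f\<in>M. c' f = g f) \<and>
    (\<forall>u v. u \<notin> N \<longrightarrow> v \<notin> N \<longrightarrow> ((u, v) \<in> orel X g c' \<longleftrightarrow> (u, v) \<in> orel X g c))"
    if "M \<subseteq> N" "finite M" for M
    using that(2,1)
  proof (induction M rule: finite_induct)
    case empty
    then show ?case using gluingD(4)[OF gl] by auto
  next
    case (insert d M)
    then obtain c1 where c1: "fpf_involution_on X c1" "eg X l g c1 \<le> eg X l g c" "\<forall>f\<in>M. c1 f = g f"
      "\<And>u v. u \<notin> N \<Longrightarrow> v \<notin> N \<Longrightarrow> ((u, v) \<in> orel X g c1 \<longleftrightarrow> (u, v) \<in> orel X g c)" by auto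
    have dX: "d \<in> X" "d \<in> N" "g d \<in> N" using insert N by auto
    obtain c2 where c2: "fpf_involution_on X c2" "eg X l g c2 \<le> eg X l g c1" "c2 d = g d"
      "\<forall>f\<in>X. c1 f = g f \<longrightarrow> c2 f = g f"
      "\<And>u v. u \<notin> {d, g d} \<Longrightarrow> v \<notin> {d, g d} \<Longrightarrow> ((u, v) \<in> orel X g c2 \<longleftrightarrow> (u, v) \<in> orel X g c1)"
      using detach_step[OF gluing_corner[OF gl c1(1)] dX(1)] by auto
    have "(u, v) \<in> orel X g c2 \<longleftrightarrow> (u, v) \<in> orel X g c" if "u \<notin> N" "v \<notin> N" for u v
      using c2(5)[of u v] c1(4)[OF that] that dX by auto
    moreover have "\<forall>f\<in>insert d M. c2 f = g f" using c2(3,4) c1(3) insert N by auto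
    ultimately show ?case using c2 c1 by (intro exI[of _ c2]) auto
  qed
  then show ?thesis using \<open>finite N\<close> by blast
qed

lemma edge_class:
  assumes gl: "gluing X l g c" and f: "f \<in> X"
  shows "orel X l g `` {f} = {f, l f, g f, g (l f)}"
proof
  note l = fpfD[OF gluingD(2)[OF gl]] and g = fpfD[OF gluingD(3)[OF gl]]
  show "orel X l g `` {f} \<subseteq> {f, l f, g f, g (l f)}"
  proof
    fix v assume "v \<in> orel X l g `` {f}"
    then have "(f, v) \<in> (lnk X l \<union> lnk X g)\<^sup>*" by (auto simp: orel_def)
    then show "v \<in> {f, l f, g f, g (l f)}"
    proof (rule rtrancl_closed)
      fix u v assume "(u, v) \<in> lnk X l \<union> lnk X g" "u \<in> {f, l f, g f, g (l f)}"
      then show "v \<in> {f, l f, g f, g (l f)}"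
        using l(3)[OF f] g(3)[OF f] g(3)[OF l(1)[OF f]] gluingD(5)[OF gl f]
          gluingD(5)[OF gl l(1)[OF f]] by (auto simp: lnk_def)
    qed simp
  qed
  have "equiv UNIV (orel X l g)" using gluingD[OF gl] by (intro equiv_orel)
  note e = equivUD[OF this]
  show "{f, l f, g f, g (l f)} \<subseteq> orel X l g `` {f}"
    using e(1) orel_stepI(1)[OF f, of l g] orel_stepI(2)[OF f, of g l] orel_stepI(2)[OF l(1)[OF f], of g l] e(3)
    by auto
qed

text \<open>Detaching all ends does not raise the value and leaves only separate edges. Then
  components and faces both coincide with edges, the value is \<open>2 E - V\<close>, and an edge
  meets at most two vertices.\<close>

lemma eg_nonneg:
  assumes gl: "gluing X l g c"
  shows "0 \<le> eg X l g c"
proof -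
  note fin = gluingD(1)[OF gl] and l = fpfD[OF gluingD(2)[OF gl]] and g = fpfD[OF gluingD(3)[OF gl]]
  obtain c' where c': "eg X l g c' \<le> eg X l g c" "\<forall>f\<in>X. c' f = g f"
    using detach[OF gl subset_refl] g by blast
  have k: "lnk X c' = lnk X g" by (rule lnk_cong) (use c'(2) in simp)
  have 1: "crel X l g c' = orel X l g" "orel X l c' = orel X l g" "orel X g c' = (lnk X g)\<^sup>*"
    unfolding crel_def orel_def k by (simp_all add: Un_ac)
  let ?V = "X // (lnk X g)\<^sup>*" and ?E = "X // orel X l g"
  have eqE: "equiv UNIV (orel X l g)" using gluingD[OF gl] by (intro equiv_orel)
  have eqV: "equiv UNIV ((lnk X g)\<^sup>*)" using gluingD[OF gl] by (intro equiv_rtrancl sym_lnk)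
  define P where "P = (\<lambda>W. {w \<in> ?V. w \<inter> W \<noteq> {}})"
  have P: "card (P W) \<le> 2" if "W \<in> ?E" for W
  proof -
    obtain f where f: "f \<in> X" "W = orel X l g `` {f}" using \<open>W \<in> ?E\<close> by (auto simp: quotient_def)
    have W: "W = {f, l f, g f, g (l f)}" using edge_class[OF gl f(1)] f(2) by simp
    have st: "(u, g u) \<in> (lnk X g)\<^sup>*" if "u \<in> X" for u using that by (auto simp: lnk_def)
    have "P W \<subseteq> {(lnk X g)\<^sup>* `` {f}, (lnk X g)\<^sup>* `` {l f}}"
    proof
      fix w assume "w \<in> P W"
      then obtain u h where u: "u \<in> X" "w = (lnk X g)\<^sup>* `` {u}" "h \<in> w" "h \<in> W"
        by (auto simp: P_def quotient_def)
      then have "(u, h) \<in> (lnk X g)\<^sup>*" by auto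
      then have w: "w = (lnk X g)\<^sup>* `` {h}" using u equiv_class_eq_iff[OF eqV] by blast
      have "h \<in> {f, l f, g f, g (l f)}" using u W by auto
      moreover have "(lnk X g)\<^sup>* `` {f} = (lnk X g)\<^sup>* `` {g f}" "(lnk X g)\<^sup>* `` {l f} = (lnk X g)\<^sup>* `` {g (l f)}"
        using st[OF f(1)] st[OF l(1)[OF f(1)]] equiv_class_eq_iff[OF eqV] by blast+
      ultimately show "w \<in> {(lnk X g)\<^sup>* `` {f}, (lnk X g)\<^sup>* `` {l f}}" using w by auto
    qed
    then have "card (P W) \<le> card {(lnk X g)\<^sup>* `` {f}, (lnk X g)\<^sup>* `` {l f}}" by (intro card_mono) auto
    also have "\<dots> \<le> 2" by (simp add: card_insert_if)
    finally show ?thesis .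
  qed
  have "?V \<subseteq> (\<Union>W\<in>?E. P W)"
  proof
    fix w assume w: "w \<in> ?V"
    then obtain f where f: "f \<in> X" "w = (lnk X g)\<^sup>* `` {f}" by (auto simp: quotient_def)
    then have "f \<in> w \<inter> orel X l g `` {f}" using equivUD(1)[OF eqE] by auto
    then show "w \<in> (\<Union>W\<in>?E. P W)" using w f by (auto simp: P_def intro!: bexI[of _ "orel X l g `` {f}"] quotientI)
  qed
  then have "card ?V \<le> card (\<Union>W\<in>?E. P W)"
    using fin by (intro card_mono) (auto simp: P_def finite_quotient_UNIV)
  also have "\<dots> \<le> (\<Sum>W\<in>?E. card (P W))" using fin by (intro card_UN_le finite_quotient_UNIV)
  also have "\<dots> \<le> (\<Sum>W\<in>?E. 2)" using P by (intro sum_mono) auto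
  finally have "ncl X ((lnk X g)\<^sup>*) \<le> 2 * ncl X (orel X l g)" by (simp add: ncl_def)
  then show ?thesis using c'(1) unfolding eg_def 1 by linarith
qed

section \<open>Disjoint unions, restrictions and renaming\<close>

lemma rtrancl_disjoint:
  assumes "r1 \<subseteq> Z \<times> Z" "r2 \<subseteq> Y \<times> Y" "Z \<inter> Y = {}" "u \<in> Z"
  shows "(u, v) \<in> (r1 \<union> r2)\<^sup>* \<longleftrightarrow> (u, v) \<in> r1\<^sup>*"
proof
  assume "(u, v) \<in> (r1 \<union> r2)\<^sup>*"
  then have "v \<in> r1\<^sup>* `` {u}"
  proof (rule rtrancl_closed)
    fix a b assume ab: "(a, b) \<in> r1 \<union> r2" "a \<in> r1\<^sup>* `` {u}"
    then have "a \<in> Z" using rtrancl_Image_subset[OF assms(1,4)] by auto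
    then show "b \<in> r1\<^sup>* `` {u}" using ab assms by (auto intro: rtrancl_into_rtrancl)
  qed simp
  then show "(u, v) \<in> r1\<^sup>*" by simp
next
  assume "(u, v) \<in> r1\<^sup>*"
  then show "(u, v) \<in> (r1 \<union> r2)\<^sup>*" by (meson Un_upper1 rtrancl_mono subsetD)
qed

lemma ncl_disjoint:
  assumes "r1 \<subseteq> Z \<times> Z" "r2 \<subseteq> Y \<times> Y" "Z \<inter> Y = {}" "finite Z" "finite Y"
  shows "ncl (Z \<union> Y) ((r1 \<union> r2)\<^sup>*) = ncl Z (r1\<^sup>*) + ncl Y (r2\<^sup>*)"
proof -
  have Z: "(r1 \<union> r2)\<^sup>* `` {u} = r1\<^sup>* `` {u}" if "u \<in> Z" for u
    using rtrancl_disjoint[OF assms(1-3) that] by auto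
  have Y: "(r1 \<union> r2)\<^sup>* `` {u} = r2\<^sup>* `` {u}" if "u \<in> Y" for u
    using rtrancl_disjoint[OF assms(2,1) _ that, of] assms(3) by (auto simp: Un_commute)
  have "(Z \<union> Y) // ((r1 \<union> r2)\<^sup>*) = Z // r1\<^sup>* \<union> Y // r2\<^sup>*"
    using Z Y by (auto simp: quotient_def)
  moreover have "Z // r1\<^sup>* \<inter> Y // r2\<^sup>* = {}"
  proof -
    have "W \<subseteq> Z \<and> W \<noteq> {}" if "W \<in> Z // r1\<^sup>*" for W
      using that rtrancl_Image_subset[OF assms(1)] by (auto simp: quotient_def)
    moreover have "W \<subseteq> Y" if "W \<in> Y // r2\<^sup>*" for W
      using that rtrancl_Image_subset[OF assms(2)] by (auto simp: quotient_def)
    ultimately show ?thesis using assms(3) by blast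
  qed
  ultimately show ?thesis
    unfolding ncl_def using assms by (simp add: card_Un_disjoint finite_quotient_UNIV)
qed

lemma orel_disjoint:
  assumes "fpf_involution_on Z t" "fpf_involution_on Z c" "fpf_involution_on Y t" "fpf_involution_on Y c"
    "Z \<inter> Y = {}" "finite Z" "finite Y"
  shows "ncl (Z \<union> Y) (orel (Z \<union> Y) t c) = ncl Z (orel Z t c) + ncl Y (orel Y t c)"
    "u \<in> Z \<Longrightarrow> (u, v) \<in> orel (Z \<union> Y) t c \<longleftrightarrow> (u, v) \<in> orel Z t c"
proof -
  have e: "lnk (Z \<union> Y) t \<union> lnk (Z \<union> Y) c = (lnk Z t \<union> lnk Z c) \<union> (lnk Y t \<union> lnk Y c)"
    by (auto simp: lnk_Un)
  have s: "lnk Z t \<union> lnk Z c \<subseteq> Z \<times> Z" "lnk Y t \<union> lnk Y c \<subseteq> Y \<times> Y"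
    using lnk_subset assms(1-4) by blast+
  show "ncl (Z \<union> Y) (orel (Z \<union> Y) t c) = ncl Z (orel Z t c) + ncl Y (orel Y t c)"
    unfolding orel_def e by (rule ncl_disjoint[OF s assms(5-7)])
  show "(u, v) \<in> orel (Z \<union> Y) t c \<longleftrightarrow> (u, v) \<in> orel Z t c" if "u \<in> Z"
    unfolding orel_def e by (rule rtrancl_disjoint[OF s assms(5) that])
qed

lemma eg_disjoint:
  assumes Z: "gluing Z l g c" and Y: "gluing Y l g c" and ZY: "Z \<inter> Y = {}"
  shows "gluing (Z \<union> Y) l g c" "eg (Z \<union> Y) l g c = eg Z l g c + eg Y l g c"
    "ncl (Z \<union> Y) (crel (Z \<union> Y) l g c) = ncl Z (crel Z l g c) + ncl Y (crel Y l g c)"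
    "u \<in> Z \<Longrightarrow> (u, v) \<in> crel (Z \<union> Y) l g c \<longleftrightarrow> (u, v) \<in> crel Z l g c"
    "u \<in> Z \<Longrightarrow> (u, v) \<in> orel (Z \<union> Y) g c \<longleftrightarrow> (u, v) \<in> orel Z g c"
    "u \<in> Y \<Longrightarrow> (u, v) \<in> orel (Z \<union> Y) g c \<longleftrightarrow> (u, v) \<in> orel Y g c"
proof -
  note z = gluingD[OF Z] and y = gluingD[OF Y]
  show "gluing (Z \<union> Y) l g c"
    using Z Y by (auto simp: gluing_def fpf_involution_on_def)
  have e: "lnk (Z \<union> Y) l \<union> lnk (Z \<union> Y) g \<union> lnk (Z \<union> Y) c
      = (lnk Z l \<union> lnk Z g \<union> lnk Z c) \<union> (lnk Y l \<union> lnk Y g \<union> lnk Y c)"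
    by (auto simp: lnk_Un)
  have s: "lnk Z l \<union> lnk Z g \<union> lnk Z c \<subseteq> Z \<times> Z" "lnk Y l \<union> lnk Y g \<union> lnk Y c \<subseteq> Y \<times> Y"
    using z(2-4)[THEN lnk_subset] y(2-4)[THEN lnk_subset] by blast+
  show c: "ncl (Z \<union> Y) (crel (Z \<union> Y) l g c) = ncl Z (crel Z l g c) + ncl Y (crel Y l g c)"
    unfolding crel_def e by (rule ncl_disjoint[OF s ZY z(1) y(1)])
  show "eg (Z \<union> Y) l g c = eg Z l g c + eg Y l g c"
    unfolding eg_def c orel_disjoint(1)[OF z(3,4) y(3,4) ZY z(1) y(1)] orel_disjoint(1)[OF z(2,4) y(2,4) ZY z(1) y(1)]
      orel_disjoint(1)[OF z(2,3) y(2,3) ZY z(1) y(1)] by simp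
  show "u \<in> Z \<Longrightarrow> (u, v) \<in> crel (Z \<union> Y) l g c \<longleftrightarrow> (u, v) \<in> crel Z l g c"
    unfolding crel_def e by (rule rtrancl_disjoint[OF s ZY])
  show "u \<in> Z \<Longrightarrow> (u, v) \<in> orel (Z \<union> Y) g c \<longleftrightarrow> (u, v) \<in> orel Z g c"
    by (rule orel_disjoint(2)[OF z(3,4) y(3,4) ZY z(1) y(1)])
  show "u \<in> Y \<Longrightarrow> (u, v) \<in> orel (Z \<union> Y) g c \<longleftrightarrow> (u, v) \<in> orel Y g c"
    using orel_disjoint(2)[OF y(3,4) z(3,4) _ y(1) z(1), of u v] ZY by (simp add: Un_commute Int_commute)
qed

lemma gluing_cong:
  assumes "\<And>f. f \<in> X \<Longrightarrow> l f = l' f" "\<And>f. f \<in> X \<Longrightarrow> g f = g' f" "\<And>f. f \<in> X \<Longrightarrow> c f = c' f"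
    "gluing X l g c"
  shows "gluing X l' g' c'" "eg X l' g' c' = eg X l g c" "crel X l' g' c' = crel X l g c"
    "orel X g' c' = orel X g c"
proof -
  have e: "lnk X l' = lnk X l" "lnk X g' = lnk X g" "lnk X c' = lnk X c"
    using assms(1-3) by (auto intro!: lnk_cong)
  show "gluing X l' g' c'"
    using assms(4) by (simp add: gluing_def fpf_involution_on_def assms(1-3)[symmetric])
  show "eg X l' g' c' = eg X l g c" "crel X l' g' c' = crel X l g c" "orel X g' c' = orel X g c"
    unfolding eg_def crel_def orel_def e by simp_all
qed

lemma gluing_disjoint_union:
  assumes 1: "gluing X\<^sub>1 l\<^sub>1 g\<^sub>1 c\<^sub>1" and 2: "gluing X\<^sub>2 l\<^sub>2 g\<^sub>2 c\<^sub>2" and dj: "X\<^sub>1 \<inter> X\<^sub>2 = {}"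
  defines "l \<equiv> \<lambda>f. if f \<in> X\<^sub>1 then l\<^sub>1 f else l\<^sub>2 f"
    and "g \<equiv> \<lambda>f. if f \<in> X\<^sub>1 then g\<^sub>1 f else g\<^sub>2 f"
    and "c \<equiv> \<lambda>f. if f \<in> X\<^sub>1 then c\<^sub>1 f else c\<^sub>2 f"
  shows "gluing (X\<^sub>1 \<union> X\<^sub>2) l g c" "eg (X\<^sub>1 \<union> X\<^sub>2) l g c = eg X\<^sub>1 l\<^sub>1 g\<^sub>1 c\<^sub>1 + eg X\<^sub>2 l\<^sub>2 g\<^sub>2 c\<^sub>2"
    "ncl (X\<^sub>1 \<union> X\<^sub>2) (crel (X\<^sub>1 \<union> X\<^sub>2) l g c) = ncl X\<^sub>1 (crel X\<^sub>1 l\<^sub>1 g\<^sub>1 c\<^sub>1) + ncl X\<^sub>2 (crel X\<^sub>2 l\<^sub>2 g\<^sub>2 c\<^sub>2)"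
    "u \<in> X\<^sub>1 \<Longrightarrow> (u, v) \<in> crel (X\<^sub>1 \<union> X\<^sub>2) l g c \<longleftrightarrow> (u, v) \<in> crel X\<^sub>1 l\<^sub>1 g\<^sub>1 c\<^sub>1"
    "u \<in> X\<^sub>1 \<Longrightarrow> (u, v) \<in> orel (X\<^sub>1 \<union> X\<^sub>2) g c \<longleftrightarrow> (u, v) \<in> orel X\<^sub>1 g\<^sub>1 c\<^sub>1"
    "u \<in> X\<^sub>2 \<Longrightarrow> (u, v) \<in> orel (X\<^sub>1 \<union> X\<^sub>2) g c \<longleftrightarrow> (u, v) \<in> orel X\<^sub>2 g\<^sub>2 c\<^sub>2"
proof -
  have "l\<^sub>1 f = l f" "g\<^sub>1 f = g f" "c\<^sub>1 f = c f" if "f \<in> X\<^sub>1" for f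
    using that by (auto simp: l_def g_def c_def)
  note a = gluing_cong[OF this 1]
  have "l\<^sub>2 f = l f" "g\<^sub>2 f = g f" "c\<^sub>2 f = c f" if "f \<in> X\<^sub>2" for f
    using that dj by (auto simp: l_def g_def c_def)
  note b = gluing_cong[OF this 2]
  note r = eg_disjoint[OF a(1) b(1) dj]
  show "gluing (X\<^sub>1 \<union> X\<^sub>2) l g c" by (rule r(1))
  show "eg (X\<^sub>1 \<union> X\<^sub>2) l g c = eg X\<^sub>1 l\<^sub>1 g\<^sub>1 c\<^sub>1 + eg X\<^sub>2 l\<^sub>2 g\<^sub>2 c\<^sub>2" using r(2) a(2) b(2) by simp
  show "ncl (X\<^sub>1 \<union> X\<^sub>2) (crel (X\<^sub>1 \<union> X\<^sub>2) l g c) = ncl X\<^sub>1 (crel X\<^sub>1 l\<^sub>1 g\<^sub>1 c\<^sub>1) + ncl X\<^sub>2 (crel X\<^sub>2 l\<^sub>2 g\<^sub>2 c\<^sub>2)"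
    using r(3) a(3) b(3) by simp
  show "u \<in> X\<^sub>1 \<Longrightarrow> (u, v) \<in> crel (X\<^sub>1 \<union> X\<^sub>2) l g c \<longleftrightarrow> (u, v) \<in> crel X\<^sub>1 l\<^sub>1 g\<^sub>1 c\<^sub>1"
    using r(4) a(3) by simp
  show "u \<in> X\<^sub>1 \<Longrightarrow> (u, v) \<in> orel (X\<^sub>1 \<union> X\<^sub>2) g c \<longleftrightarrow> (u, v) \<in> orel X\<^sub>1 g\<^sub>1 c\<^sub>1"
    using r(5) a(4) by simp
  show "u \<in> X\<^sub>2 \<Longrightarrow> (u, v) \<in> orel (X\<^sub>1 \<union> X\<^sub>2) g c \<longleftrightarrow> (u, v) \<in> orel X\<^sub>2 g\<^sub>2 c\<^sub>2"
    using r(6) b(4) by simp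
qed

lemma rtrancl_renaming:
  assumes "inj_on h X" "r \<subseteq> X \<times> X" "u \<in> X"
  shows "(map_prod h h ` r)\<^sup>* `` {h u} = h ` (r\<^sup>* `` {u})"
proof (intro equalityI subsetI)
  fix w assume "w \<in> (map_prod h h ` r)\<^sup>* `` {h u}"
  then have "(h u, w) \<in> (map_prod h h ` r)\<^sup>*" by simp
  then show "w \<in> h ` (r\<^sup>* `` {u})"
  proof (rule rtrancl_closed)
    fix a b assume "(a, b) \<in> map_prod h h ` r" "a \<in> h ` (r\<^sup>* `` {u})"
    then obtain a1 b1 a2 where "(a1, b1) \<in> r" "a = h a1" "b = h b1" "(u, a2) \<in> r\<^sup>*" "a = h a2" by auto
    moreover from this have "a2 \<in> X" "a1 \<in> X" using rtrancl_Image_subset[OF assms(2,3)] assms(2) by auto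
    ultimately have "(u, b1) \<in> r\<^sup>*" using assms(1) by (metis inj_onD rtrancl.rtrancl_into_rtrancl)
    then show "b \<in> h ` (r\<^sup>* `` {u})" using \<open>b = h b1\<close> by auto
  qed auto
next
  fix w assume "w \<in> h ` (r\<^sup>* `` {u})"
  then obtain v where v: "w = h v" "(u, v) \<in> r\<^sup>*" by auto
  have "(h u, h v) \<in> (map_prod h h ` r)\<^sup>*"
    using v(2) by (induction rule: rtrancl_induct) (auto intro: rtrancl_into_rtrancl)
  then show "w \<in> (map_prod h h ` r)\<^sup>* `` {h u}" using v by simp
qed

lemma ncl_renaming:
  assumes "inj_on h X" "r \<subseteq> X \<times> X"
  shows "ncl (h ` X) ((map_prod h h ` r)\<^sup>*) = ncl X (r\<^sup>*)"
proof -
  have "(h ` X) // ((map_prod h h ` r)\<^sup>*) = (`) h ` (X // r\<^sup>*)"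
    using rtrancl_renaming[OF assms] by (auto simp: quotient_def)
  moreover have "inj_on ((`) h) (X // r\<^sup>*)"
  proof (rule inj_onI)
    fix A B assume "A \<in> X // r\<^sup>*" "B \<in> X // r\<^sup>*" "h ` A = h ` B"
    moreover from this have "A \<subseteq> X" "B \<subseteq> X" using rtrancl_Image_subset[OF assms(2)] by (auto simp: quotient_def)
    ultimately show "A = B" using inj_on_image_eq_iff[OF assms(1)] by blast
  qed
  ultimately show ?thesis unfolding ncl_def by (simp add: card_image)
qed

text \<open>Drawings use natural numbers as flags, so two of them have to be moved apart before
  their disjoint union can be formed.\<close>

lemma gluing_renaming:
  assumes gl: "gluing X l g c" and h: "inj_on h X"
  defines "r \<equiv> \<lambda>t. h \<circ> t \<circ> inv_into X h"
  shows "gluing (h ` X) (r l) (r g) (r c)" "eg (h ` X) (r l) (r g) (r c) = eg X l g c"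
    "u \<in> X \<Longrightarrow> v \<in> X \<Longrightarrow> (h u, h v) \<in> orel (h ` X) (r g) (r c) \<longleftrightarrow> (u, v) \<in> orel X g c"
    "u \<in> X \<Longrightarrow> r l (h u) = h (l u)"
proof -
  note G = gluingD[OF gl]
  have r: "r t (h u) = h (t u)" if "u \<in> X" for t u
    using that h by (simp add: r_def)
  have fp: "fpf_involution_on (h ` X) (r t)" if "fpf_involution_on X t" for t
    using fpfD[OF that] r h unfolding fpf_involution_on_def by (auto simp: inj_on_eq_iff)
  show "gluing (h ` X) (r l) (r g) (r c)"
    using G fp r h fpfD[OF G(2)] fpfD[OF G(3)] unfolding gluing_def by (auto simp: inj_on_eq_iff)
  have ln: "lnk (h ` X) (r t) = map_prod h h ` lnk X t" for t
    using r by (force simp: lnk_def)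
  have s: "lnk X l \<subseteq> X \<times> X" "lnk X g \<subseteq> X \<times> X" "lnk X c \<subseteq> X \<times> X" using G lnk_subset by blast+
  have o: "orel (h ` X) (r t) (r t') = (map_prod h h ` (lnk X t \<union> lnk X t'))\<^sup>*" for t t'
    unfolding orel_def ln by (simp add: image_Un)
  have cr: "crel (h ` X) (r l) (r g) (r c) = (map_prod h h ` (lnk X l \<union> lnk X g \<union> lnk X c))\<^sup>*"
    unfolding crel_def ln by (simp add: image_Un)
  show "eg (h ` X) (r l) (r g) (r c) = eg X l g c"
    unfolding eg_def o cr using s by (simp add: ncl_renaming[OF h] crel_def orel_def)
  show "(h u, h v) \<in> orel (h ` X) (r g) (r c) \<longleftrightarrow> (u, v) \<in> orel X g c" if "u \<in> X" "v \<in> X"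
  proof -
    have sub: "lnk X g \<union> lnk X c \<subseteq> X \<times> X" using s by auto
    have "(h u, h v) \<in> orel (h ` X) (r g) (r c) \<longleftrightarrow> h v \<in> h ` (orel X g c `` {u})"
      using rtrancl_renaming[OF h sub that(1)] unfolding o by (auto simp: orel_def)
    also have "\<dots> \<longleftrightarrow> v \<in> orel X g c `` {u}"
      using rtrancl_Image_subset[OF sub that(1)] that h unfolding orel_def by (intro inj_on_image_mem_iff) auto
    finally show ?thesis by simp
  qed
  show "u \<in> X \<Longrightarrow> r l (h u) = h (l u)" by (rule r)
qed

text \<open>A digon whose two sides are glued to each other: the sphere with a single edge as
  1-skeleton. It is the building block for all added edges, and avoiding \<open>Y\<close> allows it
  to be added as a new component.\<close>

lemma edge_sphere:
  assumes "finite (Y :: nat set)"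
  obtains X l g and d :: nat where "gluing X l g g" "eg X l g g \<le> 0" "X \<inter> Y = {}" "d \<in> X"
    "(d, l d) \<notin> orel X g g" "\<And>f. f \<in> X \<Longrightarrow> (d, f) \<in> orel X g g \<or> (l d, f) \<in> orel X g g"
    "ncl X (crel X l g g) = 1"
proof -
  obtain n where n: "\<And>y. y \<in> Y \<Longrightarrow> y < n"
    using iffD1[OF finite_nat_set_iff_bounded assms] by auto
  define X where "X = {n, n + 1, n + 2, n + 3}"
  define l where "l = id(n := n + 1, n + 1 := n, n + 2 := n + 3, n + 3 := n + 2)"
  define g where "g = id(n := n + 2, n + 2 := n, n + 1 := n + 3, n + 3 := n + 1)"
  have gl: "gluing X l g g"
    unfolding gluing_def fpf_involution_on_def X_def by (simp add: l_def g_def)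
  have nX: "n \<in> X" by (simp add: X_def)
  have V1: "(n, n + 2) \<in> orel X g g" "(n + 1, n + 3) \<in> orel X g g"
    using orel_stepI(1)[of n X g g] orel_stepI(1)[of "n + 1" X g g] by (auto simp: X_def g_def)
  have ld: "l n = n + 1" by (simp add: l_def)
  have V2: "(n, n + 1) \<notin> orel X g g"
  proof
    assume "(n, n + 1) \<in> orel X g g"
    then have "n + 1 \<in> {n, n + 2}"
      unfolding orel_def by (rule rtrancl_closed) (auto simp: lnk_def g_def)
    then show False by simp
  qed
  have eq: "equiv UNIV (orel X g g)" "equiv UNIV (orel X l g)" "equiv UNIV (crel X l g g)"
    using gluingD[OF gl] by (auto intro: equiv_orel equiv_crel)
  have e: "(n, n + 1) \<in> orel X l g" "(n, n + 2) \<in> orel X l g" "(n + 1, n + 3) \<in> orel X l g"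
    using orel_stepI(1)[of n X l g] orel_stepI(2)[of n X g l] orel_stepI(2)[of "n + 1" X g l]
    by (auto simp: X_def g_def l_def)
  have E: "(n, f) \<in> orel X l g" if "f \<in> X" for f
    using that e equivUD[OF eq(2)] unfolding X_def by blast
  have C: "(n, f) \<in> crel X l g g" if "f \<in> X" for f
    using E[OF that] orel_subset_crel(1)[of X l g g] by blast
  have single: "ncl X R = 1" if "equiv UNIV R" "\<And>f. f \<in> X \<Longrightarrow> (n, f) \<in> R" for R
  proof -
    have "R `` {f} = R `` {n}" if "f \<in> X" for f
      using equiv_class_eq[OF \<open>equiv UNIV R\<close> \<open>\<And>f. f \<in> X \<Longrightarrow> (n, f) \<in> R\<close>[OF that]] by simp
    then have "X // R = (\<Union>f\<in>X. {R `` {n}})" unfolding quotient_def by (metis (no_types, lifting) SUP_cong)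
    then have "X // R = {R `` {n}}" using nX by auto
    then show ?thesis by (simp add: ncl_def)
  qed
  have "ncl X (join (orel X g g) n (n + 1)) + 1 = ncl X (orel X g g)"
    using V2 nX by (intro ncl_join eq gluingD(1)[OF gl]) (auto simp: X_def)
  moreover have pos: "ncl X R \<ge> 1" for R
    using finite_quotient_UNIV[OF gluingD(1)[OF gl], of R] nX unfolding ncl_def
    by (auto simp: quotient_def Suc_le_eq card_gt_0_iff)
  ultimately have "ncl X (orel X g g) \<ge> 2" by (metis add_le_mono1 one_add_one)
  then have "eg X l g g \<le> 0"
    unfolding eg_def using single[OF eq(3) C] single[OF eq(2) E] pos[of "orel X l g"] by simp
  moreover have "(n, f) \<in> orel X g g \<or> (l n, f) \<in> orel X g g" if "f \<in> X" for f
    using that V1 equivUD(1)[OF eq(1)] by (auto simp: X_def ld)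
  moreover have "X \<inter> Y = {}" using n by (fastforce simp: X_def)
  ultimately show ?thesis using that[OF gl] nX V2 single[OF eq(3) C] by (simp add: ld)
qed

section \<open>Drawings\<close>

text \<open>\<open>\<rho> u\<close> is a flag at the vertex of the 1-skeleton that represents \<open>u\<close>.\<close>

definition draws ::
    "'a set \<Rightarrow> ('a \<times> 'a) set \<Rightarrow> 'f set \<Rightarrow> ('f \<Rightarrow> 'f) \<Rightarrow> ('f \<Rightarrow> 'f) \<Rightarrow> ('f \<Rightarrow> 'f) \<Rightarrow> ('a \<Rightarrow> 'f) \<Rightarrow> bool" where
  "draws V A X l g c \<rho> \<longleftrightarrow> \<rho> ` V \<subseteq> X \<and>
     (\<forall>u\<in>V. \<forall>v\<in>V. (\<rho> u, \<rho> v) \<in> orel X g c \<longrightarrow> u = v) \<and>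
     (\<forall>(u, v)\<in>A. \<exists>f\<in>X. (\<rho> u, f) \<in> orel X g c \<and> (\<rho> v, l f) \<in> orel X g c)"

lemma drawsI:
  assumes "\<And>u. u \<in> V \<Longrightarrow> \<rho> u \<in> X"
    "\<And>u v. u \<in> V \<Longrightarrow> v \<in> V \<Longrightarrow> (\<rho> u, \<rho> v) \<in> orel X g c \<Longrightarrow> u = v"
    "\<And>u v. (u, v) \<in> A \<Longrightarrow> \<exists>f\<in>X. (\<rho> u, f) \<in> orel X g c \<and> (\<rho> v, l f) \<in> orel X g c"
  shows "draws V A X l g c \<rho>"
  using assms by (auto simp: draws_def)

lemma drawsD:
  assumes "draws V A X l g c \<rho>"
  shows "u \<in> V \<Longrightarrow> \<rho> u \<in> X"
    "u \<in> V \<Longrightarrow> v \<in> V \<Longrightarrow> (\<rho> u, \<rho> v) \<in> orel X g c \<Longrightarrow> u = v"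
    "(u, v) \<in> A \<Longrightarrow> \<exists>f\<in>X. (\<rho> u, f) \<in> orel X g c \<and> (\<rho> v, l f) \<in> orel X g c"
  using assms by (auto simp: draws_def)

lemma draws_extend:
  assumes d: "draws V A X l g c \<rho>" and AV: "A \<subseteq> V \<times> V" and sub: "X \<subseteq> X'" and l: "\<And>f. f \<in> X \<Longrightarrow> l' f = l f"
    and lX: "\<And>f. f \<in> X \<Longrightarrow> l f \<in> X"
    and o: "\<And>u v. u \<in> X \<Longrightarrow> v \<in> X \<Longrightarrow> (u, v) \<in> orel X' g' c' \<longleftrightarrow> (u, v) \<in> orel X g c"
  shows "draws V A X' l' g' c' \<rho>"
proof (rule drawsI)
  show "\<rho> u \<in> X'" if "u \<in> V" for u using drawsD(1)[OF d that] sub by auto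
  show "u = v" if "u \<in> V" "v \<in> V" "(\<rho> u, \<rho> v) \<in> orel X' g' c'" for u v
    using that drawsD(1,2)[OF d] o by blast
  show "\<exists>f\<in>X'. (\<rho> u, f) \<in> orel X' g' c' \<and> (\<rho> v, l' f) \<in> orel X' g' c'" if uv: "(u, v) \<in> A" for u v
  proof -
    obtain f where f: "f \<in> X" "(\<rho> u, f) \<in> orel X g c" "(\<rho> v, l f) \<in> orel X g c" using drawsD(3)[OF d uv] by auto
    have "\<rho> u \<in> X" "\<rho> v \<in> X" using uv AV drawsD(1)[OF d] by auto
    then show ?thesis using f o l lX sub by (intro bexI[of _ f]) auto
  qed
qed

section \<open>Cells of a closed surface as orbits, and embeddings as drawings\<close>

lemma closed_surface_iff:
  "closed_surface S \<longleftrightarrow> gluing (flags S) (along S) (glue S) (corner S) \<and>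
     ncl (flags S) (crel (flags S) (along S) (glue S) (corner S)) = 1"
proof -
  have "{(f, t f) |f t. f \<in> flags S \<and> t \<in> {along S, corner S, glue S}}
      = lnk (flags S) (along S) \<union> lnk (flags S) (glue S) \<union> lnk (flags S) (corner S)"
    by (auto simp: lnk_def)
  then show ?thesis
    by (auto simp: closed_surface_def gluing_def cells_def ncl_def crel_def)
qed

lemma vertex_cells_eq: "vertex_cells S = flags S // orel (flags S) (glue S) (corner S)"
proof -
  have "{(f, t f) |f t. f \<in> flags S \<and> t \<in> {corner S, glue S}} = lnk (flags S) (glue S) \<union> lnk (flags S) (corner S)"
    by (auto simp: lnk_def)
  then show ?thesis by (simp add: vertex_cells_def cells_def orel_def)
qed

lemma edge_cells_eq: "edge_cells S = flags S // orel (flags S) (along S) (glue S)"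
proof -
  have "{(f, t f) |f t. f \<in> flags S \<and> t \<in> {along S, glue S}} = lnk (flags S) (along S) \<union> lnk (flags S) (glue S)"
    by (auto simp: lnk_def)
  then show ?thesis by (simp add: edge_cells_def cells_def orel_def)
qed

lemma face_cells_eq: "face_cells S = flags S // orel (flags S) (along S) (corner S)"
proof -
  have "{(f, t f) |f t. f \<in> flags S \<and> t \<in> {along S, corner S}} = lnk (flags S) (along S) \<union> lnk (flags S) (corner S)"
    by (auto simp: lnk_def)
  then show ?thesis by (simp add: face_cells_def cells_def orel_def)
qed

lemma surface_euler_genus_eq:
  assumes "closed_surface S"
  shows "surface_euler_genus S = eg (flags S) (along S) (glue S) (corner S)"
  using assms unfolding closed_surface_iff surface_euler_genus_def euler_char_def eg_def
    vertex_cells_eq edge_cells_eq face_cells_eq ncl_def by simp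

text \<open>\<open>embeds_in\<close> speaks of cells and \<open>draws\<close> of flags: an edge cell
  from \<open>u\<close> to \<open>v\<close> is recovered from a side with one half at
  \<open>u\<close> and the other half at \<open>v\<close>.\<close>

lemma embeds_in_iff:
  assumes S: "closed_surface S" and A: "parcs G \<subseteq> pverts G \<times> pverts G"
  shows "embeds_in G S \<longleftrightarrow>
    (\<exists>\<rho>. draws (pverts G) (parcs G) (flags S) (along S) (glue S) (corner S) \<rho>)"
proof
  define X l g c where "X = flags S" and "l = along S" and "g = glue S" and "c = corner S"
  note defs = X_def[symmetric] l_def[symmetric] g_def[symmetric] c_def[symmetric]
  have gl: "gluing X l g c" using S unfolding closed_surface_iff defs by simp
  note lf = fpfD[OF gluingD(2)[OF gl]] and gf = fpfD[OF gluingD(3)[OF gl]]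
  have eqV: "equiv UNIV (orel X g c)" using gluingD[OF gl] by (intro equiv_orel)
  note VC = vertex_cells_eq[of S, unfolded defs] and EC = edge_cells_eq[of S, unfolded defs]
  have cell: "W = orel X g c `` {f}" "f \<in> X" if W: "W \<in> vertex_cells S" "f \<in> W" for W f
  proof -
    obtain h where h: "h \<in> X" "W = orel X g c `` {h}" using W VC by (auto simp: quotient_def)
    then show "W = orel X g c `` {f}" using equiv_class_eq[OF eqV, of h f] that by auto
    show "f \<in> X" using h that orel_subset[OF gluingD(3,4)[OF gl]] by auto
  qed
  have gcell: "g f \<in> W" if "W \<in> vertex_cells S" "f \<in> W" for W f
    using cell[OF that] orel_stepI(1)[of f X g c] by auto
  {
    assume "embeds_in G S"
    then obtain \<eta> where \<eta>: "inj_on \<eta> (pverts G)" "\<eta> ` pverts G \<subseteq> vertex_cells S"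
      "\<And>u v. (u, v) \<in> parcs G \<Longrightarrow> \<exists>e\<in>edge_cells S. {c \<in> vertex_cells S. c \<inter> e \<noteq> {}} = {\<eta> u, \<eta> v}"
      unfolding embeds_in_def by (auto split: prod.splits)
    define \<rho> where "\<rho> u = (SOME f. f \<in> \<eta> u)" for u
    have \<rho>: "\<rho> u \<in> \<eta> u" "\<rho> u \<in> X" "\<eta> u = orel X g c `` {\<rho> u}" if "u \<in> pverts G" for u
    proof -
      have v: "\<eta> u \<in> vertex_cells S" using \<eta>(2) that by auto
      then obtain h where "h \<in> X" "\<eta> u = orel X g c `` {h}" unfolding VC quotient_def by auto
      then have "\<exists>f. f \<in> \<eta> u" using equivUD(1)[OF eqV] by auto
      then show "\<rho> u \<in> \<eta> u" unfolding \<rho>_def by (rule someI_ex)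
      then show "\<rho> u \<in> X" "\<eta> u = orel X g c `` {\<rho> u}" using cell[OF v] by auto
    qed
    have "draws (pverts G) (parcs G) X l g c \<rho>"
    proof (rule drawsI)
      show "\<rho> u \<in> X" if "u \<in> pverts G" for u using \<rho>(2)[OF that] .
      show "u = v" if "u \<in> pverts G" "v \<in> pverts G" "(\<rho> u, \<rho> v) \<in> orel X g c" for u v
        using \<rho>(3)[OF that(1)] \<rho>(3)[OF that(2)] equiv_class_eq[OF eqV that(3)] inj_onD[OF \<eta>(1) _ that(1,2)] by simp
      fix u v assume uv: "(u, v) \<in> parcs G"
      then have uvV: "u \<in> pverts G" "v \<in> pverts G" using A by auto
      obtain e where e: "e \<in> edge_cells S" "{c \<in> vertex_cells S. c \<inter> e \<noteq> {}} = {\<eta> u, \<eta> v}" using \<eta>(3)[OF uv] by auto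
      have "\<eta> u \<in> {\<eta> u, \<eta> v}" "\<eta> v \<in> {\<eta> u, \<eta> v}" by auto
      then obtain f f2 where f: "\<eta> u \<in> vertex_cells S" "\<eta> v \<in> vertex_cells S" "f \<in> \<eta> u" "f \<in> e" "f2 \<in> \<eta> v" "f2 \<in> e"
        unfolding e(2)[symmetric] by auto
      have fX: "f \<in> X" using cell f by blast
      have eqE: "equiv UNIV (orel X l g)" using gluingD[OF gl] by (intro equiv_orel)
      obtain h where "h \<in> X" "e = orel X l g `` {h}" using e(1) unfolding EC quotient_def by auto
      then have "e = orel X l g `` {f}" using equiv_class_eq[OF eqE, of h f] f by auto
      then have ee: "e = {f, l f, g f, g (l f)}" using edge_class[OF gl fX] by simp
      have lfX: "l f \<in> X" using lf fX by auto
      have "orel X g c `` {l f} \<in> {c \<in> vertex_cells S. c \<inter> e \<noteq> {}}"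
        using lfX ee equivUD(1)[OF eqV] unfolding VC by (auto intro: quotientI)
      then consider "orel X g c `` {l f} = \<eta> v" | "orel X g c `` {l f} = \<eta> u" unfolding e(2) by auto
      then have "l f \<in> \<eta> v"
      proof cases
        case 1 then show ?thesis using equivUD(1)[OF eqV] by auto
      next
        case 2
        \<comment> \<open>If both halves of the side are at \<open>u\<close>, the whole edge cell
          is. As it also meets the cell of \<open>v\<close>, the two cells coincide and the claim
          still holds.\<close>
        then have "l f \<in> \<eta> u" using equivUD(1)[OF eqV] by auto
        then have "e \<subseteq> \<eta> u" using ee f gcell by auto
        then have "f2 \<in> \<eta> u" using f by auto
        then have "\<eta> u = \<eta> v" using cell(1)[OF f(1)] cell(1)[OF f(2,5)] by simp
        then show ?thesis using \<open>l f \<in> \<eta> u\<close> by simp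
      qed
      then show "\<exists>f\<in>X. (\<rho> u, f) \<in> orel X g c \<and> (\<rho> v, l f) \<in> orel X g c"
        using f(3) fX \<rho>(3)[OF uvV(1)] \<rho>(3)[OF uvV(2)] by auto
    qed
    then show "\<exists>\<rho>. draws (pverts G) (parcs G) (flags S) (along S) (glue S) (corner S) \<rho>" unfolding defs by auto
  next
    assume "\<exists>\<rho>. draws (pverts G) (parcs G) (flags S) (along S) (glue S) (corner S) \<rho>"
    then obtain \<rho> where d: "draws (pverts G) (parcs G) X l g c \<rho>" unfolding defs by auto
    define \<eta> where "\<eta> u = orel X g c `` {\<rho> u}" for u
    have inj: "inj_on \<eta> (pverts G)"
    proof (rule inj_onI)
      fix u v assume "u \<in> pverts G" "v \<in> pverts G" "\<eta> u = \<eta> v"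
      then show "u = v" using drawsD(2)[OF d] equivUD(1)[OF eqV] unfolding \<eta>_def by blast
    qed
    have img: "\<eta> ` pverts G \<subseteq> vertex_cells S"
      using drawsD(1)[OF d] unfolding VC \<eta>_def by (auto intro: quotientI)
    have edge: "\<exists>e\<in>edge_cells S. {c \<in> vertex_cells S. c \<inter> e \<noteq> {}} = {\<eta> u, \<eta> v}" if uv: "(u, v) \<in> parcs G" for u v
    proof -
      obtain f where f: "f \<in> X" "(\<rho> u, f) \<in> orel X g c" "(\<rho> v, l f) \<in> orel X g c" using drawsD(3)[OF d uv] by auto
      have uv': "\<eta> u \<in> vertex_cells S" "\<eta> v \<in> vertex_cells S" "f \<in> \<eta> u" "l f \<in> \<eta> v"
        using drawsD(1)[OF d] uv A f unfolding VC \<eta>_def by (auto intro: quotientI)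
      define e where "e = orel X l g `` {f}"
      have ee: "e = {f, l f, g f, g (l f)}" unfolding e_def by (rule edge_class[OF gl f(1)])
      have "W \<in> {\<eta> u, \<eta> v}" if W: "W \<in> vertex_cells S" "h \<in> W" "h \<in> e" for W h
      proof -
        have "h \<in> \<eta> u \<or> h \<in> \<eta> v" using W(3) ee uv' gcell by auto
        then show ?thesis using cell(1)[OF W(1,2)] cell(1)[OF uv'(1)] cell(1)[OF uv'(2)] by auto
      qed
      then have "{c \<in> vertex_cells S. c \<inter> e \<noteq> {}} = {\<eta> u, \<eta> v}" using uv' ee by blast
      moreover have "e \<in> edge_cells S" unfolding EC e_def using f by (auto intro: quotientI)
      ultimately show ?thesis by blast
    qed
    have arcs: "\<forall>(u, v)\<in>parcs G. \<exists>e\<in>edge_cells S. {c \<in> vertex_cells S. c \<inter> e \<noteq> {}} = {\<eta> u, \<eta> v}"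
    proof (rule ballI)
      fix p assume p: "p \<in> parcs G"
      obtain u v where uv: "p = (u, v)" by (cases p)
      show "case p of (u, v) \<Rightarrow> \<exists>e\<in>edge_cells S. {c \<in> vertex_cells S. c \<inter> e \<noteq> {}} = {\<eta> u, \<eta> v}"
        unfolding uv prod.case by (rule edge) (use p uv in simp)
    qed
    show "embeds_in G S" unfolding embeds_in_def by (intro exI[of _ \<eta>] conjI inj img arcs)
  }
qed

section \<open>Adding edges\<close>

lemma gluing_switch_separate:
  assumes "gluing X l g c" "a \<in> X" "b \<in> X" "(a, b) \<notin> orel X g c"
  shows "gluing_switch X c a b l g"
proof (rule gluing_switchI[OF assms(1-3)])
  show "b \<noteq> a" using assms(4) by (auto simp: orel_def)
  show "b \<noteq> c a" using assms(4) orel_stepI(2)[OF assms(2), of c g] by auto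
qed

text \<open>A one-edge sphere is added as a component and attached at \<open>a\<close> by a switch
  across components, at no cost in genus. The last conclusion says that the free end stays away from
  the other components, so that it can later be used to join them.\<close>

lemma add_pendant_edge:
  fixes X :: "nat set"
  assumes gl: "gluing X l g c" and a: "a \<in> X"
  obtains X' l' g' c' d where "gluing X' l' g' c'" "X \<subseteq> X'" "\<And>f. f \<in> X \<Longrightarrow> l' f = l f"
    "eg X' l' g' c' \<le> eg X l g c" "ncl X' (crel X' l' g' c') \<le> ncl X (crel X l g c)"
    "\<And>u v. u \<in> X \<Longrightarrow> v \<in> X \<Longrightarrow> (u, v) \<in> orel X' g' c' \<longleftrightarrow> (u, v) \<in> orel X g c"
    "d \<in> X'" "(a, d) \<in> orel X' g' c'" "\<And>u. u \<in> X \<Longrightarrow> (l' d, u) \<notin> orel X' g' c'"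
    "\<And>b. b \<in> X \<Longrightarrow> (a, b) \<notin> crel X l g c \<Longrightarrow> (l' d, b) \<notin> crel X' l' g' c'"
proof -
  obtain Y m k d where Y: "gluing Y m k k" "eg Y m k k \<le> 0" "Y \<inter> X = {}" "d \<in> Y"
    "(d, m d) \<notin> orel Y k k" "ncl Y (crel Y m k k) = 1"
    by (rule edge_sphere[OF gluingD(1)[OF gl]])
  define X' where "X' = X \<union> Y"
  define l' where "l' = (\<lambda>f. if f \<in> X then l f else m f)"
  define g' where "g' = (\<lambda>f. if f \<in> X then g f else k f)"
  define c1 where "c1 = (\<lambda>f. if f \<in> X then c f else k f)"
  have dj: "X \<inter> Y = {}" using Y by auto
  note U = gluing_disjoint_union[OF gl Y(1) dj, folded l'_def g'_def c1_def X'_def]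
  have md: "m d \<in> Y" using fpfD[OF gluingD(2)[OF Y(1)]] Y(4) by auto
  have l'd: "l' d = m d" using Y dj by (auto simp: l'_def)
  have aX: "a \<in> X'" "d \<in> X'" "l' d \<in> X'" using a Y md l'd by (auto simp: X'_def)
  have eqC: "equiv UNIV (crel X l g c)" "equiv UNIV (crel X' l' g' c1)"
    and eqO: "equiv UNIV (orel X' g' c1)"
    using gluingD[OF gl] gluingD[OF U(1)] by (auto intro: equiv_crel equiv_orel)
  have crX: "v \<in> X" if "(u, v) \<in> crel X l g c" "u \<in> X" for u v
    using that rtrancl_Image_subset[of "lnk X l \<union> lnk X g \<union> lnk X c" X u] lnk_subset gluingD(2-4)[OF gl]
    unfolding crel_def by blast
  have sep: "(u, v) \<notin> crel X' l' g' c1" "(v, u) \<notin> crel X' l' g' c1" if "u \<in> X" "v \<in> Y" for u v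
  proof -
    show "(u, v) \<notin> crel X' l' g' c1" using U(4)[OF that(1)] crX that dj by auto
    then show "(v, u) \<notin> crel X' l' g' c1" using equivUD(2)[OF eqC(2)] by blast
  qed
  have sepO: "(u, v) \<notin> orel X' g' c1" "(v, u) \<notin> orel X' g' c1" if "u \<in> X" "v \<in> Y" for u v
    using sep[OF that] orel_subset_crel by blast+
  have ad: "(a, d) \<notin> crel X' l' g' c1" using sep a Y by auto
  have ad': "(a, d) \<notin> orel X' g' c1" using sepO a Y by auto
  interpret gluing_switch X' c1 a d l' g'
    by (rule gluing_switch_separate[OF U(1) aX(1,2) ad'])
  have o: "orel X' g' (sw c1 a d) = join (orel X' g' c1) a d" by (rule V.merging(2)[OF ad'])
  show thesis
  proof (rule that[OF gluing_sw])
    show "X \<subseteq> X'" "d \<in> X'" by (auto simp: X'_def Y)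
    show "f \<in> X \<Longrightarrow> l' f = l f" for f by (simp add: l'_def)
    show "eg X' l' g' (sw c1 a d) \<le> eg X l g c" using eg_sw_components[OF ad] U(2) Y(2) by simp
    show "ncl X' (crel X' l' g' (sw c1 a d)) \<le> ncl X (crel X l g c)"
      using ncl_crel_sw_components[OF ad] U(3) Y(6) by simp
    show "(u, v) \<in> orel X' g' (sw c1 a d) \<longleftrightarrow> (u, v) \<in> orel X g c" if "u \<in> X" "v \<in> X" for u v
      unfolding o join_def using sepO[OF that(1) Y(4)] sepO[OF that(2) Y(4)] U(5)[OF that(1)] by auto
    show "(a, d) \<in> orel X' g' (sw c1 a d)" unfolding o by (rule join_mem[OF eqO])
    show "(l' d, u) \<notin> orel X' g' (sw c1 a d)" if "u \<in> X" for u
      unfolding o join_def l'd using sepO[OF that md] sepO[OF that Y(4)] U(6)[OF Y(4)] Y(5) by auto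
    show "(l' d, b) \<notin> crel X' l' g' (sw c1 a d)" if b: "b \<in> X" "(a, b) \<notin> crel X l g c" for b
    proof
      assume "(l' d, b) \<in> crel X' l' g' (sw c1 a d)"
      then have "(m d, b) \<in> join (crel X' l' g' c1) a d" using crel_sw_subset l'd by auto
      then show False using sep[OF b(1) md] sep[OF b(1) Y(4)] sep[OF a md] U(4)[OF a] b(2) by (auto simp: join_def)
    qed
  qed
qed

text \<open>A pendant edge at \<open>a\<close> whose free end is then merged with the vertex of
  \<open>b\<close>. The second switch is free of cost only across components; within one component
  the genus may grow, so no bound is claimed there.\<close>

lemma add_edge:
  fixes X :: "nat set"
  assumes gl: "gluing X l g c" and a: "a \<in> X" and b: "b \<in> X"
  obtains X' l' g' c' f where "gluing X' l' g' c'" "X \<subseteq> X'" "\<And>f. f \<in> X \<Longrightarrow> l' f = l f"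
    "\<And>u v. u \<in> X \<Longrightarrow> v \<in> X \<Longrightarrow> (u, v) \<in> orel X' g' c' \<longleftrightarrow> (u, v) \<in> orel X g c"
    "f \<in> X'" "(a, f) \<in> orel X' g' c'" "(b, l' f) \<in> orel X' g' c'"
    "(a, b) \<notin> crel X l g c \<Longrightarrow> eg X' l' g' c' \<le> eg X l g c"
    "(a, b) \<notin> crel X l g c \<Longrightarrow> ncl X' (crel X' l' g' c') + 1 \<le> ncl X (crel X l g c)"
proof -
  obtain X' l' g' c' d where E: "gluing X' l' g' c'" "X \<subseteq> X'" "\<And>f. f \<in> X \<Longrightarrow> l' f = l f"
    "eg X' l' g' c' \<le> eg X l g c" "ncl X' (crel X' l' g' c') \<le> ncl X (crel X l g c)"
    "\<And>u v. u \<in> X \<Longrightarrow> v \<in> X \<Longrightarrow> (u, v) \<in> orel X' g' c' \<longleftrightarrow> (u, v) \<in> orel X g c"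
    "d \<in> X'" "(a, d) \<in> orel X' g' c'" "\<And>u. u \<in> X \<Longrightarrow> (l' d, u) \<notin> orel X' g' c'"
    "\<And>b. b \<in> X \<Longrightarrow> (a, b) \<notin> crel X l g c \<Longrightarrow> (l' d, b) \<notin> crel X' l' g' c'"
    by (rule add_pendant_edge[OF gl a], rule that)
  have ld: "l' d \<in> X'" using fpfD[OF gluingD(2)[OF E(1)]] E(7) by auto
  have eqO: "equiv UNIV (orel X' g' c')" using gluingD[OF E(1)] by (intro equiv_orel)
  have nb: "(l' d, b) \<notin> orel X' g' c'" using E(9) b by auto
  interpret gluing_switch X' c' "l' d" b l' g'
    using gluing_switch_separate[OF E(1) ld _ nb] b E(2) by auto
  have o: "orel X' g' (sw c' (l' d) b) = join (orel X' g' c') (l' d) b" by (rule V.merging(2)[OF nb])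
  show thesis
  proof (rule that[OF gluing_sw E(2,3) _ E(7)])
    show "(u, v) \<in> orel X' g' (sw c' (l' d) b) \<longleftrightarrow> (u, v) \<in> orel X g c" if "u \<in> X" "v \<in> X" for u v
      unfolding o join_def using E(9) that E(6) by auto
    show "(a, d) \<in> orel X' g' (sw c' (l' d) b)" "(b, l' d) \<in> orel X' g' (sw c' (l' d) b)"
      unfolding o using E(8) join_mem[OF eqO] by blast+
    assume "(a, b) \<notin> crel X l g c"
    then have n: "(l' d, b) \<notin> crel X' l' g' c'" using E(10) b by auto
    show "eg X' l' g' (sw c' (l' d) b) \<le> eg X l g c" using eg_sw_components[OF n] E(4) by simp
    show "ncl X' (crel X' l' g' (sw c' (l' d) b)) + 1 \<le> ncl X (crel X l g c)"
      using ncl_crel_sw_components[OF n] E(5) by simp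
  qed
qed

text \<open>A vertex without edges still needs a flag in the surface; it becomes the free end of an
  auxiliary pendant edge.\<close>

lemma add_vertices:
  fixes X :: "nat set"
  assumes "finite U" "gluing X l g c" "X \<noteq> {}" "draws W A X l g c \<rho>" "A \<subseteq> W \<times> W" "U \<inter> W = {}"
  shows "\<exists>X' l' g' c' \<rho>'. gluing X' l' g' c' \<and> (X' :: nat set) \<noteq> {} \<and> eg X' l' g' c' \<le> eg X l g c \<and>
    draws (W \<union> U) A X' l' g' c' \<rho>'"
  using assms(1,6)
proof (induction U rule: finite_induct)
  case empty
  then show ?case using assms(2-4)
    by (intro exI[of _ X] exI[of _ l] exI[of _ g] exI[of _ c] exI[of _ \<rho>]) simp
next
  case (insert z U)
  have "U \<inter> W = {}" using insert.prems by auto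
  then obtain X1 l1 g1 c1 \<rho>1 where 1: "gluing X1 l1 g1 c1" "(X1 :: nat set) \<noteq> {}" "eg X1 l1 g1 c1 \<le> eg X l g c"
    "draws (W \<union> U) A X1 l1 g1 c1 \<rho>1" using insert.IH by metis
  obtain a where a: "a \<in> X1" using 1(2) by auto
  obtain X' l' g' c' d where E: "gluing X' l' g' c'" "X1 \<subseteq> X'" "\<And>f. f \<in> X1 \<Longrightarrow> l' f = l1 f"
    "eg X' l' g' c' \<le> eg X1 l1 g1 c1" "ncl X' (crel X' l' g' c') \<le> ncl X1 (crel X1 l1 g1 c1)"
    "\<And>u v. u \<in> X1 \<Longrightarrow> v \<in> X1 \<Longrightarrow> (u, v) \<in> orel X' g' c' \<longleftrightarrow> (u, v) \<in> orel X1 g1 c1"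
    "d \<in> X'" "(a, d) \<in> orel X' g' c'" "\<And>u. u \<in> X1 \<Longrightarrow> (l' d, u) \<notin> orel X' g' c'"
    "\<And>b. b \<in> X1 \<Longrightarrow> (a, b) \<notin> crel X1 l1 g1 c1 \<Longrightarrow> (l' d, b) \<notin> crel X' l' g' c'"
    by (rule add_pendant_edge[OF 1(1) a], rule that)
  have eqO: "equiv UNIV (orel X' g' c')" using gluingD[OF E(1)] by (intro equiv_orel)
  have dr: "draws (W \<union> U) A X' l' g' c' \<rho>1"
    using 1(4) assms(5) fpfD[OF gluingD(2)[OF 1(1)]] by (intro draws_extend[OF 1(4) _ E(2,3) _ E(6)]) auto
  have z: "z \<notin> W \<union> U" using insert by auto
  have "draws (W \<union> insert z U) A X' l' g' c' (\<rho>1(z := l' d))"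
  proof (rule drawsI)
    show "(\<rho>1(z := l' d)) u \<in> X'" if "u \<in> W \<union> insert z U" for u
      using that drawsD(1)[OF dr] fpfD(1)[OF gluingD(2)[OF E(1)] E(7)] by auto
    show "u = v" if "u \<in> W \<union> insert z U" "v \<in> W \<union> insert z U"
      "((\<rho>1(z := l' d)) u, (\<rho>1(z := l' d)) v) \<in> orel X' g' c'" for u v
    proof -
      have "\<rho>1 w \<in> X1" if "w \<in> W \<union> U" for w using drawsD(1)[OF 1(4) that] .
      then have "(l' d, \<rho>1 w) \<notin> orel X' g' c'" "(\<rho>1 w, l' d) \<notin> orel X' g' c'" if "w \<in> W \<union> U" for w
        using that E(9) equivUD(2)[OF eqO] by blast+
      then show ?thesis using that drawsD(2)[OF dr, of u v] by (auto split: if_splits)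
    qed
    fix u v assume uv: "(u, v) \<in> A"
    then have "u \<noteq> z" "v \<noteq> z" using z assms(5) by auto
    then show "\<exists>f\<in>X'. ((\<rho>1(z := l' d)) u, f) \<in> orel X' g' c' \<and> ((\<rho>1(z := l' d)) v, l' f) \<in> orel X' g' c'"
      using drawsD(3)[OF dr uv] by simp
  qed
  moreover have "X' \<noteq> {}" using E(7) by auto
  ultimately show ?case using E(1,4) 1(3) by (intro exI[of _ X'] exI) auto
qed

text \<open>An edge added between two components unites them without raising the genus, and it
  leaves the drawing as it is.\<close>

lemma connect_components:
  fixes X :: "nat set"
  assumes "gluing X l g c" "X \<noteq> {}" "draws V A X l g c \<rho>" "A \<subseteq> V \<times> V"
  shows "\<exists>X' l' g' c'. gluing X' l' g' c' \<and> ncl (X' :: nat set) (crel X' l' g' c') = 1 \<and>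
    eg X' l' g' c' \<le> eg X l g c \<and> draws V A X' l' g' c' \<rho>"
  using assms
proof (induction "ncl X (crel X l g c)" arbitrary: X l g c rule: less_induct)
  case less
  note gl = less.prems(1)
  have eqC: "equiv UNIV (crel X l g c)" using gluingD[OF gl] by (auto intro: equiv_crel)
  show ?case
  proof (cases "\<forall>a\<in>X. \<forall>b\<in>X. (a, b) \<in> crel X l g c")
    case True
    obtain a where a: "a \<in> X" using less.prems(2) by auto
    have "X // crel X l g c = {crel X l g c `` {a}}"
    proof (intro equalityI subsetI)
      fix W assume "W \<in> X // crel X l g c"
      then obtain b where "b \<in> X" "W = crel X l g c `` {b}" by (auto simp: quotient_def)
      then show "W \<in> {crel X l g c `` {a}}" using True a equiv_class_eq[OF eqC, of a b] by simp
    qed (use a in \<open>auto intro: quotientI\<close>)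
    then have "ncl X (crel X l g c) = 1" by (simp add: ncl_def)
    then show ?thesis using less.prems by blast
  next
    case False
    then obtain a b where ab: "a \<in> X" "b \<in> X" "(a, b) \<notin> crel X l g c" by auto
    obtain X' l' g' c' f where E: "gluing X' l' g' c'" "X \<subseteq> X'" "\<And>f. f \<in> X \<Longrightarrow> l' f = l f"
      "\<And>u v. u \<in> X \<Longrightarrow> v \<in> X \<Longrightarrow> (u, v) \<in> orel X' g' c' \<longleftrightarrow> (u, v) \<in> orel X g c"
      "f \<in> X'" "(a, f) \<in> orel X' g' c'" "(b, l' f) \<in> orel X' g' c'"
      "(a, b) \<notin> crel X l g c \<Longrightarrow> eg X' l' g' c' \<le> eg X l g c"
      "(a, b) \<notin> crel X l g c \<Longrightarrow> ncl X' (crel X' l' g' c') + 1 \<le> ncl X (crel X l g c)"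
      by (rule add_edge[OF gl ab(1,2)], rule that)
    have "draws V A X' l' g' c' \<rho>"
      using less.prems(3,4) fpfD[OF gluingD(2)[OF gl]] by (intro draws_extend[OF less.prems(3) _ E(2,3) _ E(4)]) auto
    moreover have "X' \<noteq> {}" using ab E(2) by auto
    moreover have "ncl X' (crel X' l' g' c') < ncl X (crel X l g c)" using E(9)[OF ab(3)] by simp
    ultimately obtain X2 l2 g2 c2 where "gluing X2 l2 g2 c2" "ncl (X2 :: nat set) (crel X2 l2 g2 c2) = 1"
      "eg X2 l2 g2 c2 \<le> eg X' l' g' c'" "draws V A X2 l2 g2 c2 \<rho>"
      using less.hyps[of X' l' g' c'] E(1) less.prems(4) by auto
    then show ?thesis using E(8)[OF ab(3)] by (intro exI[of _ X2] exI[of _ l2] exI[of _ g2] exI[of _ c2]) auto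
  qed
qed

text \<open>The way back from gluings to surfaces. The gluing may be disconnected and the drawing
  may omit isolated vertices, which is what remains after edges have been detached and the sides
  separated; both defects are repaired at no cost.\<close>

lemma euler_genus_le:
  fixes X :: "nat set"
  assumes gl: "gluing X l g c" "X \<noteq> {}" "draws W (parcs G) X l g c \<rho>" "parcs G \<subseteq> W \<times> W"
    and W: "W \<subseteq> pverts G" "finite (pverts G)"
  shows "int (euler_genus G) \<le> eg X l g c"
proof -
  obtain X1 l1 g1 c1 \<rho>1 where 1: "gluing X1 l1 g1 c1" "(X1 :: nat set) \<noteq> {}" "eg X1 l1 g1 c1 \<le> eg X l g c"
    "draws (W \<union> (pverts G - W)) (parcs G) X1 l1 g1 c1 \<rho>1"
    using add_vertices[OF finite_Diff[OF W(2)] gl Diff_disjoint[of W "pverts G", unfolded Int_commute[of W]]] by blast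
  have eq: "W \<union> (pverts G - W) = pverts G" and A: "parcs G \<subseteq> pverts G \<times> pverts G" using W gl(4) by auto
  obtain X2 l2 g2 c2 where 2: "gluing X2 l2 g2 c2" "ncl (X2 :: nat set) (crel X2 l2 g2 c2) = 1"
    "eg X2 l2 g2 c2 \<le> eg X1 l1 g1 c1" "draws (pverts G) (parcs G) X2 l2 g2 c2 \<rho>1"
    using connect_components[OF 1(1,2) 1(4)[unfolded eq] A] by metis
  define S where "S = \<lparr>flags = X2, along = l2, corner = c2, glue = g2\<rparr>"
  have S: "closed_surface S" using 2 by (simp add: closed_surface_iff S_def)
  have "embeds_in G S"
    using 2(4) by (subst embeds_in_iff[OF S A]) (auto simp: S_def)
  moreover have "surface_euler_genus S = eg X2 l2 g2 c2" using surface_euler_genus_eq[OF S] by (simp add: S_def)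
  ultimately have "euler_genus G \<le> nat (eg X2 l2 g2 c2)"
    unfolding euler_genus_def using S eg_nonneg[OF 2(1)] by (intro Least_le) auto
  then show ?thesis using 1(3) 2(3) eg_nonneg[OF 2(1)] by linarith
qed

text \<open>Every graph embeds somewhere, at whatever genus. Without this the \<open>LEAST\<close>
  in \<open>euler_genus\<close> would say nothing about the graph.\<close>

lemma exists_drawing:
  assumes "finite V" "finite A" "A \<subseteq> V \<times> V"
  shows "\<exists>X l g c \<rho>. gluing X l g c \<and> (X :: nat set) \<noteq> {} \<and> draws V A X l g c \<rho>"
  using assms(2,3)
proof (induction A rule: finite_induct)
  case empty
  obtain Y l g d where Y: "gluing Y l g g" "(d :: nat) \<in> Y"
    by (rule edge_sphere[OF finite.emptyI], rule that)
  have "draws {} {} Y l g g (\<lambda>_. d)" by (simp add: draws_def)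
  then show ?case using add_vertices[OF assms(1) Y(1) _ _ empty_subsetI Int_empty_right] Y(2)
    by (metis Un_empty_left empty_iff)
next
  case (insert p A)
  obtain x y where p: "p = (x, y)" by (cases p)
  obtain X l g c \<rho> where X: "gluing X l g c" "(X :: nat set) \<noteq> {}" "draws V A X l g c \<rho>"
    using insert.IH insert.prems by (metis insert_subset)
  have xy: "\<rho> x \<in> X" "\<rho> y \<in> X" using drawsD(1)[OF X(3)] insert.prems p by auto
  obtain X' l' g' c' f where E: "gluing X' l' g' c'" "X \<subseteq> X'" "\<And>f. f \<in> X \<Longrightarrow> l' f = l f"
    "\<And>u v. u \<in> X \<Longrightarrow> v \<in> X \<Longrightarrow> (u, v) \<in> orel X' g' c' \<longleftrightarrow> (u, v) \<in> orel X g c"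
    "f \<in> X'" "(\<rho> x, f) \<in> orel X' g' c'" "(\<rho> y, l' f) \<in> orel X' g' c'"
    "(\<rho> x, \<rho> y) \<notin> crel X l g c \<Longrightarrow> eg X' l' g' c' \<le> eg X l g c"
    "(\<rho> x, \<rho> y) \<notin> crel X l g c \<Longrightarrow> ncl X' (crel X' l' g' c') + 1 \<le> ncl X (crel X l g c)"
    by (rule add_edge[OF X(1) xy], rule that)
  have dr: "draws V A X' l' g' c' \<rho>"
    using insert.prems fpfD[OF gluingD(2)[OF X(1)]] by (intro draws_extend[OF X(3) _ E(2,3) _ E(4)]) auto
  then have "draws V (insert p A) X' l' g' c' \<rho>" using E(5-7) unfolding draws_def p by auto
  moreover have "X' \<noteq> {}" using E(5) by auto
  ultimately show ?case using E(1) by blast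
qed

lemma euler_genus_drawing:
  assumes fin: "finite (pverts G)" and A: "parcs G \<subseteq> pverts G \<times> pverts G"
  obtains X l g c \<rho> where "gluing X l g c" "(X :: nat set) \<noteq> {}" "draws (pverts G) (parcs G) X l g c \<rho>"
    "eg X l g c = int (euler_genus G)"
proof -
  have "finite (parcs G)" using fin A finite_subset by blast
  then obtain X l g c \<rho> where X: "gluing X l g c" "(X :: nat set) \<noteq> {}" "draws (pverts G) (parcs G) X l g c \<rho>"
    using exists_drawing[OF fin _ A] by blast
  obtain X2 l2 g2 c2 where 2: "gluing X2 l2 g2 c2" "ncl (X2 :: nat set) (crel X2 l2 g2 c2) = 1"
    "draws (pverts G) (parcs G) X2 l2 g2 c2 \<rho>"
    using connect_components[OF X A] by blast
  define S where "S = \<lparr>flags = X2, along = l2, corner = c2, glue = g2\<rparr>"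
  have S: "closed_surface S" using 2 by (simp add: closed_surface_iff S_def)
  have "embeds_in G S"
    using 2 by (subst embeds_in_iff[OF S A]) (auto simp: S_def)
  moreover have "surface_euler_genus S = int (nat (eg X2 l2 g2 c2))"
    using surface_euler_genus_eq[OF S] eg_nonneg[OF 2(1)] by (simp add: S_def)
  ultimately have "\<exists>k. \<exists>S :: nat polygon_gluing. closed_surface S \<and> surface_euler_genus S = int k \<and> embeds_in G S"
    using S by blast
  from LeastI_ex[OF this] obtain T :: "nat polygon_gluing" where T: "closed_surface T"
    "surface_euler_genus T = int (euler_genus G)" "embeds_in G T" unfolding euler_genus_def by blast
  have glT: "gluing (flags T) (along T) (glue T) (corner T)"
    "ncl (flags T) (crel (flags T) (along T) (glue T) (corner T)) = 1" using T(1) closed_surface_iff by blast+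
  have "flags T \<noteq> {}" using glT(2) by (auto simp: ncl_def)
  then show thesis using that[OF glT(1)] T embeds_in_iff[OF T(1) A] surface_euler_genus_eq[OF T(1)] by auto
qed

section \<open>Amalgamation along an edge\<close>

text \<open>Two switches identify the edges of \<open>p\<close> and \<open>q\<close> end by end. The
  first one joins two components; the second one joins two vertices that by then lie on a common
  face, and it cuts off the digon between the two parallel edges.\<close>

lemma amalgamate:
  assumes gl: "gluing X l g c" and p: "p \<in> X" and q: "q \<in> X" and pq: "(p, q) \<notin> crel X l g c"
    and pl: "(p, l p) \<notin> orel X g c" and ql: "(q, l q) \<notin> orel X g c"
  obtains c' where "gluing X l g c'" "eg X l g c' \<le> eg X l g c" "c' p = q" "c' (l p) = l q"
    "\<And>s t. (s, t) \<in> orel X g c' \<longleftrightarrow> (s, t) \<in> orel X g c \<or>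
       (p, s) \<in> orel X g c \<and> (q, t) \<in> orel X g c \<or> (q, s) \<in> orel X g c \<and> (p, t) \<in> orel X g c \<or>
       (l p, s) \<in> orel X g c \<and> (l q, t) \<in> orel X g c \<or> (l q, s) \<in> orel X g c \<and> (l p, t) \<in> orel X g c"
    "\<And>f. f \<notin> {p, c p, q, c q, l p, c (l p), l q, c (l q)} \<Longrightarrow> c' f = c f"
proof -
  note lf = fpfD[OF gluingD(2)[OF gl]]
  let ?O = "orel X g c"
  have eqC: "equiv UNIV (crel X l g c)" and eqO: "equiv UNIV ?O"
    using gluingD[OF gl] by (auto intro: equiv_crel equiv_orel)
  note C = equivUD[OF eqC] and O = equivUD[OF eqO]
  have lp: "l p \<in> X" "l (l p) = p" "l p \<noteq> p" and lq: "l q \<in> X" "l (l q) = q" "l q \<noteq> q" using lf p q by auto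
  have cp: "(p, l p) \<in> crel X l g c" "(q, l q) \<in> crel X l g c" using p q by (auto intro: crel_stepI)
  have sep: "(p, q) \<notin> ?O" "(p, l q) \<notin> ?O" "(l p, q) \<notin> ?O" "(l p, l q) \<notin> ?O" "(q, l p) \<notin> ?O"
    using orel_subset_crel(2)[of X g c l] pq cp C(2,3) by blast+
  interpret A: gluing_switch X c p q l g by (rule gluing_switch_separate[OF gl p q sep(1)])
  define c1 where "c1 = sw c p q"
  have o1: "orel X g c1 = join ?O p q" unfolding c1_def by (rule A.V.merging(2)[OF sep(1)])
  have J1: "(l p, s) \<in> orel X g c1 \<longleftrightarrow> (l p, s) \<in> ?O" "(l q, s) \<in> orel X g c1 \<longleftrightarrow> (l q, s) \<in> ?O" for s
    unfolding o1 join_def using pl ql sep O(2) by auto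
  have n2: "(l p, l q) \<notin> orel X g c1" using J1 sep by auto
  have gl1: "gluing X l g c1" unfolding c1_def by (rule A.gluing_sw)
  interpret B: gluing_switch X c1 "l p" "l q" l g by (rule gluing_switch_separate[OF gl1 lp(1) lq(1) n2])
  have c1p: "c1 p = q" "c1 q = p" by (auto simp: c1_def)
  have ne: "p \<noteq> q" "p \<noteq> l q" "q \<noteq> l p" using sep O(1) by metis+
  have pe: "p \<notin> B.ends" "q \<notin> B.ends"
    using ne lp lq c1p fpfD(3)[OF gluingD(4)[OF gl1] lp(1)] fpfD(3)[OF gluingD(4)[OF gl1] lq(1)] by auto
  \<comment> \<open>After the first switch the face runs through \<open>l p\<close>,
    \<open>p\<close>, \<open>q\<close>, \<open>l q\<close> without passing an end of the second
    switch in between, so that the second switch splits this face.\<close>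
  have "(l p, p) \<in> B.F.K" using lp by (intro r_into_rtrancl) (auto simp: lnk_def)
  moreover have "(p, q) \<in> B.F.K" using p pe c1p by (intro r_into_rtrancl) (auto simp: lnk_def)
  moreover have "(q, l q) \<in> B.F.K" using q by (intro r_into_rtrancl) (auto simp: lnk_def)
  ultimately have K: "(l p, l q) \<in> B.F.K" by (meson rtrancl_trans)
  show thesis
  proof (rule that[OF B.gluing_sw])
    show "eg X l g (sw c1 (l p) (l q)) \<le> eg X l g c"
      using B.eg_sw_face[OF n2 K] A.eg_sw_components[OF pq] by (simp add: c1_def)
    show "sw c1 (l p) (l q) p = q" "sw c1 (l p) (l q) (l p) = l q" using pe c1p by auto
    show "(s, t) \<in> orel X g (sw c1 (l p) (l q)) \<longleftrightarrow> (s, t) \<in> orel X g c \<or>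
       (p, s) \<in> orel X g c \<and> (q, t) \<in> orel X g c \<or> (q, s) \<in> orel X g c \<and> (p, t) \<in> orel X g c \<or>
       (l p, s) \<in> orel X g c \<and> (l q, t) \<in> orel X g c \<or> (l q, s) \<in> orel X g c \<and> (l p, t) \<in> orel X g c" for s t
      unfolding B.V.merging(2)[OF n2] join_def[of "orel X g c1"] using J1 by (auto simp: o1 join_def)
    fix f assume f: "f \<notin> {p, c p, q, c q, l p, c (l p), l q, c (l q)}"
    then have "c1 f = c f" by (simp add: c1_def)
    moreover have "f \<notin> B.ends"
    proof -
      have "c1 (l p) \<in> {c p, c q, c (l p), p, q}"
        using ne lp by (cases "l p \<in> A.ends") (auto simp: c1_def)
      moreover have "c1 (l q) \<in> {c p, c q, c (l q), p, q}"
        using ne lq by (cases "l q \<in> A.ends") (auto simp: c1_def)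
      ultimately show ?thesis using f by auto
    qed
    ultimately show "sw c1 (l p) (l q) f = c f" by simp
  qed
qed

text \<open>The two copies of \<open>xy\<close> survive as parallel edges of the 1-skeleton. A
  drawing of the simple graph may choose either of them.\<close>

lemma euler_genus_amalgamation_le:
  assumes fin: "finite (pverts G\<^sub>1)" "finite (pverts G\<^sub>2)"
    and A: "parcs G\<^sub>1 \<subseteq> pverts G\<^sub>1 \<times> pverts G\<^sub>1" "parcs G\<^sub>2 \<subseteq> pverts G\<^sub>2 \<times> pverts G\<^sub>2"
    and xy: "pverts G\<^sub>1 \<inter> pverts G\<^sub>2 = {x, y}" "x \<noteq> y" "(x, y) \<in> parcs G\<^sub>1" "(x, y) \<in> parcs G\<^sub>2"
    and G: "pverts G = pverts G\<^sub>1 \<union> pverts G\<^sub>2" "parcs G = parcs G\<^sub>1 \<union> parcs G\<^sub>2"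
  shows "euler_genus G \<le> euler_genus G\<^sub>1 + euler_genus G\<^sub>2"
proof -
  let ?V1 = "pverts G\<^sub>1" and ?V2 = "pverts G\<^sub>2"
  obtain X1 l1 g1 c1 \<rho>1 where 1: "gluing X1 l1 g1 c1" "(X1 :: nat set) \<noteq> {}" "draws ?V1 (parcs G\<^sub>1) X1 l1 g1 c1 \<rho>1"
    "eg X1 l1 g1 c1 = int (euler_genus G\<^sub>1)"
    by (rule euler_genus_drawing[OF fin(1) A(1)])
  obtain X0 l0 g0 c0 \<rho>0 where 0: "gluing X0 l0 g0 c0" "(X0 :: nat set) \<noteq> {}" "draws ?V2 (parcs G\<^sub>2) X0 l0 g0 c0 \<rho>0"
    "eg X0 l0 g0 c0 = int (euler_genus G\<^sub>2)"
    by (rule euler_genus_drawing[OF fin(2) A(2)])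
  obtain n where n: "\<forall>f\<in>X1. f < n" using iffD1[OF finite_nat_set_iff_bounded gluingD(1)[OF 1(1)]] by auto
  \<comment> \<open>All flags of the first drawing are below \<open>n\<close>, so a shift by
    \<open>n\<close> makes the second one disjoint from it.\<close>
  define h where "h = (+) n"
  have h: "inj_on h X0" by (simp add: h_def)
  define r where "r t = h \<circ> t \<circ> inv_into X0 h" for t
  note R = gluing_renaming[OF 0(1) h, folded r_def]
  define X2 l2 g2 c2 where "X2 = h ` X0" and "l2 = r l0" and "g2 = r g0" and "c2 = r c0"
  note R = R[folded X2_def l2_def g2_def c2_def]
  have l0X: "l0 f \<in> X0" if "f \<in> X0" for f using fpfD[OF gluingD(2)[OF 0(1)] that] by simp
  have d2: "draws ?V2 (parcs G\<^sub>2) X2 l2 g2 c2 (h \<circ> \<rho>0)"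
  proof (rule drawsI)
    show "(h \<circ> \<rho>0) u \<in> X2" if "u \<in> ?V2" for u using drawsD(1)[OF 0(3) that] by (simp add: X2_def)
    show "u = v" if "u \<in> ?V2" "v \<in> ?V2" "((h \<circ> \<rho>0) u, (h \<circ> \<rho>0) v) \<in> orel X2 g2 c2" for u v
      using that drawsD(1,2)[OF 0(3)] R(3) by simp
    fix u v assume uv: "(u, v) \<in> parcs G\<^sub>2"
    then obtain f where f: "f \<in> X0" "(\<rho>0 u, f) \<in> orel X0 g0 c0" "(\<rho>0 v, l0 f) \<in> orel X0 g0 c0"
      using drawsD(3)[OF 0(3)] by blast
    have "\<rho>0 u \<in> X0" "\<rho>0 v \<in> X0" using uv A drawsD(1)[OF 0(3)] by auto
    then show "\<exists>f\<in>X2. ((h \<circ> \<rho>0) u, f) \<in> orel X2 g2 c2 \<and> ((h \<circ> \<rho>0) v, l2 f) \<in> orel X2 g2 c2"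
      using f R(3,4) l0X by (intro bexI[of _ "h f"]) (auto simp: X2_def)
  qed
  define \<rho>2 where "\<rho>2 = h \<circ> \<rho>0"
  note d2 = d2[folded \<rho>2_def]
  have dj: "X1 \<inter> X2 = {}" using n by (auto simp: X2_def h_def)
  define X where "X = X1 \<union> X2"
  define l where "l = (\<lambda>f. if f \<in> X1 then l1 f else l2 f)"
  define g where "g = (\<lambda>f. if f \<in> X1 then g1 f else g2 f)"
  define c where "c = (\<lambda>f. if f \<in> X1 then c1 f else c2 f)"
  note U = gluing_disjoint_union[OF 1(1) R(1) dj, folded X_def l_def g_def c_def]
  have eqO: "equiv UNIV (orel X g c)"
    using gluingD[OF U(1)] by (auto intro: equiv_orel)
  note O = equivUD[OF eqO]
  have cl1: "v \<in> X1" if "(u, v) \<in> orel X g c" "u \<in> X1" for u v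
    using that U(5) orel_subset[OF gluingD(3,4)[OF 1(1)]] by blast
  have cl2: "v \<in> X2" if "(u, v) \<in> orel X g c" "u \<in> X2" for u v
    using that U(6) orel_subset[OF gluingD(3,4)[OF R(1)]] by blast
  have lX1: "l f = l1 f" "l f \<in> X1" if "f \<in> X1" for f using fpfD[OF gluingD(2)[OF 1(1)] that] that by (auto simp: l_def)
  have lX2: "l f = l2 f" "l f \<in> X2" if "f \<in> X2" for f
    using fpfD[OF gluingD(2)[OF R(1)] that] that dj by (auto simp: l_def)
  have D1: "\<rho>1 u \<in> X1" if "u \<in> ?V1" for u using drawsD(1)[OF 1(3) that] .
  have D2: "\<rho>2 u \<in> X2" if "u \<in> ?V2" for u using drawsD(1)[OF d2 that] .
  have I1: "u = v" if "u \<in> ?V1" "v \<in> ?V1" "(\<rho>1 u, \<rho>1 v) \<in> orel X g c" for u v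
    using that drawsD(2)[OF 1(3)] U(5) D1 by blast
  have I2: "u = v" if "u \<in> ?V2" "v \<in> ?V2" "(\<rho>2 u, \<rho>2 v) \<in> orel X g c" for u v
    using that drawsD(2)[OF d2] U(6) D2 by blast
  have E1: "\<exists>f\<in>X1. (\<rho>1 u, f) \<in> orel X g c \<and> (\<rho>1 v, l f) \<in> orel X g c" if uv: "(u, v) \<in> parcs G\<^sub>1" for u v
  proof -
    have "u \<in> ?V1" "v \<in> ?V1" using uv A by auto
    then show ?thesis using drawsD(3)[OF 1(3) uv] lX1 U(5) D1 by metis
  qed
  have E2: "\<exists>f\<in>X2. (\<rho>2 u, f) \<in> orel X g c \<and> (\<rho>2 v, l f) \<in> orel X g c" if uv: "(u, v) \<in> parcs G\<^sub>2" for u v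
  proof -
    have "u \<in> ?V2" "v \<in> ?V2" using uv A by auto
    then show ?thesis using drawsD(3)[OF d2 uv] lX2 U(6) D2 by metis
  qed
  obtain p where p: "p \<in> X1" "(\<rho>1 x, p) \<in> orel X g c" "(\<rho>1 y, l p) \<in> orel X g c" using E1[OF xy(3)] by auto
  obtain q where q: "q \<in> X2" "(\<rho>2 x, q) \<in> orel X g c" "(\<rho>2 y, l q) \<in> orel X g c" using E2[OF xy(4)] by auto
  have xyV: "x \<in> ?V1" "y \<in> ?V1" "x \<in> ?V2" "y \<in> ?V2" using xy by auto
  have sub1: "lnk X1 l1 \<union> lnk X1 g1 \<union> lnk X1 c1 \<subseteq> X1 \<times> X1"
    using lnk_subset[OF gluingD(2)[OF 1(1)]] lnk_subset[OF gluingD(3)[OF 1(1)]] lnk_subset[OF gluingD(4)[OF 1(1)]] by simp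
  have pq: "(p, q) \<notin> crel X l g c"
    using rtrancl_Image_subset[OF sub1 p(1)] U(4)[OF p(1), of q] q(1) dj by (auto simp: crel_def)
  have pl: "(p, l p) \<notin> orel X g c"
    using I1[OF xyV(1,2)] xy(2) p O(2,3) by meson
  have ql: "(q, l q) \<notin> orel X g c"
    using I2[OF xyV(3,4)] xy(2) q O(2,3) by meson
  have pX: "p \<in> X" "q \<in> X" using p q by (auto simp: X_def)
  obtain c' where c': "gluing X l g c'" "eg X l g c' \<le> eg X l g c" "c' p = q" "c' (l p) = l q"
    "\<And>s t. (s, t) \<in> orel X g c' \<longleftrightarrow> (s, t) \<in> orel X g c \<or>
       (p, s) \<in> orel X g c \<and> (q, t) \<in> orel X g c \<or> (q, s) \<in> orel X g c \<and> (p, t) \<in> orel X g c \<or>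
       (l p, s) \<in> orel X g c \<and> (l q, t) \<in> orel X g c \<or> (l q, s) \<in> orel X g c \<and> (l p, t) \<in> orel X g c"
    by (rule amalgamate[OF U(1) pX pq pl ql], rule that)
  \<comment> \<open>For \<open>x\<close> and \<open>y\<close> the flags of the first drawing are
    kept; the merged vertices contain those of the second one too.\<close>
  define \<rho> where "\<rho> u = (if u \<in> ?V1 then \<rho>1 u else \<rho>2 u)" for u
  have q_only: "(q, \<rho>2 u) \<notin> orel X g c" "(l q, \<rho>2 u) \<notin> orel X g c" if "u \<in> ?V2" "u \<notin> ?V1" for u
  proof -
    show "(q, \<rho>2 u) \<notin> orel X g c" using I2[OF xyV(3) that(1)] q(2) O(3) that(2) xyV(1) by metis
    show "(l q, \<rho>2 u) \<notin> orel X g c" using I2[OF xyV(4) that(1)] q(3) O(3) that(2) xyV(2) by metis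
  qed
  have n1: "(q, s) \<notin> orel X g c" "(l q, s) \<notin> orel X g c" if "s \<in> X1" for s
    using cl2[of q s] cl2[of "l q" s] lX2[OF q(1)] q(1) that dj by auto
  have n2: "(p, s) \<notin> orel X g c" "(l p, s) \<notin> orel X g c" if "s \<in> X2" for s
    using cl1[of p s] cl1[of "l p" s] lX1[OF p(1)] p(1) that dj by auto
  have dr: "draws (pverts G) (parcs G) X l g c' \<rho>"
  proof (rule drawsI)
    show "\<rho> u \<in> X" if "u \<in> pverts G" for u
      using that G D1 D2 by (auto simp: \<rho>_def X_def)
    show "u = v" if uv: "u \<in> pverts G" "v \<in> pverts G" "(\<rho> u, \<rho> v) \<in> orel X g c'" for u v
    proof (cases "u \<in> ?V1")
      case u: True
      then have u1: "\<rho> u = \<rho>1 u" "\<rho> u \<in> X1" using D1 by (auto simp: \<rho>_def)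
      show ?thesis
      proof (cases "v \<in> ?V1")
        case True
        then have "\<rho> v = \<rho>1 v" "\<rho> v \<in> X1" using D1 by (auto simp: \<rho>_def)
        then have "(\<rho>1 u, \<rho>1 v) \<in> orel X g c" using uv(3) n1 u1 unfolding c'(5) by auto
        then show ?thesis using I1 u True by blast
      next
        case False
        then have v: "\<rho> v = \<rho>2 v" "v \<in> ?V2" "\<rho> v \<in> X2" using uv G D2 by (auto simp: \<rho>_def)
        have "(\<rho> u, \<rho> v) \<notin> orel X g c" using cl1 u1 v dj by blast
        then show ?thesis using uv(3) q_only[OF v(2) False] n2[OF v(3)] v(1) unfolding c'(5) by auto
      qed
    next
      case u: False
      then have u2: "\<rho> u = \<rho>2 u" "u \<in> ?V2" "\<rho> u \<in> X2" using uv G D2 by (auto simp: \<rho>_def)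
      have *: "(\<rho> u, \<rho> v) \<in> orel X g c" using uv(3) q_only[OF u2(2) u] n2[OF u2(3)] u2(1) unfolding c'(5) by auto
      have "v \<notin> ?V1" using cl2[OF * u2(3)] D1[of v] dj unfolding \<rho>_def by (metis disjoint_iff)
      then have "\<rho> v = \<rho>2 v" "v \<in> ?V2" using uv G by (auto simp: \<rho>_def)
      then show ?thesis using * u2 I2 by auto
    qed
    have \<rho>2: "(\<rho> u, f) \<in> orel X g c'" if h: "u \<in> ?V2" "(\<rho>2 u, f) \<in> orel X g c" for u f
    proof (cases "u \<in> ?V1")
      case False
      then show ?thesis using h(2) unfolding c'(5) by (simp add: \<rho>_def)
    next
      case True
      then consider "u = x" | "u = y" using h(1) xy(1) by blast
      then show ?thesis
      proof cases
        case 1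
        have "(p, \<rho>1 x) \<in> orel X g c" using p(2) O(2) by blast
        moreover have "(q, f) \<in> orel X g c" using q(2) h(2) 1 O(2,3) by meson
        ultimately show ?thesis using 1 xyV unfolding c'(5) by (simp add: \<rho>_def)
      next
        case 2
        have "(l p, \<rho>1 y) \<in> orel X g c" using p(3) O(2) by blast
        moreover have "(l q, f) \<in> orel X g c" using q(3) h(2) 2 O(2,3) by meson
        ultimately show ?thesis using 2 xyV unfolding c'(5) by (simp add: \<rho>_def)
      qed
    qed
    fix u v assume "(u, v) \<in> parcs G"
    then consider "(u, v) \<in> parcs G\<^sub>1" | "(u, v) \<in> parcs G\<^sub>2" using G by auto
    then show "\<exists>f\<in>X. (\<rho> u, f) \<in> orel X g c' \<and> (\<rho> v, l f) \<in> orel X g c'"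
    proof cases
      case 1
      then have "u \<in> ?V1" "v \<in> ?V1" using A by auto
      moreover obtain f where "f \<in> X1" "(\<rho>1 u, f) \<in> orel X g c" "(\<rho>1 v, l f) \<in> orel X g c" using E1[OF 1] by auto
      ultimately show ?thesis unfolding c'(5) by (intro bexI[of _ f]) (auto simp: \<rho>_def X_def)
    next
      case 2
      then have "u \<in> ?V2" "v \<in> ?V2" using A by auto
      moreover obtain f where "f \<in> X2" "(\<rho>2 u, f) \<in> orel X g c" "(\<rho>2 v, l f) \<in> orel X g c" using E2[OF 2] by auto
      ultimately show ?thesis using \<rho>2 by (intro bexI[of _ f]) (auto simp: X_def)
    qed
  qed
  have "int (euler_genus G) \<le> eg X l g c'"
    using fin A G pX by (intro euler_genus_le[OF c'(1) _ dr]) auto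
  also have "\<dots> \<le> int (euler_genus G\<^sub>1) + int (euler_genus G\<^sub>2)" using c'(2) U(2) 1(4) 0(4) R(2) by simp
  finally show ?thesis by simp
qed

section \<open>Separating the two sides of an edge\<close>

definition mixed :: "'f set \<Rightarrow> ('f \<Rightarrow> bool) \<Rightarrow> ('f \<Rightarrow> 'f) \<Rightarrow> 'f set" where
  "mixed X col c = {f \<in> X. col (c f) \<noteq> col f}"

text \<open>
  The flags are coloured by the two sides.  The edges of \<open>p\<close> and \<open>q\<close> are parallel and bound a
  digon; their ends are the only vertices at which both colours may occur.
\<close>

locale coloured =
  fixes X :: "'f set" and l g :: "'f \<Rightarrow> 'f" and col :: "'f \<Rightarrow> bool" and R :: "('f \<times> 'f) set" and p q :: 'f
  assumes fin: "finite X" and l: "fpf_involution_on X l" and g: "fpf_involution_on X g"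
    and lg: "\<And>f. f \<in> X \<Longrightarrow> g (l f) = l (g f)" "\<And>f. f \<in> X \<Longrightarrow> g f \<noteq> l f"
    and R: "equiv UNIV R"
    and col: "\<And>f. f \<in> X \<Longrightarrow> col (l f) = col f" "\<And>f. f \<in> X \<Longrightarrow> col (g f) = col f"
    and pX: "p \<in> X" and qX: "q \<in> X" and colp: "col p" and colq: "\<not> col q"
    and pl: "(p, l p) \<notin> R"
begin

text \<open>The competitors in the extremal choice: sides, gluing and the vertex partition
  \<open>R\<close> are fixed, only the rotations vary, and the digon of \<open>p\<close> and
  \<open>q\<close> has to survive.\<close>

definition good :: "('f \<Rightarrow> 'f) \<Rightarrow> bool" where
  "good c \<longleftrightarrow> fpf_involution_on X c \<and> orel X g c = R \<and> c p = q \<and> c (l p) = l q \<and>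
     (\<forall>f\<in>X. (p, f) \<notin> R \<longrightarrow> (l p, f) \<notin> R \<longrightarrow> col (c f) = col f)"

definition nf :: "('f \<Rightarrow> 'f) \<Rightarrow> nat" where
  "nf c = ncl X (orel X l c)"

text \<open>A lexicographic order in one number: there are at most \<open>card X\<close> mixed
  flags, so with the factor \<open>card X + 1\<close> a gained face outweighs any number of them. As
  \<open>nf c\<close> is at most \<open>card X\<close>, the subtraction does not truncate.\<close>

definition \<mu> :: "('f \<Rightarrow> 'f) \<Rightarrow> nat" where
  "\<mu> c = (card X - nf c) * (card X + 1) + card (mixed X col c)"

lemma goodD:
  assumes "good c"
  shows "fpf_involution_on X c" "orel X g c = R" "c p = q" "c (l p) = l q" "gluing X l g c"
    "f \<in> X \<Longrightarrow> (p, f) \<notin> R \<Longrightarrow> (l p, f) \<notin> R \<Longrightarrow> col (c f) = col f"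
  using assms fin l g lg by (auto simp: good_def gluing_def)

lemma nf_le: "nf c \<le> card X"
proof -
  have "card ((\<lambda>x. orel X l c `` {x}) ` X) \<le> card X" using fin by (rule card_image_le)
  moreover have "X // orel X l c = (\<lambda>x. orel X l c `` {x}) ` X" by (auto simp: quotient_def)
  ultimately show ?thesis by (simp add: nf_def ncl_def)
qed

lemma card_mixed_le: "card (mixed X col c) \<le> card X"
  using fin by (intro card_mono) (auto simp: mixed_def)

lemma \<mu>_less_faces:
  assumes "nf c < nf c'"
  shows "\<mu> c' < \<mu> c"
proof -
  have "card X - nf c \<ge> Suc (card X - nf c')" using assms nf_le[of c'] by simp
  then have "Suc (card X - nf c') * (card X + 1) \<le> (card X - nf c) * (card X + 1)" by (rule mult_le_mono1)
  then show ?thesis unfolding \<mu>_def using card_mixed_le[of c'] by simp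
qed

lemma \<mu>_less_mixed:
  assumes "nf c \<le> nf c'" "mixed X col c' \<subset> mixed X col c"
  shows "\<mu> c' < \<mu> c"
proof -
  have "finite (mixed X col c)" using fin by (simp add: mixed_def)
  then have "card (mixed X col c') < card (mixed X col c)" using assms(2) by (rule psubset_card_mono)
  moreover have "(card X - nf c') * (card X + 1) \<le> (card X - nf c) * (card X + 1)"
    using assms(1) by (intro mult_le_mono1) simp
  ultimately show ?thesis unfolding \<mu>_def by linarith
qed

text \<open>
  Switching the two corners removes them from the mixed ones.  If it splits the vertex, it also
  splits the face, or else another switch gains a face; the part of the vertex that was cut off
  is put back next to the digon, which costs at most the face just gained.
\<close>

lemma merge_mixed_corners:
  assumes c: "good c" and a: "a \<in> X" "col a" "\<not> col (c a)" "(p, a) \<in> R"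
    and a': "a' \<in> X" "col a'" "\<not> col (c a')" "(p, a') \<in> R"
    and ne: "a \<noteq> a'" and face: "(a, a') \<in> orel X l c"
  shows "\<exists>c'. good c' \<and> nf c \<le> nf c' \<and> \<mu> c' < \<mu> c"
proof -
  note Rs = equivUD[OF R] and cf = fpfD[OF goodD(1)[OF c]] and gf = fpfD[OF g] and lf = fpfD[OF l]
  define b b' where "b = c a" and "b' = c a'"
  have b: "b \<in> X" "\<not> col b" "c b = a" and b': "b' \<in> X" "\<not> col b'" "c b' = a'"
    using cf a a' by (auto simp: b_def b'_def)
  have step: "(f, c f) \<in> R" if "f \<in> X" for f using orel_stepI(2)[OF that, of c g] goodD(2)[OF c] by simp
  have stepg: "(f, g f) \<in> R" if "f \<in> X" for f using orel_stepI(1)[OF that, of g c] goodD(2)[OF c] by simp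
  have bR: "(p, b) \<in> R" "(p, b') \<in> R"
    using step[OF a(1)] step[OF a'(1)] a(4) a'(4) Rs(3) unfolding b_def b'_def by blast+
  have pq: "(p, q) \<in> R" using step[OF pX] goodD(3)[OF c] by simp
  have lplq: "(l p, l q) \<in> R" using step[of "l p"] lf pX goodD(4)[OF c] by simp
  have plq: "(p, l q) \<notin> R" using pl lplq Rs(2,3) by blast
  have lX: "l p \<in> X" "l q \<in> X" using lf pX qX by auto
  have cq: "c q = p" "c (l q) = l p" using goodD(3,4)[OF c] cf pX lX by metis+
  \<comment> \<open>The face of \<open>p\<close> is the digon, which has only one corner at the
    vertex of \<open>p\<close>. Hence neither \<open>a\<close> nor \<open>a'\<close> is
    \<open>p\<close>, and the switch leaves the digon alone.\<close>
  have digon: "v \<in> {p, q, l p, l q}" if "(p, v) \<in> orel X l c" for v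
    using that unfolding orel_def
    by (rule rtrancl_closed) (use lf pX qX goodD(3,4)[OF c] cq in \<open>auto simp: lnk_def\<close>)
  have eqF: "equiv UNIV (orel X l c)" by (rule equiv_orel[OF l goodD(1)[OF c]])
  have pa: "p \<noteq> a"
  proof
    assume "p = a"
    then have "a' \<in> {p, q, l p, l q}" using digon face by simp
    then show False using \<open>p = a\<close> ne a' colq col(1)[OF qX] pl by auto
  qed
  have pa': "p \<noteq> a'"
  proof
    assume "p = a'"
    then have "a \<in> {p, q, l p, l q}" using digon face equivUD(2)[OF eqF] by simp
    then show False using \<open>p = a'\<close> ne a colq col(1)[OF qX] pl by auto
  qed
  have pends: "p \<notin> {a, b, a', b'}" using pa pa' colp b b' by auto
  have qends: "q \<notin> {a, b, a', b'}" using pa pa' colq a a' b b' cq by auto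
  have offR: "good c'" if "fpf_involution_on X c'" "orel X g c' = R" "c' p = q"
    "\<And>f. f \<in> X \<Longrightarrow> (p, f) \<notin> R \<Longrightarrow> c' f = c f" for c'
    unfolding good_def using that goodD[OF c] pl plq lX by auto
  interpret A: gluing_switch X c a a' l g
    using ne cf[OF a(1)] b a' a by (intro gluing_switchI goodD(5)[OF c]) (auto simp: b_def)
  have Aends: "A.ends = {a, b, a', b'}" by (auto simp: b_def b'_def)
  have pV: "(p, q) \<in> A.V.K" using pX pends goodD(3)[OF c] unfolding Aends by (intro r_into_rtrancl) (auto simp: lnk_def)
  define c1 where "c1 = sw c a a'"
  have c1: "c1 a = a'" "c1 a' = a" "c1 b = b'" "c1 b' = b" "\<And>f. f \<notin> {a, b, a', b'} \<Longrightarrow> c1 f = c f"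
    unfolding c1_def b_def b'_def by auto
  have c1f: "fpf_involution_on X c1" unfolding c1_def by (rule A.fpf_sw)
  have inM: "{a, b, a', b'} \<subseteq> mixed X col c" using a a' b b' by (auto simp: mixed_def b_def b'_def)
  have M1: "mixed X col c1 \<subseteq> mixed X col c - {a, b, a', b'}"
  proof
    fix f assume f: "f \<in> mixed X col c1"
    show "f \<in> mixed X col c - {a, b, a', b'}"
    proof (cases "f \<in> {a, b, a', b'}")
      case True
      then have "col (c1 f) = col f"
        using c1(1-4) a(2) a'(2) b(2) b'(2) by (elim insertE emptyE) simp_all
      then show ?thesis using f by (simp add: mixed_def)
    next
      case False
      then show ?thesis using f c1(5)[OF False] by (simp add: mixed_def)
    qed
  qed
  \<comment> \<open>Since \<open>a\<close> and \<open>a'\<close> share a face, the switch cannot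
    merge two faces.\<close>
  have nf1: "nf c \<le> nf c1"
    using A.F.splitting(4) A.F.crossing A.F.parallel(1,3) face unfolding nf_def c1_def
    by (cases rule: A.F.switch_cases) auto
  show ?thesis
  proof (cases rule: A.V.switch_cases)
    case par
    then have "(a, a') \<notin> R" using A.V.parallel(1,3) goodD(2)[OF c] by simp
    then show ?thesis using a a' Rs(2,3) by blast
  next
    case cro
    have "good c1"
    proof (rule offR[OF c1f])
      show "orel X g c1 = R" unfolding c1_def using A.V.crossing[OF cro] goodD(2)[OF c] by simp
      show "c1 p = q" using pends c1 goodD(3)[OF c] by simp
      show "c1 f = c f" if "(p, f) \<notin> R" for f using that c1(5)[of f] a a' bR by auto
    qed
    moreover have "\<mu> c1 < \<mu> c" using nf1 M1 inM by (intro \<mu>_less_mixed) auto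
    ultimately show ?thesis using nf1 by blast
  next
    case spl
    show ?thesis
    proof (cases rule: A.F.switch_cases)
      case par
      then have "(a, a') \<notin> orel X l c" using A.F.parallel(1,3) by simp
      then show ?thesis using face by simp
    next
      case cro
      have cro': "(a, b') \<in> A.F.K" using cro by (simp add: b'_def)
      \<comment> \<open>Matching \<open>a\<close> with \<open>b'\<close> instead exchanges the two
        behaviours: the vertex is now only reversed and thus kept, while the face is split. This
        gains a face.\<close>
      interpret B: gluing_switch X c a b' l g
      proof (rule gluing_switchI[OF goodD(5)[OF c] a(1) b'(1)])
        show "b' \<noteq> a" "b' \<noteq> c a" using a b' A.ends_in(8) by (auto simp: b'_def)
      qed
      have ends: "B.ends = A.ends" using b' by (auto simp: b'_def)
      define c2 where "c2 = sw c a b'"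
      have "(a, c b') \<in> B.V.K" unfolding ends using spl b' by simp
      then have o: "orel X g c2 = R" unfolding c2_def using B.V.crossing goodD(2)[OF c] by simp
      have "(a, b') \<in> B.F.K" unfolding ends by (rule cro')
      then have n: "nf c2 = nf c + 1" unfolding nf_def c2_def using B.F.splitting(4) by simp
      have "good c2"
      proof (rule offR[OF _ o])
        show "fpf_involution_on X c2" unfolding c2_def by (rule B.fpf_sw)
        have *: "c2 f = c f" if "f \<notin> {a, b, a', b'}" for f
          unfolding c2_def using that ends Aends by (intro B.sw_simps) auto
        show "c2 p = q" using *[OF pends] goodD(3)[OF c] by simp
        show "c2 f = c f" if "(p, f) \<notin> R" for f using that a(4) a'(4) bR by (intro *) auto
      qed
      then show ?thesis using n \<mu>_less_faces[of c c2] by (intro exI[of _ c2]) auto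
    next
      case spl': spl
      have n1: "nf c1 = nf c + 1" unfolding nf_def c1_def using A.F.splitting(4)[OF spl'] by simp
      let ?K = "A.V.K"
      note Ks = A.V.K_sym A.V.K_trans
      have o1: "orel X g c1 = ?K" unfolding c1_def by (rule A.V.splitting(1)[OF spl])
      have oR: "R = join ?K a b" using A.V.splitting(2)[OF spl] goodD(2)[OF c] by (simp add: b_def)
      have nab: "(a, b) \<notin> ?K" using A.V.splitting(3)[OF spl] by (simp add: b_def)
      have KR: "?K \<subseteq> R" unfolding oR by (rule join_mem(3)[OF A.V.equiv_K])
      have gl1: "gluing X l g c1" by (rule gluing_corner[OF goodD(5)[OF c] c1f])
      have c1p: "c1 p = q" "c1 q = p" using pends qends c1 goodD(3)[OF c] cq by auto
      \<comment> \<open>Here \<open>s\<close> is whichever of \<open>a\<close>, \<open>b\<close>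
        lies in the part of the vertex without the digon. The flag \<open>d\<close> belongs to the
        digon edge of the colour of \<open>s\<close>, on the side facing away from the digon, so
        switching \<open>d\<close> with \<open>s\<close> reunites the vertex and keeps the digon. At
        most the face just gained is lost, and of the four unmixed flags at most \<open>s'\<close>
        becomes mixed again.\<close>
      have finish: ?thesis if d: "d \<in> X" "d = g r" "r \<in> {p, q}" "(d, s) \<notin> ?K"
        "s \<in> {a, b}" "col d = col s" "join ?K d s = R" for d r s
      proof -
        have sX: "s \<in> X" using d a b by auto
        have rX: "r \<in> X" using d pX qX by auto
        define s' z where "s' = c1 s" and "z = c1 d"
        have s': "s' \<in> {a', b'}" "col s' = col s" using d c1 a a' b b' by (auto simp: s'_def)
        interpret B: gluing_switch X c1 d s l g
          using d sX by (intro gluing_switch_separate[OF gl1]) (auto simp: o1)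
        define c2 where "c2 = sw c1 d s"
        have o2: "orel X g c2 = R" unfolding c2_def using B.V.merging(2) d o1 by simp
        have "nf c1 \<le> nf c2 + 1" unfolding nf_def c2_def by (rule B.F.ncl_sw_ge)
        then have n2: "nf c \<le> nf c2" using n1 by simp
        have Bends: "B.ends = {d, z, s, s'}" by (simp add: z_def s'_def)
        have c2: "c2 d = s" "c2 s = d" "c2 z = s'" "c2 s' = z" "\<And>f. f \<notin> {d, z, s, s'} \<Longrightarrow> c2 f = c1 f"
          using B.sw_simps Bends unfolding c2_def z_def s'_def by auto
        have zd: "c1 z = d" unfolding z_def using fpfD[OF c1f] d by auto
        have "mixed X col c2 \<subseteq> insert s' (mixed X col c1)"
        proof
          fix f assume f: "f \<in> mixed X col c2"
          then consider "f = d" | "f = s" | "f = s'" | "f = z" | "f \<notin> {d, z, s, s'}" by auto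
          then show "f \<in> insert s' (mixed X col c1)"
          proof cases
            case 4
            then show ?thesis using f c2 zd s' d by (auto simp: mixed_def)
          qed (use f c2 d in \<open>auto simp: mixed_def\<close>)
        qed
        moreover have "s' \<in> {a, b, a', b'}" "s \<in> {a, b, a', b'}" "s \<noteq> s'"
          using s' d fpfD(2)[OF c1f sX] by (auto simp: s'_def)
        ultimately have M2: "mixed X col c2 \<subset> mixed X col c" using M1 inM by blast
        have rR: "(p, r) \<in> R" using d pq Rs(1) by auto
        have dR: "(p, d) \<in> R" using rR stepg[OF rX] d(2) Rs(3) by blast
        have zR: "(p, z) \<in> R"
          using dR KR orel_stepI(2)[OF d(1), of c1 g] unfolding o1 z_def using Rs(3) by blast
        have "p \<notin> {d, z, s, s'}"
        proof -
          have "g p \<noteq> p" "g q \<noteq> p" using gf(2)[OF pX] col(2)[OF qX] colp colq by auto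
          then have "p \<noteq> d" using d by auto
          moreover have "q \<noteq> d" using d gf(2)[OF qX] col(2)[OF pX] colp colq by auto
          then have "p \<noteq> z" using zd c1p by auto
          ultimately show ?thesis using s' d pends by auto
        qed
        then have "c2 p = q" using c2 c1p by auto
        moreover have "c2 f = c f" if "(p, f) \<notin> R" for f
        proof -
          have "f \<notin> {a, b, a', b'}" using that a(4) a'(4) bR by auto
          moreover from this have "f \<notin> {d, z, s, s'}" using that dR zR s'(1) d(5) by auto
          ultimately show ?thesis using c2(5) c1(5) by simp
        qed
        moreover have "fpf_involution_on X c2" unfolding c2_def by (rule B.fpf_sw)
        ultimately have "good c2" using o2 by (intro offR)
        then show ?thesis using n2 \<mu>_less_mixed[OF n2 M2] by blast
      qed
      have jc: "join ?K u v = join ?K v u" for u v by (auto simp: join_def)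
      have "(a, p) \<in> R" using a Rs(2) by blast
      then consider "(a, p) \<in> ?K" | "(b, p) \<in> ?K" unfolding oR join_def by auto
      then show ?thesis
      proof cases
        case 1
        have "(q, g q) \<in> ?K" using qX by (intro r_into_rtrancl) (auto simp: lnk_def)
        then have ag: "(a, g q) \<in> ?K" using 1 pV Ks(2) by blast
        show ?thesis
        proof (rule finish[of "g q" q b])
          show "(g q, b) \<notin> ?K" using ag nab Ks by blast
          show "join ?K (g q) b = R"
            unfolding oR jc[of _ b] using join_cong[OF A.V.equiv_K ag, of b] by simp
        qed (use gf qX b colq col in auto)
      next
        case 2
        have "(p, g p) \<in> ?K" using pX by (intro r_into_rtrancl) (auto simp: lnk_def)
        then have bg: "(b, g p) \<in> ?K" using 2 Ks(2) by blast
        show ?thesis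
        proof (rule finish[of "g p" p a])
          show "(g p, a) \<notin> ?K" using bg nab Ks by blast
          show "join ?K (g p) a = R"
            unfolding oR jc[of "g p"] using join_cong[OF A.V.equiv_K bg, of a] by simp
        qed (use gf pX a colp col in auto)
      qed
    qed
  qed
qed

end

section \<open>Matchings and the counting of their links\<close>

text \<open>Induction on \<open>card U\<close>: some \<open>q\<close> that neither \<open>A\<close>
  nor \<open>B\<close> matches with \<open>p\<close> is matched with \<open>p\<close> by
  \<open>\<pi>\<close>. Contracting the paths \<open>A p, p, q, A q\<close> and
  \<open>B p, p, q, B q\<close> to single links leaves two matchings of a smaller set, and a
  solution for these lifts back.\<close>

lemma common_hamiltonian_matching:
  assumes "finite U" "fpf_involution_on U A" "fpf_involution_on U B"
  shows "\<exists>\<pi>. fpf_involution_on U \<pi> \<and> (\<forall>u\<in>U. \<forall>v\<in>U. (u, v) \<in> orel U A \<pi>) \<and>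
    (\<forall>u\<in>U. \<forall>v\<in>U. (u, v) \<in> orel U B \<pi>)"
  using assms
proof (induction "card U" arbitrary: U A B rule: less_induct)
  case less
  note A = fpfD[OF less.prems(2)] and B = fpfD[OF less.prems(3)]
  show ?case
  proof (cases "U = {}")
    case True
    then show ?thesis by (simp add: fpf_involution_on_def)
  next
    case False
    then obtain p where p: "p \<in> U" by auto
    show ?thesis
    proof (cases "\<exists>q\<in>U. q \<notin> {p, A p, B p}")
      case False
      have AB: "A p = B p"
      proof (rule ccontr)
        assume n: "A p \<noteq> B p"
        \<comment> \<open>If \<open>A p\<close> and \<open>B p\<close> differ,
          \<open>A (B p)\<close> is a fourth element and thus an admissible
          \<open>q\<close>.\<close>
        have "A (B p) \<in> U" "A (B p) \<noteq> B p" using A B p by auto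
        moreover have "A (B p) \<noteq> p" "A (B p) \<noteq> A p" using A B p n by metis+
        ultimately show False using False by auto
      qed
      then have U: "U = {p, A p}" using False A(1)[OF p] p by auto
      have "(u, v) \<in> orel U T A" if "u \<in> U" "v \<in> U" for u v T
      proof -
        have "(p, A p) \<in> orel U T A" "(A p, p) \<in> orel U T A"
          using orel_stepI(2)[OF p, of A T] orel_stepI(2)[OF A(1)[OF p], of A T] A(3)[OF p] by auto
        then show ?thesis using that U by (auto simp: orel_def)
      qed
      then show ?thesis using less.prems(2) by blast
    next
      case True
      then obtain q where q: "q \<in> U" "q \<noteq> p" "q \<noteq> A p" "q \<noteq> B p" by auto
      define U' where "U' = U - {p, q}"
      define con where "con T = T(T p := T q, T q := T p)" for T :: "'a \<Rightarrow> 'a"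
      have con: "fpf_involution_on U' (con T)"
        and pull: "\<And>\<pi>. \<lbrakk>fpf_involution_on U' \<pi>; \<forall>u\<in>U'. \<forall>v\<in>U'. (u, v) \<in> orel U' (con T) \<pi>;
          fpf_involution_on U (\<pi>(p := q, q := p))\<rbrakk>
          \<Longrightarrow> \<forall>u\<in>U. \<forall>v\<in>U. (u, v) \<in> orel U T (\<pi>(p := q, q := p))"
        if T: "fpf_involution_on U T" "q \<noteq> T p" for T
      proof -
        note Tf = fpfD[OF T(1)]
        have ne: "T p \<noteq> p" "T q \<noteq> q" "T q \<noteq> p" "T p \<noteq> T q" "T p \<in> U'" "T q \<in> U'"
        proof -
          show 1: "T p \<noteq> p" "T q \<noteq> q" using Tf p q by auto
          show 2: "T q \<noteq> p" "T p \<noteq> T q" using Tf(3) p q T(2) by metis+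
          show "T p \<in> U'" "T q \<in> U'" using 1 2 Tf(1) p q T(2) by (auto simp: U'_def)
        qed
        have off: "T f \<in> U' \<and> T f \<noteq> T p \<and> T f \<noteq> T q" if f: "f \<in> U'" "f \<noteq> T p" "f \<noteq> T q" for f
        proof -
          have "f \<in> U" "f \<noteq> p" "f \<noteq> q" using f by (auto simp: U'_def)
          moreover from this have "T f \<noteq> p" "T f \<noteq> q" "T f \<noteq> T p" "T f \<noteq> T q"
            using Tf(3) p q f by metis+
          ultimately show ?thesis using Tf(1) by (auto simp: U'_def)
        qed
        show "fpf_involution_on U' (con T)"
          unfolding fpf_involution_on_def
        proof
          fix f assume f: "f \<in> U'"
          consider "f = T p" | "f = T q" | "f \<noteq> T p" "f \<noteq> T q" by auto
          then show "con T f \<in> U' \<and> con T f \<noteq> f \<and> con T (con T f) = f"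
          proof cases
            case 3
            then show ?thesis using off[OF f] f Tf by (auto simp: con_def U'_def)
          qed (use ne in \<open>auto simp: con_def\<close>)
        qed
        fix \<pi> assume \<pi>: "fpf_involution_on U' \<pi>" "\<forall>u\<in>U'. \<forall>v\<in>U'. (u, v) \<in> orel U' (con T) \<pi>"
          and \<pi>': "fpf_involution_on U (\<pi>(p := q, q := p))"
        let ?O = "orel U T (\<pi>(p := q, q := p))"
        have eqO: "equiv UNIV ?O" by (rule equiv_orel[OF T(1) \<pi>'])
        note O = equivUD[OF eqO]
        have st: "(f, T f) \<in> ?O" if "f \<in> U" for f using that by (rule orel_stepI)
        have pq: "(p, q) \<in> ?O" using orel_stepI(2)[OF p, of "\<pi>(p := q, q := p)" T] q by simp
        have TT: "(T p, T q) \<in> ?O" using st[OF p] st[OF q(1)] pq O(2,3) by meson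
        have "orel U' (con T) \<pi> \<subseteq> ?O"
        proof (rule orel_least[OF eqO])
          fix f assume f: "f \<in> U'"
          then have fU: "f \<in> U" "f \<noteq> p" "f \<noteq> q" by (auto simp: U'_def)
          show "(f, \<pi> f) \<in> ?O" using orel_stepI(2)[OF fU(1), of "\<pi>(p := q, q := p)" T] fU by simp
          show "(f, con T f) \<in> ?O" using TT O(2) st[OF fU(1)] ne by (auto simp: con_def)
        qed
        then have "(T p, v) \<in> ?O" if "v \<in> U'" for v using \<pi>(2) ne(5) that by blast
        moreover have "(T p, p) \<in> ?O" "(T p, q) \<in> ?O" using st[OF p] pq O(2,3) by meson+
        ultimately have "(T p, v) \<in> ?O" if "v \<in> U" for v using that by (auto simp: U'_def)
        then show "\<forall>u\<in>U. \<forall>v\<in>U. (u, v) \<in> ?O" using O(2,3) by meson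
      qed
      have "card U' < card U" "finite U'"
        using less.prems(1) p unfolding U'_def by (auto intro!: psubset_card_mono)
      then obtain \<pi> where \<pi>: "fpf_involution_on U' \<pi>" "\<forall>u\<in>U'. \<forall>v\<in>U'. (u, v) \<in> orel U' (con A) \<pi>"
        "\<forall>u\<in>U'. \<forall>v\<in>U'. (u, v) \<in> orel U' (con B) \<pi>"
        using less.hyps[of U' "con A" "con B"] con[OF less.prems(2) q(3)] con[OF less.prems(3) q(4)] by metis
      have "fpf_involution_on U (\<pi>(p := q, q := p))"
        unfolding fpf_involution_on_def
      proof
        fix f assume f: "f \<in> U"
        show "(\<pi>(p := q, q := p)) f \<in> U \<and> (\<pi>(p := q, q := p)) f \<noteq> f \<and>
          (\<pi>(p := q, q := p)) ((\<pi>(p := q, q := p)) f) = f"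
        proof (cases "f \<in> U'")
          case True
          then show ?thesis using fpfD[OF \<pi>(1) True] by (auto simp: U'_def)
        next
          case False
          then show ?thesis using f p q by (auto simp: U'_def)
        qed
      qed
      then show ?thesis using pull[OF less.prems(2) q(3) \<pi>(1,2)] pull[OF less.prems(3) q(4) \<pi>(1,3)] by metis
    qed
  qed
qed

lemma involution_transversal:
  assumes "finite U" "fpf_involution_on U \<pi>"
  shows "\<exists>T\<subseteq>U. U = T \<union> \<pi> ` T \<and> 2 * card T = card U"
  using assms
proof (induction "card U" arbitrary: U rule: less_induct)
  case less
  show ?case
  proof (cases "U = {}")
    case True
    then show ?thesis by auto
  next
    case False
    then obtain u where u: "u \<in> U" by auto
    note P = fpfD[OF less.prems(2)]
    define U' where "U' = U - {u, \<pi> u}"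
    have "fpf_involution_on U' \<pi>"
      unfolding fpf_involution_on_def
    proof
      fix f assume "f \<in> U'"
      then have "f \<in> U" "f \<noteq> u" "f \<noteq> \<pi> u" by (auto simp: U'_def)
      moreover from this have "\<pi> f \<noteq> u" "\<pi> f \<noteq> \<pi> u" using P(3) u by metis+
      ultimately show "\<pi> f \<in> U' \<and> \<pi> f \<noteq> f \<and> \<pi> (\<pi> f) = f" using P by (auto simp: U'_def)
    qed
    moreover have c: "card U = card U' + 2"
    proof -
      have "card {u, \<pi> u} = 2" using P(2)[OF u] by auto
      moreover have "{u, \<pi> u} \<subseteq> U" using P u by auto
      ultimately show ?thesis unfolding U'_def using less.prems(1) card_mono[of U "{u, \<pi> u}"]
        by (subst card_Diff_subset) auto
    qed
    moreover have fin': "finite U'" using less.prems(1) by (simp add: U'_def)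
    ultimately obtain T where T: "T \<subseteq> U'" "U' = T \<union> \<pi> ` T" "2 * card T = card U'" using less.hyps[of U'] by auto
    have "u \<notin> T" "finite T" using T fin' by (auto simp: U'_def intro: finite_subset)
    moreover have "U = insert u T \<union> \<pi> ` insert u T"
      using T(2) u P(1)[OF u] unfolding U'_def by blast
    ultimately show ?thesis using T c u by (intro exI[of _ "insert u T"]) (auto simp: U'_def)
  qed
qed

definition add_links :: "('f \<times> 'f) set \<Rightarrow> ('f \<Rightarrow> 'f) \<Rightarrow> 'f set \<Rightarrow> ('f \<times> 'f) set" where
  "add_links r h S = (r \<union> {(a, h a) | a. a \<in> S} \<union> {(h a, a) | a. a \<in> S})\<^sup>*"

lemma add_links_insert:
  assumes "sym r"
  shows "add_links r h (insert a S) = join (add_links r h S) a (h a)" "equiv UNIV (add_links r h S)"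
    "add_links r h {} = r\<^sup>*"
proof -
  let ?s = "r \<union> {(a, h a) | a. a \<in> S} \<union> {(h a, a) | a. a \<in> S}"
  have s: "sym ?s" using assms by (auto simp: sym_def)
  have "r \<union> {(b, h b) | b. b \<in> insert a S} \<union> {(h b, b) | b. b \<in> insert a S} = ?s \<union> {(a, h a), (h a, a)}" by auto
  then show "add_links r h (insert a S) = join (add_links r h S) a (h a)"
    unfolding add_links_def using rtrancl_add_link[OF s] by simp
  show "equiv UNIV (add_links r h S)" unfolding add_links_def by (rule equiv_rtrancl[OF s])
  show "add_links r h {} = r\<^sup>*" by (simp add: add_links_def)
qed

lemma ncl_add_links_ge:
  assumes "finite X" "sym r" "finite S" "S \<subseteq> X" "h ` S \<subseteq> X"
  shows "ncl X (r\<^sup>*) \<le> ncl X (add_links r h S) + card S"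
  using assms(3-5)
proof (induction S rule: finite_induct)
  case empty
  then show ?case using add_links_insert(3)[OF assms(2)] by simp
next
  case (insert a S)
  have "ncl X (add_links r h S) \<le> ncl X (add_links r h (insert a S)) + 1"
    unfolding add_links_insert(1)[OF assms(2)] using insert
    by (intro ncl_join_ge assms(1) add_links_insert(2)[OF assms(2)]) auto
  then show ?case using insert by simp
qed

text \<open>Freshness of a link is required against every set of other links, so that it is
  available at each stage, in whatever order the induction adds them.\<close>

lemma ncl_add_links_eq:
  assumes "finite X" "sym r" "finite S" "S \<subseteq> X" "h ` S \<subseteq> X"
    and new: "\<And>a S'. a \<in> S \<Longrightarrow> S' \<subseteq> S \<Longrightarrow> a \<notin> S' \<Longrightarrow> (a, h a) \<notin> add_links r h S'"
  shows "ncl X (r\<^sup>*) = ncl X (add_links r h S) + card S"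
  using assms(3) assms(4-6)
proof (induction S rule: finite_induct)
  case empty
  then show ?case using add_links_insert(3)[OF assms(2)] by simp
next
  case (insert a S)
  have "(a, h a) \<notin> add_links r h S" using insert.prems(3)[of a S] insert by auto
  then have "ncl X (add_links r h (insert a S)) + 1 = ncl X (add_links r h S)"
    unfolding add_links_insert(1)[OF assms(2)] using insert.prems
    by (intro ncl_join assms(1) add_links_insert(2)[OF assms(2)]) auto
  moreover have "ncl X (r\<^sup>*) = ncl X (add_links r h S) + card S"
    using insert.prems by (intro insert.IH) auto
  ultimately show ?case using insert by simp
qed

context coloured
begin

text \<open>The two ends of the digon are alike, so what is proved at the vertex of \<open>p\<close>
  also applies at the vertex of \<open>l p\<close>.\<close>

lemma coloured_other_end: "coloured X l g col R (l p) (l q)"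
  using fin l g lg R col pX qX colp colq pl fpfD[OF l pX] fpfD[OF l qX] equivUD(2)[OF R]
  by unfold_locales auto

text \<open>At a minimum of \<open>\<mu>\<close> there cannot be two mixed corners of one face at
  the same end of the digon, because \<open>merge_mixed_corners\<close> would lower
  \<open>\<mu>\<close> further.\<close>

lemma reduced_exists:
  assumes "good c0"
  shows "\<exists>c. good c \<and> nf c0 \<le> nf c \<and> (\<forall>r\<in>{p, l p}. \<forall>a\<in>X. \<forall>a'\<in>X. col a \<longrightarrow> col a' \<longrightarrow> \<not> col (c a) \<longrightarrow>
    \<not> col (c a') \<longrightarrow> (r, a) \<in> R \<longrightarrow> (r, a') \<in> R \<longrightarrow> (a, a') \<in> orel X l c \<longrightarrow> a = a')"
proof -
  obtain c where c: "good c" "nf c0 \<le> nf c" and min: "\<And>c'. good c' \<Longrightarrow> nf c0 \<le> nf c' \<Longrightarrow> \<mu> c \<le> \<mu> c'"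
    using ex_has_least_nat[of "\<lambda>c. good c \<and> nf c0 \<le> nf c" c0 \<mu>] assms by auto
  interpret Y: coloured X l g col R "l p" "l q" by (rule coloured_other_end)
  have llp: "l (l p) = p" "l (l q) = q" using fpfD(3)[OF l] pX qX by auto
  have Y: "Y.good c' \<longleftrightarrow> good c'" for c'
    unfolding Y.good_def good_def llp by blast
  have "a = a'" if r: "r \<in> {p, l p}" and a: "a \<in> X" "a' \<in> X" "col a" "col a'" "\<not> col (c a)" "\<not> col (c a')"
    "(r, a) \<in> R" "(r, a') \<in> R" "(a, a') \<in> orel X l c" for r a a'
  proof (rule ccontr)
    assume ne: "a \<noteq> a'"
    have "\<exists>c'. good c' \<and> nf c \<le> nf c' \<and> \<mu> c' < \<mu> c"
    proof (cases "r = p")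
      case True
      then show ?thesis using merge_mixed_corners[OF c(1)] a ne by blast
    next
      case False
      then have "r = l p" using r by simp
      then show ?thesis using Y.merge_mixed_corners[of c a a'] c(1) a ne unfolding Y by blast
    qed
    then show False using min c(2) by (meson leD le_trans)
  qed
  then show ?thesis using c by blast
qed

end

section \<open>Strands of faces and arcs of rotations in a reduced matching\<close>

lemma equivUI:
  assumes "\<And>u. (u, u) \<in> R" "\<And>u v. (u, v) \<in> R \<Longrightarrow> (v, u) \<in> R"
    "\<And>u v w. (u, v) \<in> R \<Longrightarrow> (v, w) \<in> R \<Longrightarrow> (u, w) \<in> R"
  shows "equiv UNIV R"
proof -
  have "refl R" by (rule refl_onI) (rule assms(1))
  moreover have "sym R" by (rule symI) (rule assms(2))
  moreover have "trans R" by (rule transI) (rule assms(3))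
  ultimately show ?thesis by (simp add: equiv_def)
qed

definition partner :: "'f set \<Rightarrow> ('f \<times> 'f) set \<Rightarrow> 'f \<Rightarrow> 'f" where
  "partner U K a = (THE z. z \<in> U \<and> z \<noteq> a \<and> (a, z) \<in> K)"

lemma partner:
  assumes K: "equiv UNIV K" and ex: "\<And>a. a \<in> U \<Longrightarrow> \<exists>!z. z \<in> U \<and> z \<noteq> a \<and> (a, z) \<in> K"
  shows "fpf_involution_on U (partner U K)" "a \<in> U \<Longrightarrow> (a, partner U K a) \<in> K"
    "a \<in> U \<Longrightarrow> z \<in> U \<Longrightarrow> (a, z) \<in> K \<Longrightarrow> z = a \<or> z = partner U K a"
proof -
  have P: "partner U K a \<in> U \<and> partner U K a \<noteq> a \<and> (a, partner U K a) \<in> K" if "a \<in> U" for a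
    unfolding partner_def by (rule theI'[OF ex[OF that]])
  have un: "z = a \<or> z = partner U K a" if "a \<in> U" "z \<in> U" "(a, z) \<in> K" for a z
    using ex[OF that(1)] P[OF that(1)] that by blast
  show "a \<in> U \<Longrightarrow> (a, partner U K a) \<in> K" using P by blast
  show "a \<in> U \<Longrightarrow> z \<in> U \<Longrightarrow> (a, z) \<in> K \<Longrightarrow> z = a \<or> z = partner U K a" by (rule un)
  have "partner U K (partner U K a) = a" if a: "a \<in> U" for a
    using un[of "partner U K a" a] P[OF a] a equivUD(2)[OF K] by auto
  then show "fpf_involution_on U (partner U K)" using P by (simp add: fpf_involution_on_def)
qed

locale reduced = coloured X l g col R p q for X :: "'f set" and l g col R p q +
  fixes c :: "'f \<Rightarrow> 'f"
  assumes good: "good c"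
    and red: "\<And>r a a'. r \<in> {p, l p} \<Longrightarrow> a \<in> X \<Longrightarrow> a' \<in> X \<Longrightarrow> col a \<Longrightarrow> col a' \<Longrightarrow> \<not> col (c a) \<Longrightarrow>
      \<not> col (c a') \<Longrightarrow> (r, a) \<in> R \<Longrightarrow> (r, a') \<in> R \<Longrightarrow> (a, a') \<in> orel X l c \<Longrightarrow> a = a'"
begin

definition "U = mixed X col c"
definition "Ux = {f \<in> U. (p, f) \<in> R}"
definition "Uy = {f \<in> U. (l p, f) \<in> R}"

lemmas c = goodD(1)[OF good]
lemmas cf = fpfD[OF c] and lf = fpfD[OF l] and gf = fpfD[OF g]
lemmas Rs = equivUD[OF R]

lemma U_sub: "U \<subseteq> X" by (auto simp: U_def mixed_def)

lemma finU: "finite U" using finite_subset[OF U_sub fin] .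

lemma cU: "f \<in> U \<Longrightarrow> c f \<in> U"
  using cf by (auto simp: U_def mixed_def)

lemma colU: "f \<in> U \<Longrightarrow> col (c f) \<noteq> col f" "f \<in> X \<Longrightarrow> f \<notin> U \<Longrightarrow> col (c f) = col f"
  by (auto simp: U_def mixed_def)

lemma c_off: "fpf_involution_on (X - U) c"
  unfolding fpf_involution_on_def using cf cU by (metis Diff_iff)

lemma stepR: "f \<in> X \<Longrightarrow> (f, c f) \<in> R" "f \<in> X \<Longrightarrow> (f, g f) \<in> R"
  using orel_stepI[of f X] goodD(2)[OF good] by blast+

lemma pq_facts: "l p \<in> X" "l q \<in> X" "(p, q) \<in> R" "(l p, l q) \<in> R" "col (l p)" "\<not> col (l q)"
  using lf pX qX stepR(1)[OF pX] stepR(1)[of "l p"] goodD(3,4)[OF good] col colp colq by auto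

lemma Uxy: "U = Ux \<union> Uy" "Ux \<inter> Uy = {}"
proof -
  show "U = Ux \<union> Uy"
    using goodD(6)[OF good] colU(1) U_sub unfolding Ux_def Uy_def by blast
  show "Ux \<inter> Uy = {}" using pl Rs(2,3) unfolding Ux_def Uy_def by blast
qed

lemma cUx: "f \<in> Ux \<Longrightarrow> c f \<in> Ux"
  using cU stepR U_sub Rs(3) unfolding Ux_def by blast

abbreviation "cutl t \<equiv> lnk X t \<union> lnk (X - U) c"

text \<open>Cut open at all mixed corners, the mixed faces fall into strands (\<open>KF\<close>) and
  the rotations at \<open>x\<close> and \<open>y\<close> into arcs (\<open>KV\<close>). Strands and
  arcs have a single colour each.\<close>

definition "KF = (cutl l)\<^sup>*"
definition "KV = (cutl g)\<^sup>*"

lemma sym_cutl: "sym (cutl l)" "sym (cutl g)"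
  by (intro sym_Un sym_lnk l g c_off)+

lemma equiv_K: "equiv UNIV KF" "equiv UNIV KV"
  unfolding KF_def KV_def by (intro equiv_rtrancl sym_cutl)+

lemma K_col:
  assumes "(u, v) \<in> KF \<or> (u, v) \<in> KV" "u \<in> X"
  shows "v \<in> X \<and> col v = col u"
proof -
  have "v \<in> {v \<in> X. col v = col u}"
    using assms(1) unfolding KF_def KV_def
  proof (elim disjE)
    assume "(u, v) \<in> (cutl l)\<^sup>*"
    then show ?thesis by (rule rtrancl_closed) (use assms(2) lf cf col colU(2) in \<open>auto simp: lnk_def\<close>)
  next
    assume "(u, v) \<in> (cutl g)\<^sup>*"
    then show ?thesis by (rule rtrancl_closed) (use assms(2) gf cf col colU(2) in \<open>auto simp: lnk_def\<close>)
  qed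
  then show ?thesis by simp
qed

lemma KV_R: "KV \<subseteq> R"
  unfolding KV_def goodD(2)[OF good, symmetric] orel_def by (rule rtrancl_mono) (auto simp: lnk_def)

lemma KF_sub: "KF \<subseteq> orel X l c"
  unfolding KF_def orel_def by (rule rtrancl_mono) (auto simp: lnk_def)

text \<open>\<open>\<sigma>\<close> leads from one end of a strand to its other end, and
  \<open>\<alpha>\<close> does the same for arcs.\<close>

definition "\<sigma> = partner U KF"
definition "\<alpha> = partner U KV"

lemma partner_ex: "a \<in> U \<Longrightarrow> \<exists>!z. z \<in> U \<and> z \<noteq> a \<and> (a, z) \<in> KF" "a \<in> U \<Longrightarrow> \<exists>!z. z \<in> U \<and> z \<noteq> a \<and> (a, z) \<in> KV"
  unfolding KF_def KV_def by (rule path_partner[OF fin _ c_off U_sub], (rule l g), assumption)+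

lemma \<sigma>: "fpf_involution_on U \<sigma>" "a \<in> U \<Longrightarrow> (a, \<sigma> a) \<in> KF"
  "a \<in> U \<Longrightarrow> z \<in> U \<Longrightarrow> (a, z) \<in> KF \<Longrightarrow> z = a \<or> z = \<sigma> a"
  unfolding \<sigma>_def using partner[OF equiv_K(1), of U] partner_ex(1) by blast+

lemma \<alpha>: "fpf_involution_on U \<alpha>" "a \<in> U \<Longrightarrow> (a, \<alpha> a) \<in> KV"
  unfolding \<alpha>_def using partner[OF equiv_K(2), of U] partner_ex(2) by blast+

lemmas \<sigma>f = fpfD[OF \<sigma>(1)] and \<alpha>f = fpfD[OF \<alpha>(1)]

lemma \<sigma>\<alpha>_col: "a \<in> U \<Longrightarrow> col (\<sigma> a) = col a" "a \<in> U \<Longrightarrow> col (\<alpha> a) = col a"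
  using K_col[of a "\<sigma> a"] K_col[of a "\<alpha> a"] \<sigma>(2) \<alpha>(2) U_sub by blast+

lemma \<alpha>_R: "a \<in> U \<Longrightarrow> (a, \<alpha> a) \<in> R"
  using \<alpha>(2) KV_R by blast

text \<open>Every strand of a mixed face leads from one end of the digon to the other.\<close>

lemma \<sigma>_leaves:
  assumes r: "r \<in> {p, l p}" and a: "a \<in> U" "(r, a) \<in> R"
  shows "(r, \<sigma> a) \<notin> R"
proof
  assume s: "(r, \<sigma> a) \<in> R"
  have sU: "\<sigma> a \<in> U" "\<sigma> a \<noteq> a" using \<sigma>f a by auto
  have F: "(a, \<sigma> a) \<in> orel X l c" using \<sigma>(2)[OF a(1)] KF_sub by blast
  have X: "a \<in> X" "\<sigma> a \<in> X" using a sU U_sub by auto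
  have eqF: "equiv UNIV (orel X l c)" by (rule equiv_orel[OF l c])
  show False
  proof (cases "col a")
    case True
    then show False using red[OF r X, OF _ _ _ _ a(2) s F] \<sigma>\<alpha>_col(1)[OF a(1)] colU(1)[OF a(1)] colU(1)[OF sU(1)] sU by auto
  next
    case False
    \<comment> \<open>\<open>red\<close> speaks about flags of colour true only; here it is applied
      to the flags across the two corners, which have that colour and lie on the same face at the
      same vertex.\<close>
    have "(a, c a) \<in> orel X l c" "(\<sigma> a, c (\<sigma> a)) \<in> orel X l c" using X by (auto intro: orel_stepI)
    then have F': "(c a, c (\<sigma> a)) \<in> orel X l c" using F equivUD(2,3)[OF eqF] by meson
    have "(r, c a) \<in> R" "(r, c (\<sigma> a)) \<in> R" using stepR(1)[OF X(1)] stepR(1)[OF X(2)] a(2) s Rs(3) by blast+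
    then have "c a = c (\<sigma> a)"
      using red[OF r, of "c a" "c (\<sigma> a)"] F' cf X False \<sigma>\<alpha>_col(1)[OF a(1)] colU(1)[OF a(1)] colU(1)[OF sU(1)] by auto
    then show False using cf(3)[OF X(1)] cf(3)[OF X(2)] sU by metis
  qed
qed

lemma \<sigma>_xy: "a \<in> Ux \<Longrightarrow> \<sigma> a \<in> Uy" "a \<in> Uy \<Longrightarrow> \<sigma> a \<in> Ux"
proof -
  have 1: "\<sigma> a \<notin> Ux" if "a \<in> Ux" for a using \<sigma>_leaves[of p a] that by (auto simp: Ux_def)
  have 2: "\<sigma> a \<notin> Uy" if "a \<in> Uy" for a using \<sigma>_leaves[of "l p" a] that by (auto simp: Uy_def)
  show "a \<in> Ux \<Longrightarrow> \<sigma> a \<in> Uy" "a \<in> Uy \<Longrightarrow> \<sigma> a \<in> Ux" using 1 2 \<sigma>f(1) Uxy by blast+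
qed

lemma \<alpha>_xy: "a \<in> Ux \<Longrightarrow> \<alpha> a \<in> Ux" "a \<in> Uy \<Longrightarrow> \<alpha> a \<in> Uy"
  using \<alpha>f(1) \<alpha>_R Rs(3) unfolding Ux_def Uy_def by blast+

text \<open>A strand has just one end at \<open>x\<close>. Hence the mixed corners at
  \<open>x\<close> join strands in disjoint pairs, one of each colour, and every such link costs
  exactly one class; the corners at \<open>y\<close> can only unite further.\<close>

lemma faces_le: "nf c + card {a \<in> Ux. col a} \<le> ncl X KF"
proof -
  let ?S = "{a \<in> Ux. col a}"
  have S: "?S \<subseteq> X" "c ` ?S \<subseteq> X" "finite ?S" using U_sub Uxy cf finU by (auto intro: finite_subset)
  have new: "(a, c a) \<notin> add_links (cutl l) c S'" if a: "a \<in> ?S" and S': "S' \<subseteq> ?S" "a \<notin> S'" for a S'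
  proof
    assume "(a, c a) \<in> add_links (cutl l) c S'"
    have aU: "a \<in> U" "a \<in> X" using a Uxy U_sub by auto
    have "c a \<in> KF `` {a}"
      using \<open>(a, c a) \<in> _\<close> unfolding add_links_def
    proof (rule rtrancl_closed)
      show "a \<in> KF `` {a}" using equivUD(1)[OF equiv_K(1)] by simp
      fix u v assume u: "u \<in> KF `` {a}" and "(u, v) \<in> cutl l \<union> {(a, c a) |a. a \<in> S'} \<union> {(c a, a) |a. a \<in> S'}"
      then consider "(u, v) \<in> cutl l" | "u \<in> S'" | s where "s \<in> S'" "u = c s" by auto
      then show "v \<in> KF `` {a}"
      proof cases
        case 1
        then have "(u, v) \<in> KF" unfolding KF_def by auto
        then show ?thesis using u equivUD(3)[OF equiv_K(1)] by blast
      next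
        case 2
        then have "u \<in> U" "u \<in> Ux" using S' Uxy by auto
        then have "u = a \<or> u = \<sigma> a" using \<sigma>(3)[OF aU(1)] u by auto
        then show ?thesis using 2 S' \<open>u \<in> Ux\<close> \<sigma>_xy(1)[of a] a Uxy(2) by auto
      next
        case 3
        then have "s \<in> U" "col s" using S' Uxy by auto
        then have "\<not> col u" using 3 colU(1) by blast
        then show ?thesis using K_col[of a u] u aU a by auto
      qed
    qed
    then show False using K_col[of a "c a"] aU a colU(1)[OF aU(1)] by auto
  qed
  have "ncl X KF = ncl X (add_links (cutl l) c ?S) + card ?S"
    unfolding KF_def by (rule ncl_add_links_eq[OF fin sym_cutl(1) S(3,1,2) new])
  moreover have "add_links (cutl l) c ?S \<subseteq> orel X l c"
    unfolding add_links_def orel_def using S U_sub cf by (intro rtrancl_mono) (auto simp: lnk_def)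
  then have "nf c \<le> ncl X (add_links (cutl l) c ?S)"
    unfolding nf_def by (intro ncl_antimono fin add_links_insert(2) sym_cutl equiv_orel l c)
  ultimately show ?thesis by simp
qed

lemma card_Ux: "card Ux = 2 * card {a \<in> Ux. col a}"
proof -
  have "bij_betw c {a \<in> Ux. col a} {a \<in> Ux. \<not> col a}"
  proof (rule bij_betwI[where g = c])
    show "c \<in> {a \<in> Ux. col a} \<rightarrow> {a \<in> Ux. \<not> col a}" "c \<in> {a \<in> Ux. \<not> col a} \<rightarrow> {a \<in> Ux. col a}"
      using cUx colU(1) Uxy(1) by blast+
  qed (use cf(3) Uxy U_sub in auto)
  then have "card {a \<in> Ux. col a} = card {a \<in> Ux. \<not> col a}" by (rule bij_betw_same_card)
  moreover have "card Ux = card {a \<in> Ux. col a} + card {a \<in> Ux. \<not> col a}"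
    using finU Uxy(1) by (subst card_Un_disjoint[symmetric]) (auto intro: arg_cong[where f = card])
  ultimately show ?thesis by simp
qed

text \<open>A pairing \<open>\<pi>\<close> of strands of equal colour is applied at their ends at
  \<open>x\<close> and carried over to their ends at \<open>y\<close>, so that paired strands close
  up to a face. Each side of \<open>x\<close> becomes one vertex if \<open>\<pi>\<close> closes the
  arcs there into one cycle, and each side of \<open>y\<close> if it does the same with the arcs at
  \<open>y\<close>. A common Hamiltonian matching achieves both.\<close>

lemma separated:
  "\<exists>c'. fpf_involution_on X c' \<and> (\<forall>f\<in>X. col (c' f) = col f) \<and> nf c \<le> nf c' \<and>
    (\<forall>u\<in>X. \<forall>v. (u, v) \<in> orel X g c' \<longleftrightarrow> (u, v) \<in> R \<and> col u = col v)"
proof -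
  define Uk where "Uk k = {a \<in> Ux. col a = k}" for k
  have UkU: "Uk k \<subseteq> U" "Uk k \<subseteq> X" for k using Uxy U_sub by (auto simp: Uk_def)
  have finUk: "finite (Uk k)" for k using finite_subset[OF UkU(1) finU] .
  \<comment> \<open>The matching by arcs at \<open>y\<close>, moved along the strands to their ends
    at \<open>x\<close>, where it lives on the same set as \<open>\<alpha>\<close>.\<close>
  define \<beta> where "\<beta> = \<sigma> \<circ> \<alpha> \<circ> \<sigma>"
  have \<alpha>k: "fpf_involution_on (Uk k) \<alpha>" for k
    unfolding fpf_involution_on_def
    using \<alpha>f UkU(1) \<alpha>_xy(1) \<sigma>\<alpha>_col(2) by (auto simp: Uk_def subset_iff)
  have \<beta>k: "fpf_involution_on (Uk k) \<beta>" for k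
    unfolding fpf_involution_on_def
  proof
    fix a assume a: "a \<in> Uk k"
    then have a: "a \<in> Ux" "a \<in> U" "col a = k" using UkU by (auto simp: Uk_def)
    have s: "\<sigma> a \<in> Uy" "\<sigma> a \<in> U" "col (\<sigma> a) = k" using \<sigma>_xy(1)[OF a(1)] \<sigma>f(1)[OF a(2)] \<sigma>\<alpha>_col(1)[OF a(2)] a by auto
    have t: "\<alpha> (\<sigma> a) \<in> Uy" "\<alpha> (\<sigma> a) \<in> U" "col (\<alpha> (\<sigma> a)) = k" "\<alpha> (\<sigma> a) \<noteq> \<sigma> a"
      using \<alpha>_xy(2)[OF s(1)] \<alpha>f[OF s(2)] \<sigma>\<alpha>_col(2)[OF s(2)] s by auto
    have "\<sigma> (\<alpha> (\<sigma> a)) \<in> Uk k" using \<sigma>_xy(2)[OF t(1)] \<sigma>\<alpha>_col(1)[OF t(2)] t by (simp add: Uk_def)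
    moreover have "\<sigma> (\<alpha> (\<sigma> a)) \<noteq> a" using \<sigma>f(3)[OF t(2)] t(4) by metis
    ultimately show "\<beta> a \<in> Uk k \<and> \<beta> a \<noteq> a \<and> \<beta> (\<beta> a) = a"
      using \<sigma>f(3)[OF t(2)] \<alpha>f(3)[OF s(2)] \<sigma>f(3)[OF a(2)] by (simp add: \<beta>_def)
  qed
  have "\<forall>k. \<exists>\<pi>. fpf_involution_on (Uk k) \<pi> \<and> (\<forall>u\<in>Uk k. \<forall>v\<in>Uk k. (u, v) \<in> orel (Uk k) \<alpha> \<pi>) \<and>
    (\<forall>u\<in>Uk k. \<forall>v\<in>Uk k. (u, v) \<in> orel (Uk k) \<beta> \<pi>)"
    using common_hamiltonian_matching[OF finUk \<alpha>k \<beta>k] by blast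
  then obtain P where P: "\<And>k. fpf_involution_on (Uk k) (P k)"
    "\<And>k u v. u \<in> Uk k \<Longrightarrow> v \<in> Uk k \<Longrightarrow> (u, v) \<in> orel (Uk k) \<alpha> (P k)"
    "\<And>k u v. u \<in> Uk k \<Longrightarrow> v \<in> Uk k \<Longrightarrow> (u, v) \<in> orel (Uk k) \<beta> (P k)"
    by metis
  define \<pi> where "\<pi> f = P (col f) f" for f
  have \<pi>: "\<pi> f \<in> Ux" "col (\<pi> f) = col f" "\<pi> f \<noteq> f" "\<pi> (\<pi> f) = f" if "f \<in> Ux" for f
  proof -
    have "f \<in> Uk (col f)" using that by (simp add: Uk_def)
    note q = fpfD[OF P(1) this]
    show 1: "\<pi> f \<in> Ux" "col (\<pi> f) = col f" using q(1) by (auto simp: Uk_def \<pi>_def)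
    show "\<pi> f \<noteq> f" using q(2) by (simp add: \<pi>_def)
    show "\<pi> (\<pi> f) = f" using q(3) 1(2) unfolding \<pi>_def by simp
  qed
  define c' where "c' f = (if f \<in> Ux then \<pi> f else if f \<in> Uy then \<sigma> (\<pi> (\<sigma> f)) else c f)" for f
  have c'x: "c' f = \<pi> f" if "f \<in> Ux" for f using that by (simp add: c'_def)
  have c'y: "c' f = \<sigma> (\<pi> (\<sigma> f))" if "f \<in> Uy" for f using that Uxy(2) by (auto simp: c'_def)
  have c'o: "c' f = c f" if "f \<notin> U" for f using that Uxy(1) by (auto simp: c'_def)
  have Usub: "Ux \<subseteq> X" "Uy \<subseteq> X" "Ux \<subseteq> U" "Uy \<subseteq> U" using Uxy U_sub by auto
  have y: "\<sigma> (\<pi> (\<sigma> f)) \<in> Uy" "col (\<sigma> (\<pi> (\<sigma> f))) = col f" "\<sigma> (\<pi> (\<sigma> f)) \<noteq> f" "\<sigma> (\<sigma> (\<pi> (\<sigma> f))) = \<pi> (\<sigma> f)"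
    if f: "f \<in> Uy" for f
  proof -
    have s: "\<sigma> f \<in> Ux" "f \<in> U" "\<sigma> f \<in> U" using \<sigma>_xy(2)[OF f] f Usub by auto
    have t: "\<pi> (\<sigma> f) \<in> Ux" "\<pi> (\<sigma> f) \<in> U" using \<pi>(1)[OF s(1)] Usub by auto
    show "\<sigma> (\<pi> (\<sigma> f)) \<in> Uy" by (rule \<sigma>_xy(1)[OF t(1)])
    show "col (\<sigma> (\<pi> (\<sigma> f))) = col f"
      using \<sigma>\<alpha>_col(1)[OF t(2)] \<sigma>\<alpha>_col(1)[OF s(2)] \<pi>(2)[OF s(1)] by simp
    show "\<sigma> (\<sigma> (\<pi> (\<sigma> f))) = \<pi> (\<sigma> f)" by (rule \<sigma>f(3)[OF t(2)])
    then show "\<sigma> (\<pi> (\<sigma> f)) \<noteq> f" using \<pi>(3)[OF s(1)] by metis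
  qed
  have fpf': "fpf_involution_on X c'"
    unfolding fpf_involution_on_def
  proof
    fix f assume f: "f \<in> X"
    consider "f \<in> Ux" | "f \<in> Uy" | "f \<notin> U" using Uxy by auto
    then show "c' f \<in> X \<and> c' f \<noteq> f \<and> c' (c' f) = f"
    proof cases
      case 1
      then show ?thesis using c'x \<pi> Usub(1) by auto
    next
      case 2
      have s: "\<sigma> f \<in> Ux" "\<sigma> (\<sigma> f) = f" using \<sigma>_xy(2)[OF 2] \<sigma>f(3) 2 Usub by auto
      have "c' (c' f) = \<sigma> (\<pi> (\<pi> (\<sigma> f)))" using c'y[OF 2] c'y[OF y(1)[OF 2]] y(4)[OF 2] by simp
      then show ?thesis using c'y[OF 2] y(1,3)[OF 2] Usub(2) \<pi>(4)[OF s(1)] s(2) by auto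
    next
      case 3
      then have "c f \<notin> U" using cU[of "c f"] cf(3)[OF f] by auto
      then show ?thesis using 3 c'o cf[OF f] by simp
    qed
  qed
  have col': "col (c' f) = col f" if f: "f \<in> X" for f
  proof -
    consider "f \<in> Ux" | "f \<in> Uy" | "f \<notin> U" using Uxy by auto
    then show ?thesis
      by cases (use c'x c'y c'o \<pi>(2) y(2) colU(2)[OF f] in auto)
  qed
  let ?R' = "orel X g c'"
  have eqR': "equiv UNIV ?R'" by (rule equiv_orel[OF g fpf'])
  note R's = equivUD[OF eqR']
  have RxI: "(f, f') \<in> R" if "(r, f) \<in> R" "(r, f') \<in> R" for r f f' using that Rs(2,3) by blast
  have stepR': "(f, c' f) \<in> R" if f: "f \<in> X" for f
  proof -
    consider "f \<in> Ux" | "f \<in> Uy" | "f \<notin> U" using Uxy by auto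
    then show ?thesis
    proof cases
      case 1
      then show ?thesis using c'x[OF 1] \<pi>(1)[OF 1] RxI[of p f "\<pi> f"] by (simp add: Ux_def)
    next
      case 2
      then show ?thesis using c'y[OF 2] y(1)[OF 2] RxI[of "l p" f "c' f"] by (simp add: Uy_def)
    next
      case 3
      then show ?thesis using c'o stepR(1)[OF f] by simp
    qed
  qed
  define Q where "Q = R \<inter> {(u, v). col u = col v}"
  have "equiv UNIV Q"
  proof (rule equivUI)
    show "(u, w) \<in> Q" if "(u, v) \<in> Q" "(v, w) \<in> Q" for u v w using that Rs(3)[of u v w] by (simp add: Q_def)
  qed (use Rs(1,2) in \<open>auto simp: Q_def\<close>)
  then have sub: "?R' \<subseteq> Q"
    by (rule orel_least) (use stepR stepR' col col' in \<open>auto simp: Q_def\<close>)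
  have KV': "KV \<subseteq> ?R'"
    unfolding KV_def orel_def by (rule rtrancl_mono) (auto simp: lnk_def c'o)
  \<comment> \<open>A flag at \<open>x\<close> or \<open>y\<close> that reaches no mixed corner
    would see its whole rotation in one colour. The digon excludes this, as its two edges give both
    colours at either end.\<close>
  have reach: "\<exists>a\<in>U. (f, a) \<in> KV" if f: "f \<in> X" and r: "r \<in> {p, l p}" "(r, f) \<in> R" for f r
  proof (rule ccontr)
    assume none: "\<not> (\<exists>a\<in>U. (f, a) \<in> KV)"
    have cl: "v \<in> KV `` {f}" if "(f, v) \<in> R" for v
      using that unfolding goodD(2)[OF good, symmetric] orel_def
    proof (rule rtrancl_closed)
      show "f \<in> KV `` {f}" using equivUD(1)[OF equiv_K(2)] by simp
      fix u v assume uv: "(u, v) \<in> lnk X g \<union> lnk X c" "u \<in> KV `` {f}"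
      then have "u \<notin> U" using none by auto
      then have "(u, v) \<in> KV" using uv(1) unfolding KV_def by (intro r_into_rtrancl) (auto simp: lnk_def)
      then show "v \<in> KV `` {f}" using uv(2) equivUD(3)[OF equiv_K(2)] by blast
    qed
    obtain s where s: "s \<in> {q, l q}" "(r, s) \<in> R" "col r" "\<not> col s" using r pq_facts colp colq by auto
    have "(f, r) \<in> KV" "(f, s) \<in> KV" using cl[of r] cl[of s] r(2) s(2) Rs(2,3) by blast+
    then show False using K_col[of f r] K_col[of f s] f s(3,4) by simp
  qed
  have linkx: "(a, a') \<in> ?R'" if "a \<in> Uk k" "a' \<in> Uk k" for a a' k
  proof -
    have "orel (Uk k) \<alpha> (P k) \<subseteq> ?R'"
    proof (rule orel_least[OF eqR'])
      fix f assume f: "f \<in> Uk k"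
      then have f': "f \<in> Ux" "f \<in> U" "f \<in> X" "col f = k" using UkU by (auto simp: Uk_def)
      show "(f, \<alpha> f) \<in> ?R'" using \<alpha>(2)[OF f'(2)] KV' by blast
      show "(f, P k f) \<in> ?R'" using orel_stepI(2)[OF f'(3), of c' g] c'x[OF f'(1)] f'(4) by (simp add: \<pi>_def)
    qed
    then show ?thesis using P(2) that by blast
  qed
  have linky: "(\<sigma> a, \<sigma> a') \<in> ?R'" if a: "a \<in> Uk k" "a' \<in> Uk k" for a a' k
  proof -
    define Q' where "Q' = {(u, v). (\<sigma> u, \<sigma> v) \<in> ?R'}"
    have "equiv UNIV Q'"
    proof (rule equivUI)
      show "(u, w) \<in> Q'" if "(u, v) \<in> Q'" "(v, w) \<in> Q'" for u v w
        using that R's(3)[of "\<sigma> u" "\<sigma> v" "\<sigma> w"] by (simp add: Q'_def)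
    qed (use R's(1,2) in \<open>auto simp: Q'_def\<close>)
    then have "orel (Uk k) \<beta> (P k) \<subseteq> Q'"
    proof (rule orel_least)
      fix f assume f: "f \<in> Uk k"
      then have f': "f \<in> Ux" "f \<in> U" "f \<in> X" "col f = k" using UkU by (auto simp: Uk_def)
      have s: "\<sigma> f \<in> Uy" "\<sigma> f \<in> U" "\<sigma> f \<in> X" "\<sigma> (\<sigma> f) = f"
        using \<sigma>_xy(1)[OF f'(1)] \<sigma>f[OF f'(2)] U_sub by auto
      have "\<sigma> (\<beta> f) = \<alpha> (\<sigma> f)" using \<sigma>f(3)[OF \<alpha>f(1)[OF s(2)]] by (simp add: \<beta>_def)
      then show "(f, \<beta> f) \<in> Q'" using \<alpha>(2)[OF s(2)] KV' by (auto simp: Q'_def)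
      show "(f, P k f) \<in> Q'"
        using orel_stepI(2)[OF s(3), of c' g] c'y[OF s(1)] s(4) f'(4) by (simp add: Q'_def \<pi>_def)
    qed
    then show ?thesis using P(3)[OF a] by (auto simp: Q'_def)
  qed
  have sup: "(u, v) \<in> ?R'" if u: "u \<in> X" and uv: "(u, v) \<in> R" "col u = col v" for u v
  proof -
    have vX: "v \<in> X" using uv(1) u orel_subset[OF g c] goodD(2)[OF good] by blast
    consider "(p, u) \<in> R" | "(l p, u) \<in> R" | "(p, u) \<notin> R" "(l p, u) \<notin> R" by auto
    then show ?thesis
    proof cases
      case 1
      then have pv: "(p, v) \<in> R" using uv Rs(3) by blast
      obtain a b where ab: "a \<in> U" "(u, a) \<in> KV" "b \<in> U" "(v, b) \<in> KV"
        using reach[OF u _ 1] reach[OF vX _ pv] by auto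
      have "(p, a) \<in> R" "(p, b) \<in> R" using ab KV_R 1 pv Rs(3) by blast+
      then have "a \<in> Uk (col u)" "b \<in> Uk (col u)"
        using ab K_col[of u a] K_col[of v b] u vX uv(2) by (auto simp: Uk_def Ux_def)
      then have "(a, b) \<in> ?R'" by (rule linkx)
      moreover have "(u, a) \<in> ?R'" "(b, v) \<in> ?R'" using ab KV' R's(2) by blast+
      ultimately show ?thesis using R's(3) by meson
    next
      case 2
      then have lpv: "(l p, v) \<in> R" using uv Rs(3) by blast
      obtain a b where ab: "a \<in> U" "(u, a) \<in> KV" "b \<in> U" "(v, b) \<in> KV"
        using reach[OF u _ 2] reach[OF vX _ lpv] by auto
      have "(l p, a) \<in> R" "(l p, b) \<in> R" using ab KV_R 2 lpv Rs(3) by blast+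
      then have "a \<in> Uy" "b \<in> Uy" using ab by (auto simp: Uy_def)
      moreover have "col a = col u" "col b = col u" using K_col[of u a] K_col[of v b] u vX uv(2) ab by auto
      ultimately have "\<sigma> a \<in> Uk (col u)" "\<sigma> b \<in> Uk (col u)"
        using \<sigma>_xy(2) \<sigma>\<alpha>_col(1) ab by (auto simp: Uk_def)
      then have "(\<sigma> (\<sigma> a), \<sigma> (\<sigma> b)) \<in> ?R'" by (rule linky)
      then have "(a, b) \<in> ?R'" using \<sigma>f(3) ab by simp
      moreover have "(u, a) \<in> ?R'" "(b, v) \<in> ?R'" using ab KV' R's(2) by blast+
      ultimately show ?thesis using R's(3) by meson
    next
      case 3
      have "v \<in> {v. (u, v) \<in> ?R' \<and> (u, v) \<in> R}"
        using uv(1)[unfolded goodD(2)[OF good, symmetric] orel_def]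
      proof (rule rtrancl_closed)
        show "u \<in> {v. (u, v) \<in> ?R' \<and> (u, v) \<in> R}" using R's(1) Rs(1) by simp
        fix s t assume st: "(s, t) \<in> lnk X g \<union> lnk X c" "s \<in> {v. (u, v) \<in> ?R' \<and> (u, v) \<in> R}"
        then have "s \<notin> U" using 3 Uxy(1) Rs(2,3) unfolding Ux_def Uy_def by blast
        then have "t = g s \<or> t = c' s" "s \<in> X" using st(1) c'o by (auto simp: lnk_def)
        then have "(s, t) \<in> ?R'" "(s, t) \<in> R"
          using orel_stepI[of s X g c'] orel_stepI[of s X c' g] stepR(2)[of s] stepR'[of s] by auto
        then show "t \<in> {v. (u, v) \<in> ?R' \<and> (u, v) \<in> R}" using st(2) R's(3) Rs(3) by blast
      qed
      then show ?thesis by simp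
    qed
  qed
  have "fpf_involution_on Ux \<pi>" using \<pi> by (simp add: fpf_involution_on_def)
  then obtain T where T: "T \<subseteq> Ux" "Ux = T \<union> \<pi> ` T" "2 * card T = card Ux"
    using involution_transversal[of Ux \<pi>] finite_subset[OF Usub(3) finU] by blast
  have TX: "finite T" "T \<subseteq> X" "\<pi> ` T \<subseteq> X" using T Usub finite_subset[OF _ finU] by auto
  let ?L = "add_links (cutl l) \<pi> T"
  have eqL: "equiv UNIV ?L" by (rule add_links_insert(2)[OF sym_cutl(1)])
  note Ls = equivUD[OF eqL]
  have KL: "KF \<subseteq> ?L" unfolding KF_def add_links_def by (rule rtrancl_mono) auto
  have \<pi>L: "(a, \<pi> a) \<in> ?L" if a: "a \<in> Ux" for a
  proof -
    have t: "(a, \<pi> a) \<in> ?L" "(\<pi> a, a) \<in> ?L" if "a \<in> T" for a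
      using that unfolding add_links_def by (auto intro!: r_into_rtrancl)
    from a T(2) consider "a \<in> T" | b where "b \<in> T" "a = \<pi> b" by blast
    then show ?thesis
    proof cases
      case 2
      then have "\<pi> a = b" using \<pi>(4) T(1) by auto
      then show ?thesis using t(2)[OF 2(1)] 2 by simp
    qed (use t in auto)
  qed
  \<comment> \<open>The new corners at \<open>y\<close> link nothing that is not already linked by
    those at \<open>x\<close>, since the strands connect both ends. So one link per pair of
    \<open>\<pi>\<close> suffices, and \<open>card T\<close>, half of \<open>card Ux\<close>, is
    exactly the loss already accounted for in \<open>faces_le\<close>.\<close>
  have "orel X l c' \<subseteq> ?L"
  proof (rule orel_least[OF eqL])
    fix f assume f: "f \<in> X"
    have "(f, l f) \<in> KF" unfolding KF_def using f by (intro r_into_rtrancl) (auto simp: lnk_def)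
    then show "(f, l f) \<in> ?L" using KL by blast
    consider "f \<in> Ux" | "f \<in> Uy" | "f \<notin> U" using Uxy by auto
    then show "(f, c' f) \<in> ?L"
    proof cases
      case 1
      then show ?thesis using \<pi>L c'x by simp
    next
      case 2
      then have s: "\<sigma> f \<in> Ux" "f \<in> U" "\<pi> (\<sigma> f) \<in> U" using \<sigma>_xy(2)[OF 2] \<pi>(1) Usub by auto
      have "(f, \<sigma> f) \<in> ?L" "(\<pi> (\<sigma> f), \<sigma> (\<pi> (\<sigma> f))) \<in> ?L" using \<sigma>(2)[OF s(2)] \<sigma>(2)[OF s(3)] KL by blast+
      then show ?thesis using \<pi>L[OF s(1)] c'y[OF 2] Ls(3) by metis
    next
      case 3
      then have "(f, c f) \<in> KF" unfolding KF_def using f by (intro r_into_rtrancl) (auto simp: lnk_def)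
      then show ?thesis using KL c'o[OF 3] by auto
    qed
  qed
  then have "ncl X ?L \<le> nf c'"
    unfolding nf_def by (intro ncl_antimono fin eqL equiv_orel l fpf')
  moreover have "ncl X KF \<le> ncl X ?L + card T"
    unfolding KF_def by (rule ncl_add_links_ge[OF fin sym_cutl(1) TX])
  ultimately have "nf c \<le> nf c'" using faces_le card_Ux T(3) by linarith
  moreover have "\<forall>u\<in>X. \<forall>v. (u, v) \<in> ?R' \<longleftrightarrow> (u, v) \<in> R \<and> col u = col v"
    using sub sup by (auto simp: Q_def)
  ultimately show ?thesis using fpf' col' by blast
qed

end

section \<open>The lower bound for the genus of a sum\<close>

text \<open>Both ends of the digon split, which gains two vertices; at most one component is gained,
  and it counts twice; no face is lost. The balance in \<open>eg\<close> is not positive.\<close>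

lemma separate_colours:
  assumes gl: "gluing X l g c"
    and col: "\<And>f. f \<in> X \<Longrightarrow> col (l f) = col f" "\<And>f. f \<in> X \<Longrightarrow> col (g f) = col f"
    and p: "p \<in> X" "col p" "\<not> col (c p)" "c (l p) = l (c p)" "(p, l p) \<notin> orel X g c"
    and mono: "\<And>f. f \<in> X \<Longrightarrow> (p, f) \<notin> orel X g c \<Longrightarrow> (l p, f) \<notin> orel X g c \<Longrightarrow> col (c f) = col f"
  shows "\<exists>c'. gluing X l g c' \<and> eg X l g c' \<le> eg X l g c \<and> (\<forall>f\<in>X. col (c' f) = col f) \<and>
    (\<forall>u\<in>X. \<forall>v. (u, v) \<in> orel X g c' \<longleftrightarrow> (u, v) \<in> orel X g c \<and> col u = col v)"
proof -
  let ?R = "orel X g c"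
  define q where "q = c p"
  note G = gluingD[OF gl]
  have R: "equiv UNIV ?R" by (rule equiv_orel[OF G(3,4)])
  note Rs = equivUD[OF R]
  have q: "q \<in> X" "\<not> col q" "c p = q" "c (l p) = l q" using fpfD[OF G(4)] p by (auto simp: q_def)
  interpret coloured X l g col ?R p q
    by unfold_locales (use G R col p q in auto)
  have "good c" using G q mono by (simp add: good_def)
  then obtain c1 where c1: "good c1" "nf c \<le> nf c1" "\<forall>r\<in>{p, l p}. \<forall>a\<in>X. \<forall>a'\<in>X. col a \<longrightarrow> col a' \<longrightarrow> \<not> col (c1 a) \<longrightarrow>
    \<not> col (c1 a') \<longrightarrow> (r, a) \<in> ?R \<longrightarrow> (r, a') \<in> ?R \<longrightarrow> (a, a') \<in> orel X l c1 \<longrightarrow> a = a'"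
    using reduced_exists by blast
  interpret reduced X l g col ?R p q c1
    by unfold_locales (use c1 in blast)+
  obtain c' where c': "fpf_involution_on X c'" "\<And>f. f \<in> X \<Longrightarrow> col (c' f) = col f" "nf c1 \<le> nf c'"
    "\<And>u v. u \<in> X \<Longrightarrow> (u, v) \<in> orel X g c' \<longleftrightarrow> (u, v) \<in> ?R \<and> col u = col v"
    using separated by blast
  let ?R' = "orel X g c'"
  have lp: "l p \<in> X" "l q \<in> X" "col (l p)" "\<not> col (l q)" using fpfD(1)[OF G(2)] p q col by auto
  have pq: "(p, q) \<in> ?R" "(l p, l q) \<in> ?R" using orel_stepI(2)[OF p(1), of c g] orel_stepI(2)[OF lp(1), of c g] q by auto
  have eqR': "equiv UNIV ?R'" by (rule equiv_orel[OF G(3) c'(1)])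
  have R'R: "?R' \<subseteq> ?R"
  proof (rule orel_least[OF R])
    fix f assume f: "f \<in> X"
    show "(f, g f) \<in> ?R" using f by (rule orel_stepI)
    show "(f, c' f) \<in> ?R" using orel_stepI(2)[OF f, of c' g] c'(4)[OF f] by blast
  qed
  \<comment> \<open>The links from \<open>p\<close> to \<open>q\<close> and from \<open>l p\<close>
    to \<open>l q\<close> lie inside the old vertex partition, and each of them unites two vertices
    of the new one.\<close>
  have V: "ncl X ?R + 2 \<le> ncl X ?R'"
  proof -
    let ?J = "join ?R' p q"
    have "(p, q) \<notin> ?R'" using c'(4)[OF p(1)] p q by auto
    then have 1: "ncl X ?J + 1 = ncl X ?R'" by (intro ncl_join G eqR' p q)
    have eqJ: "equiv UNIV ?J" by (rule equiv_join[OF eqR'])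
    have "(l p, l q) \<notin> ?J"
    proof
      assume "(l p, l q) \<in> ?J"
      moreover have "(l p, l q) \<notin> ?R'" using c'(4)[OF lp(1)] lp by auto
      ultimately have "(p, l p) \<in> ?R' \<or> (q, l p) \<in> ?R'" by (auto simp: join_def)
      then have "(p, l p) \<in> ?R" using R'R pq(1) Rs(3) by blast
      then show False using p by simp
    qed
    then have 2: "ncl X (join ?J (l p) (l q)) + 1 = ncl X ?J" by (intro ncl_join G eqJ lp)
    have "join ?J (l p) (l q) \<subseteq> ?R" by (intro join_least R R'R pq)
    then have "ncl X ?R \<le> ncl X (join ?J (l p) (l q))" by (intro ncl_antimono G equiv_join eqR' R)
    then show ?thesis using 1 2 by simp
  qed
  \<comment> \<open>One link from \<open>p\<close> to \<open>q\<close> restores all connections: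
    along the sides it also connects \<open>l p\<close> with \<open>l q\<close>, and every mixed
    corner can be bypassed inside its vertex through one of these two pairs.\<close>
  have C: "ncl X (crel X l g c') \<le> ncl X (crel X l g c) + 1"
  proof -
    let ?C = "crel X l g c'"
    let ?J = "join ?C p q"
    have eqC: "equiv UNIV ?C" "equiv UNIV (crel X l g c)" by (intro equiv_crel G c'(1))+
    have eqJ: "equiv UNIV ?J" by (rule equiv_join[OF eqC(1)])
    note Js = equivUD[OF eqJ]
    have CJ: "?C \<subseteq> ?J" by (rule join_mem(3)[OF eqC(1)])
    have RJ: "?R' \<subseteq> ?J" using orel_subset_crel(2)[of X g c' l] CJ by blast
    have pqJ: "(p, q) \<in> ?J" by (rule join_mem[OF eqC(1)])
    have toR: "(u, v) \<in> ?J" if "u \<in> X" "(u, v) \<in> ?R" "col u = col v" for u v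
      using that c'(4) RJ by blast
    have lJ: "(f, l f) \<in> ?J" if "f \<in> X" for f using crel_stepI(1)[OF that] CJ by blast
    have lpq: "(l p, l q) \<in> ?J" using lJ[OF p(1)] lJ[OF q(1)] pqJ Js(2,3) by meson
    have "crel X l g c \<subseteq> ?J"
    proof (rule crel_least[OF eqJ])
      fix f assume f: "f \<in> X"
      show "(f, l f) \<in> ?J" "(f, g f) \<in> ?J" using crel_stepI[OF f] CJ by blast+
      have cR: "(f, c f) \<in> ?R" and cX: "c f \<in> X" using orel_stepI(2)[OF f] fpfD(1)[OF G(4) f] by auto
      have key: "(f, c f) \<in> ?J" if r: "r \<in> X" "s \<in> X" "(r, s) \<in> ?J" "(r, s) \<in> ?R" "col r" "\<not> col s" "(r, f) \<in> ?R"
        "col f \<noteq> col (c f)" for r s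
      proof -
        have *: "(f, r) \<in> ?R" "(f, s) \<in> ?R" "(c f, r) \<in> ?R" "(c f, s) \<in> ?R"
          using r(4,7) cR Rs(2,3) by meson+
        show ?thesis
        proof (cases "col f")
          case True
          then have "(f, r) \<in> ?J" "(c f, s) \<in> ?J" using * toR f cX r by auto
          then show ?thesis using r(3) Js(2,3) by meson
        next
          case False
          then have "(f, s) \<in> ?J" "(c f, r) \<in> ?J" using * toR f cX r by auto
          then show ?thesis using r(3) Js(2,3) by meson
        qed
      qed
      show "(f, c f) \<in> ?J"
      proof (cases "col f = col (c f)")
        case True
        then show ?thesis using toR[OF f cR] by simp
      next
        case False
        then consider "(p, f) \<in> ?R" | "(l p, f) \<in> ?R" using mono[OF f] by auto
        then show ?thesis
        proof cases
          case 1 then show ?thesis using key[of p q] p q pq pqJ False by auto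
        next
          case 2 then show ?thesis using key[of "l p" "l q"] lp pq lpq False by auto
        qed
      qed
    qed
    then have "ncl X ?J \<le> ncl X (crel X l g c)" by (intro ncl_antimono G eqJ eqC)
    then show ?thesis using ncl_join_ge[OF G(1) eqC(1) p(1) q(1)] by simp
  qed
  have "eg X l g c' \<le> eg X l g c"
    unfolding eg_def using V C c1(2) c'(3) unfolding nf_def by linarith
  then show ?thesis using c' gluing_corner[OF gl c'(1)] by blast
qed

text \<open>The drawn edge \<open>xy\<close> goes to the first graph and a parallel copy to the
  second. After the separation of colours the gluing is a disjoint union that carries one graph on
  each part, and the genus is additive over the parts.\<close>

lemma euler_genus_amalgamation_ge:
  assumes fin: "finite (pverts G\<^sub>1)" "finite (pverts G\<^sub>2)"
    and A: "parcs G\<^sub>1 \<subseteq> pverts G\<^sub>1 \<times> pverts G\<^sub>1" "parcs G\<^sub>2 \<subseteq> pverts G\<^sub>2 \<times> pverts G\<^sub>2"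
    and loops: "\<And>u. (u, u) \<notin> parcs G\<^sub>1" "\<And>u. (u, u) \<notin> parcs G\<^sub>2"
    and xy: "pverts G\<^sub>1 \<inter> pverts G\<^sub>2 = {x, y}" "x \<noteq> y" "(x, y) \<in> parcs G\<^sub>1" "(x, y) \<in> parcs G\<^sub>2"
    and G: "pverts G = pverts G\<^sub>1 \<union> pverts G\<^sub>2" "parcs G = parcs G\<^sub>1 \<union> parcs G\<^sub>2"
  shows "euler_genus G\<^sub>1 + euler_genus G\<^sub>2 \<le> euler_genus G"
proof -
  let ?V1 = "pverts G\<^sub>1" and ?V2 = "pverts G\<^sub>2"
  have finG: "finite (pverts G)" and AG: "parcs G \<subseteq> pverts G \<times> pverts G" using fin A G by auto
  obtain X l g c0 \<rho> where X: "gluing X l g c0" "(X :: nat set) \<noteq> {}" "draws (pverts G) (parcs G) X l g c0 \<rho>"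
    "eg X l g c0 = int (euler_genus G)"
    by (rule euler_genus_drawing[OF finG AG])
  let ?O0 = "orel X g c0"
  have eqO0: "equiv UNIV ?O0" using gluingD[OF X(1)] by (intro equiv_orel)
  note O0 = equivUD[OF eqO0]
  note lf = fpfD[OF gluingD(2)[OF X(1)]] and gf = fpfD[OF gluingD(3)[OF X(1)]] and lg = gluingD(5)[OF X(1)]
  obtain \<epsilon> where \<epsilon>: "\<And>u v. (u, v) \<in> parcs G \<Longrightarrow> \<epsilon> (u, v) \<in> X \<and> (\<rho> u, \<epsilon> (u, v)) \<in> ?O0 \<and> (\<rho> v, l (\<epsilon> (u, v))) \<in> ?O0"
  proof -
    have "\<exists>f. f \<in> X \<and> (\<rho> (fst a), f) \<in> ?O0 \<and> (\<rho> (snd a), l f) \<in> ?O0" if "a \<in> parcs G" for a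
      using drawsD(3)[OF X(3), of "fst a" "snd a"] that by auto
    then obtain e where "\<And>a. a \<in> parcs G \<Longrightarrow> e a \<in> X \<and> (\<rho> (fst a), e a) \<in> ?O0 \<and> (\<rho> (snd a), l (e a)) \<in> ?O0" by metis
    then show thesis using that[of e] by fastforce
  qed
  define Ed where "Ed f = {f, l f, g f, g (l f)}" for f
  have Ed_l: "l f \<in> Ed e" "g f \<in> Ed e" if "f \<in> Ed e" "e \<in> X" for f e
    using that(1) lf(3)[OF that(2)] gf(3)[OF that(2)] gf(3)[OF lf(1)[OF that(2)]] lg[OF that(2)] lg[OF lf(1)[OF that(2)]]
    by (auto simp: Ed_def)
  have Ed_X: "Ed e \<subseteq> X" if "e \<in> X" for e using lf(1) gf(1) that by (auto simp: Ed_def)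
  have gO: "(f, g f) \<in> ?O0" if "f \<in> X" for f using that by (rule orel_stepI)
  have Ed_end: "\<exists>w\<in>{u, v}. (\<rho> w, f) \<in> ?O0" if "(u, v) \<in> parcs G" "f \<in> Ed (\<epsilon> (u, v))" for u v f
    using \<epsilon>[OF that(1)] that(2) gO[of "\<epsilon> (u, v)"] gO[of "l (\<epsilon> (u, v))"] lf(1)[of "\<epsilon> (u, v)"] O0(3)
    unfolding Ed_def by blast
  \<comment> \<open>The arc \<open>(x, y)\<close> alone stands for the edge \<open>xy\<close>,
    because the flag chosen for the reverse arc may lie on another edge of the 1-skeleton.\<close>
  define A1 A2 where "A1 = insert (x, y) (parcs G\<^sub>1 - {(y, x)})" and "A2 = parcs G\<^sub>2 - {(x, y), (y, x)}"
  have A12: "A1 \<subseteq> parcs G" "A2 \<subseteq> parcs G" "A1 \<subseteq> parcs G\<^sub>1" "A2 \<subseteq> parcs G\<^sub>2" using xy G by (auto simp: A1_def A2_def)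
  define Z1 Z2 where "Z1 = (\<Union>a\<in>A1. Ed (\<epsilon> a))" and "Z2 = (\<Union>a\<in>A2. Ed (\<epsilon> a))"
  have \<epsilon>X: "\<epsilon> a \<in> X" if "a \<in> parcs G" for a using \<epsilon>[of "fst a" "snd a"] that by simp
  have Z_X: "Z1 \<subseteq> X" "Z2 \<subseteq> X" using Ed_X \<epsilon>X A12 unfolding Z1_def Z2_def by blast+
  have Z_l: "f \<in> Z1 \<Longrightarrow> l f \<in> Z1" "f \<in> Z2 \<Longrightarrow> l f \<in> Z2" "f \<in> Z1 \<Longrightarrow> g f \<in> Z1" "f \<in> Z2 \<Longrightarrow> g f \<in> Z2" for f
  proof -
    have Zc: "l f \<in> (\<Union>a\<in>B. Ed (\<epsilon> a)) \<and> g f \<in> (\<Union>a\<in>B. Ed (\<epsilon> a))" if "f \<in> (\<Union>a\<in>B. Ed (\<epsilon> a))" "B \<subseteq> parcs G" for B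
    proof -
      from that obtain a where a: "a \<in> B" "f \<in> Ed (\<epsilon> a)" by blast
      then have "\<epsilon> a \<in> X" using \<epsilon>X that(2) by blast
      then show ?thesis using Ed_l[OF a(2)] a(1) by blast
    qed
    show "f \<in> Z1 \<Longrightarrow> l f \<in> Z1" "f \<in> Z2 \<Longrightarrow> l f \<in> Z2" "f \<in> Z1 \<Longrightarrow> g f \<in> Z1" "f \<in> Z2 \<Longrightarrow> g f \<in> Z2"
      using Zc[OF _ A12(1)] Zc[OF _ A12(2)] unfolding Z1_def Z2_def by simp_all
  qed
  have \<epsilon>Z: "\<epsilon> a \<in> Z1" if "a \<in> A1" for a using that unfolding Z1_def Ed_def by blast
  have \<epsilon>Z2: "\<epsilon> a \<in> Z2" if "a \<in> A2" for a using that unfolding Z2_def Ed_def by blast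
  have uniq: "w = w'" if "w \<in> pverts G" "w' \<in> pverts G" "(\<rho> w, f) \<in> ?O0" "(\<rho> w', f) \<in> ?O0" for w w' f
    using drawsD(2)[OF X(3) that(1,2)] that(3,4) O0(2,3) by blast
  have Z1_end: "\<exists>w\<in>?V1. (\<rho> w, f) \<in> ?O0" if fZ: "f \<in> Z1" for f
  proof -
    obtain u v where "(u, v) \<in> A1" "f \<in> Ed (\<epsilon> (u, v))" using fZ unfolding Z1_def by auto
    then show ?thesis using Ed_end[of u v f] A12 A(1) by blast
  qed
  have Z2_end: "\<exists>w\<in>?V2. (\<rho> w, f) \<in> ?O0" if fZ: "f \<in> Z2" for f
  proof -
    obtain u v where "(u, v) \<in> A2" "f \<in> Ed (\<epsilon> (u, v))" using fZ unfolding Z2_def by auto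
    then show ?thesis using Ed_end[of u v f] A12 A(2) by blast
  qed
  \<comment> \<open>An edge of the 1-skeleton serving both sides would have both ends among
    \<open>x\<close> and \<open>y\<close>, but \<open>A2\<close> contains no arc between
    these.\<close>
  have Z12: "Z1 \<inter> Z2 = {}"
  proof (rule ccontr)
    assume "Z1 \<inter> Z2 \<noteq> {}"
    then obtain f where f: "f \<in> Z1" "f \<in> Z2" by auto
    obtain u v where uv: "(u, v) \<in> A2" "f \<in> Ed (\<epsilon> (u, v))" using f(2) unfolding Z2_def by auto
    have uvG: "(u, v) \<in> parcs G" "u \<in> ?V2" "v \<in> ?V2" using uv A12 A by auto
    have e: "\<epsilon> (u, v) \<in> X" "(\<rho> u, \<epsilon> (u, v)) \<in> ?O0" "(\<rho> v, l (\<epsilon> (u, v))) \<in> ?O0" using \<epsilon>[OF uvG(1)] by auto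
    have "\<epsilon> (u, v) \<in> Ed f"
      using uv(2) e(1) lf gf lg unfolding Ed_def by auto
    then have eZ: "\<epsilon> (u, v) \<in> Z1" "l (\<epsilon> (u, v)) \<in> Z1"
      using Z_l(1,3) f(1) unfolding Ed_def by auto
    have "u \<in> ?V1" using Z1_end[OF eZ(1)] uniq[of u _ "\<epsilon> (u, v)"] e uvG G by blast
    moreover have "v \<in> ?V1" using Z1_end[OF eZ(2)] uniq[of v _ "l (\<epsilon> (u, v))"] e uvG G by blast
    ultimately have "u \<in> {x, y}" "v \<in> {x, y}" using uvG xy(1) by auto
    moreover have "u \<noteq> v" using uv(1) loops A12 by auto
    ultimately show False using uv(1) unfolding A2_def by auto
  qed
  \<comment> \<open>Edges outside the graph might run between vertices of different sides and create
    mixed corners away from \<open>x\<close> and \<open>y\<close>; detaching them prevents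
    this.\<close>
  define N where "N = X - (Z1 \<union> Z2)"
  have gZ: "f \<in> Z1 \<union> Z2" if "g f \<in> Z1 \<union> Z2" "f \<in> X" for f
    using Z_l(3,4)[of "g f"] that gf(3)[OF that(2)] by auto
  have N: "N \<subseteq> X" "g ` N \<subseteq> N" using gZ gf(1) unfolding N_def by auto
  obtain c1 where c1: "fpf_involution_on X c1" "eg X l g c1 \<le> eg X l g c0" "\<And>f. f \<in> N \<Longrightarrow> c1 f = g f"
    "\<And>u v. u \<notin> N \<Longrightarrow> v \<notin> N \<Longrightarrow> (u, v) \<in> orel X g c1 \<longleftrightarrow> (u, v) \<in> ?O0"
    using detach[OF X(1) N] by blast
  have gl1: "gluing X l g c1" by (rule gluing_corner[OF X(1) c1(1)])
  \<comment> \<open>The second copy of the edge \<open>xy\<close>, amalgamated along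
    \<open>p\<close> below, where the digon arises.\<close>
  obtain Y m k d where Y: "gluing Y m k k" "eg Y m k k \<le> 0" "Y \<inter> X = {}" "d \<in> Y"
    "(d, m d) \<notin> orel Y k k" "\<And>f. f \<in> Y \<Longrightarrow> (d, f) \<in> orel Y k k \<or> (m d, f) \<in> orel Y k k"
    by (rule edge_sphere[OF gluingD(1)[OF X(1)]], rule that)
  have dj: "X \<inter> Y = {}" using Y by auto
  define X' where "X' = X \<union> Y"
  define l' where "l' = (\<lambda>f. if f \<in> X then l f else m f)"
  define g' where "g' = (\<lambda>f. if f \<in> X then g f else k f)"
  define cU where "cU = (\<lambda>f. if f \<in> X then c1 f else k f)"
  note U = gluing_disjoint_union[OF gl1 Y(1) dj, folded X'_def l'_def g'_def cU_def]
  let ?OU = "orel X' g' cU"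
  have eqOU: "equiv UNIV ?OU" using gluingD[OF U(1)] by (intro equiv_orel)
  note OU = equivUD[OF eqOU]
  have clX: "v \<in> X" if "(u, v) \<in> ?OU" "u \<in> X" for u v
    using that U(5) orel_subset[OF gluingD(3,4)[OF gl1]] by blast
  have clY: "v \<in> Y" if "(u, v) \<in> ?OU" "u \<in> Y" for u v
    using that U(6) orel_subset[OF gluingD(3,4)[OF Y(1)]] by blast
  have l'X: "l' f = l f" if "f \<in> X" for f using that by (simp add: l'_def)
  have l'Y: "l' f = m f" if "f \<in> Y" for f using that dj by (auto simp: l'_def)
  have md: "m d \<in> Y" using fpfD(1)[OF gluingD(2)[OF Y(1)] Y(4)] .
  define p where "p = \<epsilon> (x, y)"
  have xyG: "(x, y) \<in> parcs G" "x \<in> pverts G" "y \<in> pverts G" using xy G by auto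
  have p: "p \<in> X" "(\<rho> x, p) \<in> ?O0" "(\<rho> y, l p) \<in> ?O0" "p \<in> Z1" "l p \<in> Z1" "l p \<in> X"
    using \<epsilon>[OF xyG(1)] \<epsilon>Z[of "(x, y)"] Z_l(1) lf(1) by (auto simp: p_def A1_def)
  have ZN: "f \<notin> N" if "f \<in> Z1 \<union> Z2" for f using that by (simp add: N_def)
  have ZO: "(u, v) \<in> ?OU \<longleftrightarrow> (u, v) \<in> ?O0" if "u \<in> Z1 \<union> Z2" "v \<in> Z1 \<union> Z2" for u v
    using U(5)[of u v] c1(4)[of u v] that ZN Z_X by auto
  have sub1: "lnk X l \<union> lnk X g \<union> lnk X c1 \<subseteq> X \<times> X"
    using lnk_subset[OF gluingD(2)[OF gl1]] lnk_subset[OF gluingD(3)[OF gl1]] lnk_subset[OF gluingD(4)[OF gl1]] by simp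
  have pd: "(p, d) \<notin> crel X' l' g' cU"
    using rtrancl_Image_subset[OF sub1 p(1)] U(4)[OF p(1), of d] Y(4) dj by (auto simp: crel_def)
  have plO0: "(p, l p) \<notin> ?O0" using uniq[OF xyG(2,3), of "l p"] p O0(3) xy(2) by blast
  have pl: "(p, l' p) \<notin> ?OU" using plO0 ZO[of p "l p"] p l'X by auto
  have dl: "(d, l' d) \<notin> ?OU" using U(6)[OF Y(4)] Y(4,5) l'Y by auto
  have pX': "p \<in> X'" "d \<in> X'" using p Y by (auto simp: X'_def)
  obtain c2 where c2: "gluing X' l' g' c2" "eg X' l' g' c2 \<le> eg X' l' g' cU" "c2 p = d" "c2 (l' p) = l' d"
    "\<And>s t. (s, t) \<in> orel X' g' c2 \<longleftrightarrow> (s, t) \<in> ?OU \<or>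
       (p, s) \<in> ?OU \<and> (d, t) \<in> ?OU \<or> (d, s) \<in> ?OU \<and> (p, t) \<in> ?OU \<or>
       (l' p, s) \<in> ?OU \<and> (l' d, t) \<in> ?OU \<or> (l' d, s) \<in> ?OU \<and> (l' p, t) \<in> ?OU"
    "\<And>f. f \<notin> {p, cU p, d, cU d, l' p, cU (l' p), l' d, cU (l' d)} \<Longrightarrow> c2 f = cU f"
    by (rule amalgamate[OF U(1) pX' pd pl dl], rule that)
  let ?O2 = "orel X' g' c2"
  have eqO2: "equiv UNIV ?O2" using gluingD[OF c2(1)] by (intro equiv_orel)
  note O2 = equivUD[OF eqO2]
  have dX: "(d, s) \<notin> ?OU" "(l' d, s) \<notin> ?OU" if "s \<in> X" for s
    using clY[of d s] clY[of "l' d" s] Y(4) md l'Y dj that by auto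
  have O2X: "(s, t) \<in> ?O2 \<longleftrightarrow> (s, t) \<in> ?OU" if "s \<in> X" "t \<in> X" for s t
    unfolding c2(5) using dX that by auto
  have O2Z: "(s, t) \<in> ?O2 \<longleftrightarrow> (s, t) \<in> ?O0" if "s \<in> Z1 \<union> Z2" "t \<in> Z1 \<union> Z2" for s t
    using O2X[of s t] ZO[OF that] that Z_X by auto
  have OUO2: "?OU \<subseteq> ?O2" using c2(5) by auto
  have pdO2: "(p, d) \<in> ?O2" "(l' p, l' d) \<in> ?O2" unfolding c2(5) using OU(1) by auto
  \<comment> \<open>Detached flags are counted to the first side. They create no mixed corner, since
    the corner map agrees with \<open>g\<close> there and \<open>g\<close> preserves
    colours.\<close>
  define col where "col f \<longleftrightarrow> f \<in> X - Z2" for f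
  have colX: "col f \<longleftrightarrow> f \<notin> Z2" if "f \<in> X" for f using that by (simp add: col_def)
  have colY: "\<not> col f" if "f \<in> Y" for f using that dj by (auto simp: col_def)
  have lZ2: "f \<in> Z2 \<longleftrightarrow> l f \<in> Z2" "f \<in> Z2 \<longleftrightarrow> g f \<in> Z2" if "f \<in> X" for f
  proof -
    show "f \<in> Z2 \<longleftrightarrow> l f \<in> Z2" using Z_l(2)[of f] Z_l(2)[of "l f"] unfolding lf(3)[OF that] by blast
    show "f \<in> Z2 \<longleftrightarrow> g f \<in> Z2" using Z_l(4)[of f] Z_l(4)[of "g f"] unfolding gf(3)[OF that] by blast
  qed
  have col_l: "col (l' f) = col f" "col (g' f) = col f" if f: "f \<in> X'" for f
  proof -
    consider "f \<in> X" | "f \<in> Y" using f by (auto simp: X'_def)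
    then have "col (l' f) = col f \<and> col (g' f) = col f"
    proof cases
      case 1
      then have "l' f = l f" "g' f = g f" by (simp_all add: l'_def g'_def)
      then show ?thesis
        using colX[OF 1] colX[OF lf(1)[OF 1]] colX[OF gf(1)[OF 1]] lZ2[OF 1] by metis
    next
      case 2
      then show ?thesis using colY fpfD(1)[OF gluingD(2)[OF Y(1)] 2] fpfD(1)[OF gluingD(3)[OF Y(1)] 2] dj
        by (auto simp: l'_def g'_def)
    qed
    then show "col (l' f) = col f" "col (g' f) = col f" by auto
  qed
  have colp: "col p" "\<not> col (c2 p)" using p(1,4) Z12 colY[OF Y(4)] c2(3) by (auto simp: col_def)
  have plO2: "(p, l' p) \<notin> ?O2" using O2X[of p "l p"] pl p l'X by auto
  have mono: "col (c2 f) = col f" if f: "f \<in> X'" "(p, f) \<notin> ?O2" "(l' p, f) \<notin> ?O2" for f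
  proof -
    have st: "(e, cU e) \<in> ?O2" if "e \<in> X'" for e using orel_stepI(2)[OF that, of cU g'] OUO2 by blast
    have lX': "l' p \<in> X'" "l' d \<in> X'" using p(6) md l'X[OF p(1)] l'Y[OF Y(4)] by (auto simp: X'_def)
    have "(p, cU p) \<in> ?O2" "(p, cU d) \<in> ?O2" "(l' p, cU (l' p)) \<in> ?O2" "(l' p, cU (l' d)) \<in> ?O2"
      using st[OF pX'(1)] st[OF pX'(2)] st[OF lX'(1)] st[OF lX'(2)] pdO2 O2(3) by blast+
    then have "f \<notin> {p, cU p, d, cU d, l' p, cU (l' p), l' d, cU (l' d)}"
      using f(2,3) pdO2 O2(1) by auto
    then have c2f: "c2 f = cU f" by (rule c2(6))
    have fY: "f \<notin> Y"
    proof
      assume "f \<in> Y"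
      then have "(d, f) \<in> ?OU \<or> (l' d, f) \<in> ?OU" using Y(6) U(6)[OF Y(4)] U(6)[OF md] l'Y[OF Y(4)] by auto
      then show False using f(2,3) pdO2 OUO2 O2(3) by blast
    qed
    then have fX: "f \<in> X" using f by (auto simp: X'_def)
    then have c2f: "c2 f = c1 f" using c2f by (simp add: cU_def)
    have cX: "c1 f \<in> X" "c1 (c1 f) = f" using fpfD[OF c1(1) fX] by auto
    show ?thesis
    proof (cases "f \<in> N")
      case True
      then show ?thesis using c1(3)[OF True] c2f lZ2(2)[OF fX] colX[OF fX] colX[OF gf(1)[OF fX]] by simp
    next
      case False
      then have fZ: "f \<in> Z1 \<union> Z2" using fX by (simp add: N_def)
      have "c1 f \<notin> N"
      proof
        assume n: "c1 f \<in> N"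
        then have "f = g (c1 f)" using c1(3)[OF n] cX by simp
        then show False using N(2) n False by auto
      qed
      then have cZ: "c1 f \<in> Z1 \<union> Z2" using cX by (simp add: N_def)
      have rel: "(f, c1 f) \<in> ?O0"
        using c1(4)[OF False \<open>c1 f \<notin> N\<close>] orel_stepI(2)[OF fX, of c1 g] by simp
      have notxy: "(\<rho> x, f) \<notin> ?O0" "(\<rho> y, f) \<notin> ?O0"
      proof -
        have "(p, f) \<notin> ?O0" "(l p, f) \<notin> ?O0" using f(2,3) O2Z[of p f] O2Z[of "l p" f] p fZ l'X[OF p(1)] by auto
        then show "(\<rho> x, f) \<notin> ?O0" "(\<rho> y, f) \<notin> ?O0" using p(2,3) O0(2,3) by blast+
      qed
      have no: False if ab: "a \<in> Z1" "b \<in> Z2" "(a, f) \<in> ?O0" "(b, f) \<in> ?O0" for a b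
      proof -
        obtain w w' where w: "w \<in> ?V1" "(\<rho> w, a) \<in> ?O0" "w' \<in> ?V2" "(\<rho> w', b) \<in> ?O0"
          using Z1_end[OF ab(1)] Z2_end[OF ab(2)] by blast
        have wf: "(\<rho> w, f) \<in> ?O0" "(\<rho> w', f) \<in> ?O0" using w(2,4) ab(3,4) O0(3) by blast+
        then have "w = w'" using uniq[of w w' f] w G by blast
        then have "w \<in> {x, y}" using w xy(1) by blast
        then show False using wf notxy by auto
      qed
      have "f \<in> Z1 \<longleftrightarrow> c1 f \<in> Z1"
        using no[of f "c1 f"] no[of "c1 f" f] fZ cZ rel O0(1) O0(2)[OF rel] by auto
      then have "f \<in> Z2 \<longleftrightarrow> c1 f \<in> Z2" using fZ cZ Z12 by auto
      then show ?thesis using colX[OF fX] colX[OF cX(1)] c2f by simp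
    qed
  qed
  have c2lp: "c2 (l' p) = l' (c2 p)" using c2(3,4) by simp
  obtain c3 where c3: "gluing X' l' g' c3" "eg X' l' g' c3 \<le> eg X' l' g' c2" "\<And>f. f \<in> X' \<Longrightarrow> col (c3 f) = col f"
    "\<And>u v. u \<in> X' \<Longrightarrow> (u, v) \<in> orel X' g' c3 \<longleftrightarrow> (u, v) \<in> ?O2 \<and> col u = col v"
    using separate_colours[of X' l' g' c2 col p, OF c2(1) col_l pX'(1) colp c2lp plO2 mono] by blast
  \<comment> \<open>All three maps now preserve the colour, so the two colour classes are gluings
    themselves and the genus is the sum of theirs.\<close>
  define Xk where "Xk b = {f \<in> X'. col f = b}" for b
  note G3 = gluingD[OF c3(1)]
  have fpk: "fpf_involution_on (Xk b) t" if "fpf_involution_on X' t" "\<And>f. f \<in> X' \<Longrightarrow> col (t f) = col f" for b t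
    using that unfolding fpf_involution_on_def Xk_def by simp
  have glk: "gluing (Xk b) l' g' c3" for b
    unfolding gluing_def using fpk[OF G3(2) col_l(1)] fpk[OF G3(3) col_l(2)] fpk[OF G3(4) c3(3)] G3(1,5,6)
    by (simp add: Xk_def)
  have Xk: "Xk True \<union> Xk False = X'" "Xk True \<inter> Xk False = {}" by (auto simp: Xk_def)
  note Dk = eg_disjoint[OF glk glk Xk(2), unfolded Xk(1)]
  have Ok: "(u, v) \<in> orel (Xk b) g' c3 \<longleftrightarrow> (u, v) \<in> ?O2 \<and> col v = b" if "u \<in> Xk b" for u v b
  proof -
    have "(u, v) \<in> orel X' g' c3 \<longleftrightarrow> (u, v) \<in> orel (Xk b) g' c3"
      using Dk(5)[of u v] Dk(6)[of u v] that by (cases b) auto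
    moreover have "u \<in> X'" "col u = b" using that by (auto simp: Xk_def)
    ultimately show ?thesis using c3(4)[of u v] by auto
  qed
  \<comment> \<open>The flag \<open>\<rho> u\<close> may lie on a detached edge and then no longer
    marks the vertex \<open>u\<close>. It is replaced by a flag of the graph's own edges, which
    exists as soon as \<open>u\<close> has an incident arc; the other vertices are restored by
    \<open>euler_genus_le\<close>.\<close>
  define W where "W = {u. \<exists>v. (u, v) \<in> parcs G \<or> (v, u) \<in> parcs G}"
  have lpZ: "l (l p) = p" using lf(3) p(1) by auto
  have atZ: "\<exists>f\<in>Z1 \<union> Z2. (\<rho> u, f) \<in> ?O0 \<and> (\<rho> v, l f) \<in> ?O0" if uv: "(u, v) \<in> parcs G" for u v
  proof -
    consider "(u, v) = (y, x)" | "(u, v) \<in> A1" | "(u, v) \<in> A2" using uv G by (auto simp: A1_def A2_def)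
    then show ?thesis
    proof cases
      case 1
      then show ?thesis using p lpZ by (intro bexI[of _ "l p"]) auto
    next
      case 2
      then show ?thesis using \<epsilon>[OF uv] \<epsilon>Z[of "(u, v)"] by auto
    next
      case 3
      then show ?thesis using \<epsilon>[OF uv] \<epsilon>Z2[of "(u, v)"] by auto
    qed
  qed
  have "\<exists>f\<in>Z1 \<union> Z2. (\<rho> u, f) \<in> ?O0" if "u \<in> W" for u
    using that atZ Z_l(1,2) unfolding W_def by blast
  then obtain \<tau> where \<tau>: "\<And>u. u \<in> W \<Longrightarrow> \<tau> u \<in> Z1 \<union> Z2" "\<And>u. u \<in> W \<Longrightarrow> (\<rho> u, \<tau> u) \<in> ?O0"
    by metis
  have WG: "W \<subseteq> pverts G" using AG by (auto simp: W_def)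
  have \<tau>inj: "u = v" if "u \<in> W" "v \<in> W" "(\<tau> u, \<tau> v) \<in> ?O2" for u v
  proof -
    have "(\<tau> u, \<tau> v) \<in> ?O0" using O2Z \<tau>(1) that by blast
    then have "(\<rho> u, \<tau> v) \<in> ?O0" using \<tau>(2)[OF that(1)] O0(3) by blast
    then show ?thesis using uniq[of u v "\<tau> v"] \<tau>(2) that WG by blast
  qed
  have \<tau>at: "(\<tau> u, f) \<in> ?O2" if "u \<in> W" "f \<in> Z1 \<union> Z2" "(\<rho> u, f) \<in> ?O0" for u f
    using O2Z[OF \<tau>(1)[OF that(1)] that(2)] \<tau>(2)[OF that(1)] that(3) O0(2,3) by blast
  have xyW: "x \<in> W" "y \<in> W" using xyG by (auto simp: W_def)
  have bound: "int (euler_genus H) \<le> eg (Xk b) l' g' c3"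
    if H: "parcs H \<subseteq> parcs G" "finite (pverts H)" "parcs H \<subseteq> pverts H \<times> pverts H" "Xk b \<noteq> {}"
      and arcs: "\<And>u v. (u, v) \<in> parcs H \<Longrightarrow> \<exists>f\<in>Xk b. (\<tau> u, f) \<in> ?O2 \<and> (\<tau> v, l' f) \<in> ?O2" for H b
  proof -
    define WH where "WH = {u. \<exists>v. (u, v) \<in> parcs H \<or> (v, u) \<in> parcs H}"
    have WHW: "WH \<subseteq> W" using H(1) by (auto simp: WH_def W_def)
    have lk: "l' f \<in> Xk b" if "f \<in> Xk b" for f using fpfD(1)[OF gluingD(2)[OF glk] that] .
    have "\<exists>f\<in>Xk b. (\<tau> u, f) \<in> ?O2" if "u \<in> WH" for u using that arcs lk unfolding WH_def by blast
    \<comment> \<open>After the separation \<open>x\<close> and \<open>y\<close> have one vertex on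
      each side, so representatives have to be taken among the flags of colour
      \<open>b\<close>.\<close>
    then obtain \<theta> where \<theta>: "\<And>u. u \<in> WH \<Longrightarrow> \<theta> u \<in> Xk b" "\<And>u. u \<in> WH \<Longrightarrow> (\<tau> u, \<theta> u) \<in> ?O2" by metis
    have near: "(\<theta> u, f) \<in> orel (Xk b) g' c3" if "u \<in> WH" "f \<in> Xk b" "(\<tau> u, f) \<in> ?O2" for u f
      using Ok[OF \<theta>(1)[OF that(1)], of f] that \<theta>(2)[OF that(1)] O2(2,3) unfolding Xk_def by blast
    have dr: "draws WH (parcs H) (Xk b) l' g' c3 \<theta>"
    proof (rule drawsI)
      show "\<theta> u \<in> Xk b" if "u \<in> WH" for u using \<theta>(1)[OF that] .
      show "u = v" if uv: "u \<in> WH" "v \<in> WH" "(\<theta> u, \<theta> v) \<in> orel (Xk b) g' c3" for u v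
      proof -
        have "(\<theta> u, \<theta> v) \<in> ?O2" using Ok[OF \<theta>(1)[OF uv(1)]] uv(3) by blast
        then have "(\<tau> u, \<tau> v) \<in> ?O2"
          using O2(3)[OF O2(3)[OF \<theta>(2)[OF uv(1)]] O2(2)[OF \<theta>(2)[OF uv(2)]]] by simp
        then show ?thesis using \<tau>inj uv(1,2) WHW by blast
      qed
      fix u v assume uv: "(u, v) \<in> parcs H"
      then have "u \<in> WH" "v \<in> WH" by (auto simp: WH_def)
      then show "\<exists>f\<in>Xk b. (\<theta> u, f) \<in> orel (Xk b) g' c3 \<and> (\<theta> v, l' f) \<in> orel (Xk b) g' c3"
        using arcs[OF uv] near lk by blast
    qed
    show ?thesis
      by (rule euler_genus_le[OF glk H(4) dr _ _ H(2)]) (use H(3) in \<open>auto simp: WH_def\<close>)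
  qed
  have Z1k: "f \<in> Xk True" if "f \<in> Z1" for f using that Z_X Z12 by (auto simp: Xk_def X'_def col_def)
  have Z2k: "f \<in> Xk False" if "f \<in> Z2" for f using that Z_X by (auto simp: Xk_def X'_def col_def)
  have Yk: "f \<in> Xk False" if "f \<in> Y" for f using that colY by (auto simp: Xk_def X'_def)
  have atO2: "(\<tau> u, \<epsilon> (u, v)) \<in> ?O2 \<and> (\<tau> v, l' (\<epsilon> (u, v))) \<in> ?O2" if "(u, v) \<in> A1 \<or> (u, v) \<in> A2" for u v
  proof -
    have uvG: "(u, v) \<in> parcs G" "u \<in> W" "v \<in> W" using that A12 by (auto simp: W_def)
    have "\<epsilon> (u, v) \<in> Z1 \<union> Z2" "l (\<epsilon> (u, v)) \<in> Z1 \<union> Z2" "\<epsilon> (u, v) \<in> X"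
      using that \<epsilon>Z[of "(u, v)"] \<epsilon>Z2[of "(u, v)"] Z_l(1,2) \<epsilon>[OF uvG(1)] by auto
    then show ?thesis using \<tau>at[OF uvG(2)] \<tau>at[OF uvG(3)] \<epsilon>[OF uvG(1)] l'X by simp
  qed
  have "(x, y) \<in> A1" by (simp add: A1_def)
  then have xp: "(\<tau> x, p) \<in> ?O2" "(\<tau> y, l' p) \<in> ?O2" using atO2[of x y] by (auto simp: p_def)
  have b1: "int (euler_genus G\<^sub>1) \<le> eg (Xk True) l' g' c3"
  proof (rule bound)
    show "parcs G\<^sub>1 \<subseteq> parcs G" "finite (pverts G\<^sub>1)" "parcs G\<^sub>1 \<subseteq> pverts G\<^sub>1 \<times> pverts G\<^sub>1" using G fin A by auto
    show "Xk True \<noteq> {}" using Z1k p(4) by auto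
    fix u v assume uv: "(u, v) \<in> parcs G\<^sub>1"
    show "\<exists>f\<in>Xk True. (\<tau> u, f) \<in> ?O2 \<and> (\<tau> v, l' f) \<in> ?O2"
    proof (cases "(u, v) = (y, x)")
      case True
      then show ?thesis using xp Z1k[OF p(5)] l'X[OF p(1)] l'X[OF p(6)] lpZ by (intro bexI[of _ "l p"]) auto
    next
      case False
      then have "(u, v) \<in> A1" using uv by (simp add: A1_def)
      then show ?thesis using atO2 Z1k \<epsilon>Z by blast
    qed
  qed
  have b2: "int (euler_genus G\<^sub>2) \<le> eg (Xk False) l' g' c3"
  proof (rule bound)
    show "parcs G\<^sub>2 \<subseteq> parcs G" "finite (pverts G\<^sub>2)" "parcs G\<^sub>2 \<subseteq> pverts G\<^sub>2 \<times> pverts G\<^sub>2" using G fin A by auto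
    show "Xk False \<noteq> {}" using Yk Y(4) by auto
    have xd: "(\<tau> x, d) \<in> ?O2" "(\<tau> y, l' d) \<in> ?O2" using xp pdO2 O2(3) by blast+
    have lld: "l' (l' d) = d" using fpfD(3)[OF gluingD(2)[OF Y(1)] Y(4)] l'Y[OF Y(4)] l'Y[OF md] by simp
    fix u v assume uv: "(u, v) \<in> parcs G\<^sub>2"
    consider "(u, v) = (x, y)" | "(u, v) = (y, x)" | "(u, v) \<in> A2" using uv by (auto simp: A2_def)
    then show "\<exists>f\<in>Xk False. (\<tau> u, f) \<in> ?O2 \<and> (\<tau> v, l' f) \<in> ?O2"
    proof cases
      case 1
      then show ?thesis using xd Yk[OF Y(4)] by (intro bexI[of _ d]) auto
    next
      case 2
      then show ?thesis using xd Yk[OF md] lld l'Y[OF Y(4)] by (intro bexI[of _ "l' d"]) auto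
    next
      case 3
      then show ?thesis using atO2 Z2k \<epsilon>Z2 by blast
    qed
  qed
  have "int (euler_genus G\<^sub>1) + int (euler_genus G\<^sub>2) \<le> int (euler_genus G)"
    using b1 b2 Dk(2) c3(2) c2(2) U(2) Y(2) c1(2) X(4) by linarith
  then show ?thesis by linarith
qed

section \<open>Criticality of sums\<close>

lemma pair_graph_iff:
  "pair_graph G \<longleftrightarrow> finite (pverts G) \<and> parcs G \<subseteq> pverts G \<times> pverts G \<and> (\<forall>u. (u, u) \<notin> parcs G) \<and>
     (\<forall>u v. (u, v) \<in> parcs G \<longrightarrow> (v, u) \<in> parcs G)"
proof
  assume "pair_graph G"
  then interpret pair_graph G .
  have "(v, u) \<in> parcs G" if "(u, v) \<in> parcs G" for u v
    using pair_sym_arcs that by (auto simp: symmetric_def dest: symD)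
  then show "finite (pverts G) \<and> parcs G \<subseteq> pverts G \<times> pverts G \<and> (\<forall>u. (u, u) \<notin> parcs G) \<and>
     (\<forall>u v. (u, v) \<in> parcs G \<longrightarrow> (v, u) \<in> parcs G)"
    using pair_finite_verts pair_no_loops in_arcsD1 in_arcsD2 by fastforce
next
  assume a: "finite (pverts G) \<and> parcs G \<subseteq> pverts G \<times> pverts G \<and> (\<forall>u. (u, u) \<notin> parcs G) \<and>
     (\<forall>u v. (u, v) \<in> parcs G \<longrightarrow> (v, u) \<in> parcs G)"
  have "finite (parcs G)" using a by (meson finite_SigmaI finite_subset)
  then show "pair_graph G"
    using a by unfold_locales (auto simp: symmetric_def sym_def)
qed

lemma GxyD:
  assumes "G \<in> Gxy x y"
  shows "finite (pverts G)" "parcs G \<subseteq> pverts G \<times> pverts G" "(u, u) \<notin> parcs G"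
    "(u, v) \<in> parcs G \<Longrightarrow> (v, u) \<in> parcs G" "(u, v) \<in> parcs G \<Longrightarrow> u \<in> pverts G"
    "(u, v) \<in> parcs G \<Longrightarrow> v \<in> pverts G" "x \<in> pverts G" "y \<in> pverts G" "x \<noteq> y"
  using assms unfolding Gxy_def pair_graph_iff by auto

lemma Gxy_oD: "G \<in> Gxy_o x y \<Longrightarrow> G \<in> Gxy x y" "G \<in> Gxy_o x y \<Longrightarrow> (x, y) \<notin> parcs G"
  by (auto simp: Gxy_o_def)

lemma euler_genus_plus_sum:
  assumes 1: "G\<^sub>1 \<in> Gxy x y" and 2: "G\<^sub>2 \<in> Gxy x y" and s: "xy_sum x y G\<^sub>1 G\<^sub>2 G"
  shows "euler_genus_plus x y G = euler_genus_plus x y G\<^sub>1 + euler_genus_plus x y G\<^sub>2"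
proof -
  let ?p = "\<lambda>G. add_xy x y G"
  note d1 = GxyD[OF 1] and d2 = GxyD[OF 2]
  have V: "pverts G\<^sub>1 \<inter> pverts G\<^sub>2 = {x, y}" and G: "G = \<lparr>pverts = pverts G\<^sub>1 \<union> pverts G\<^sub>2, parcs = parcs G\<^sub>1 \<union> parcs G\<^sub>2\<rparr>"
    using s by (auto simp: xy_sum_def)
  have "euler_genus (?p G) \<le> euler_genus (?p G\<^sub>1) + euler_genus (?p G\<^sub>2)"
    by (rule euler_genus_amalgamation_le[where x = x and y = y])
      (use d1 d2 V G in \<open>auto simp: add_xy_def\<close>)
  moreover have "euler_genus (?p G\<^sub>1) + euler_genus (?p G\<^sub>2) \<le> euler_genus (?p G)"
    by (rule euler_genus_amalgamation_ge[where x = x and y = y])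
      (use d1 d2 V G in \<open>auto simp: add_xy_def\<close>)
  ultimately show ?thesis by (simp add: euler_genus_plus_def)
qed

lemma xy_sum_commute: "xy_sum x y G\<^sub>1 G\<^sub>2 G \<Longrightarrow> xy_sum x y G\<^sub>2 G\<^sub>1 G"
  by (auto simp: xy_sum_def)

lemma apply_op_Gxy:
  assumes G: "G \<in> Gxy x y" and \<mu>: "\<mu> \<in> minor_operations x y G"
  shows "apply_op \<mu> G \<in> Gxy x y"
proof -
  note d = GxyD[OF G]
  from \<mu> consider u v where "\<mu> = Delete u v" | u v where "\<mu> = Contract u v" "(u, v) \<in> parcs G" "v \<notin> {x, y}"
    by (auto simp: minor_operations_def)
  then show ?thesis
  proof cases
    case 1
    then show ?thesis using d unfolding Gxy_def pair_graph_iff by auto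
  next
    case 2
    define q where "q = id(v := u)"
    have H: "apply_op \<mu> G = \<lparr>pverts = q ` pverts G, parcs = {(q a, q b) | a b. (a, b) \<in> parcs G \<and> q a \<noteq> q b}\<rparr>"
      using 2 by (simp add: q_def Let_def)
    have "x = q x" "y = q y" using 2 by (auto simp: q_def)
    then have "x \<in> q ` pverts G" "y \<in> q ` pverts G" using d(7,8) by blast+
    moreover have "{(q a, q b) | a b. (a, b) \<in> parcs G \<and> q a \<noteq> q b} \<subseteq> q ` pverts G \<times> q ` pverts G"
      using d(5,6) by auto
    moreover have "(b, a) \<in> {(q a, q b) | a b. (a, b) \<in> parcs G \<and> q a \<noteq> q b}"
      if "(a, b) \<in> {(q a, q b) | a b. (a, b) \<in> parcs G \<and> q a \<noteq> q b}" for a b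
      using that d(4) by fastforce
    ultimately show ?thesis using d(1,9) unfolding Gxy_def pair_graph_iff H by auto
  qed
qed

text \<open>The operation does not touch \<open>G\<^sub>2\<close>: an edge common to both summands
  could only be \<open>xy\<close>, which is absent, and the vertex that a contraction removes is no
  terminal and hence lies outside \<open>G\<^sub>2\<close>.\<close>

lemma xy_sum_apply_op:
  assumes 1: "G\<^sub>1 \<in> Gxy_o x y" and 2: "G\<^sub>2 \<in> Gxy_o x y" and s: "xy_sum x y G\<^sub>1 G\<^sub>2 G"
    and \<mu>: "\<mu> \<in> minor_operations x y G\<^sub>1"
  shows "xy_sum x y (apply_op \<mu> G\<^sub>1) G\<^sub>2 (apply_op \<mu> G)"
proof -
  note d1 = GxyD[OF Gxy_oD(1)[OF 1]] and d2 = GxyD[OF Gxy_oD(1)[OF 2]]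
  have V: "pverts G\<^sub>1 \<inter> pverts G\<^sub>2 = {x, y}" and G: "G = \<lparr>pverts = pverts G\<^sub>1 \<union> pverts G\<^sub>2, parcs = parcs G\<^sub>1 \<union> parcs G\<^sub>2\<rparr>"
    using s by (auto simp: xy_sum_def)
  from \<mu> consider u v where "\<mu> = Delete u v" "(u, v) \<in> parcs G\<^sub>1"
    | u v where "\<mu> = Contract u v" "(u, v) \<in> parcs G\<^sub>1" "v \<notin> {x, y}"
    by (auto simp: minor_operations_def)
  then show ?thesis
  proof cases
    case 1
    have "(u, v) \<notin> parcs G\<^sub>2"
    proof
      assume uv: "(u, v) \<in> parcs G\<^sub>2"
      then have "u \<in> {x, y}" "v \<in> {x, y}" using 1 d1(5,6) d2(5,6) V by blast+
      moreover have "u \<noteq> v" using uv d2(3) by auto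
      ultimately have "(x, y) \<in> parcs G\<^sub>2" using uv d2(4) by auto
      then show False using Gxy_oD(2)[OF 2] by simp
    qed
    moreover from this have "(v, u) \<notin> parcs G\<^sub>2" using d2(4) by blast
    ultimately show ?thesis using V G 1 by (auto simp: xy_sum_def)
  next
    case 2
    define q where "q = id(v := u)"
    have H: "apply_op \<mu> K = \<lparr>pverts = q ` pverts K, parcs = {(q a, q b) | a b. (a, b) \<in> parcs K \<and> q a \<noteq> q b}\<rparr>" for K
      using 2 by (simp add: q_def Let_def)
    have v: "v \<in> pverts G\<^sub>1" "u \<in> pverts G\<^sub>1" "u \<noteq> v" using 2 d1 by auto
    have v2: "v \<notin> pverts G\<^sub>2" using v V 2 by auto
    have q2: "q a = a" if "a \<in> pverts G\<^sub>2" for a using that v2 by (auto simp: q_def)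
    have i2: "q ` pverts G\<^sub>2 = pverts G\<^sub>2" using q2 by auto
    have i1: "q ` pverts G\<^sub>1 = pverts G\<^sub>1 - {v}" using v by (auto simp: q_def)
    have a2: "{(q a, q b) | a b. (a, b) \<in> parcs G\<^sub>2 \<and> q a \<noteq> q b} = parcs G\<^sub>2"
    proof (intro equalityI subrelI)
      fix a b assume ab: "(a, b) \<in> parcs G\<^sub>2"
      then have "q a = a" "q b = b" "a \<noteq> b" using q2 d2 by auto
      then show "(a, b) \<in> {(q a, q b) | a b. (a, b) \<in> parcs G\<^sub>2 \<and> q a \<noteq> q b}" using ab by force
    next
      fix a b assume "(a, b) \<in> {(q a, q b) | a b. (a, b) \<in> parcs G\<^sub>2 \<and> q a \<noteq> q b}"
      then obtain a' b' where "(a', b') \<in> parcs G\<^sub>2" "a = q a'" "b = q b'" by auto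
      then show "(a, b) \<in> parcs G\<^sub>2" using q2 d2(5,6) by metis
    qed
    have "{(q a, q b) | a b. (a, b) \<in> parcs G \<and> q a \<noteq> q b} =
        {(q a, q b) | a b. (a, b) \<in> parcs G\<^sub>1 \<and> q a \<noteq> q b} \<union> {(q a, q b) | a b. (a, b) \<in> parcs G\<^sub>2 \<and> q a \<noteq> q b}"
      using G by auto
    then have arcs: "parcs (apply_op \<mu> G) = parcs (apply_op \<mu> G\<^sub>1) \<union> parcs G\<^sub>2" unfolding H a2 by simp
    have "q ` pverts G = q ` pverts G\<^sub>1 \<union> pverts G\<^sub>2" using G i2 by (simp add: image_Un)
    then have verts: "pverts (apply_op \<mu> G) = pverts (apply_op \<mu> G\<^sub>1) \<union> pverts G\<^sub>2" unfolding H by simp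
    have "pverts (apply_op \<mu> G\<^sub>1) \<inter> pverts G\<^sub>2 = {x, y}" unfolding H using i1 V v2 by auto
    then show ?thesis unfolding xy_sum_def using arcs verts by (simp add: H)
  qed
qed

lemma critical_sum:
  assumes 1: "G\<^sub>1 \<in> Gxy_o x y" and 2: "G\<^sub>2 \<in> Gxy_o x y" and s: "xy_sum x y G\<^sub>1 G\<^sub>2 G"
  shows "critical x y (euler_genus_plus x y) G \<longleftrightarrow>
    critical x y (euler_genus_plus x y) G\<^sub>1 \<and> critical x y (euler_genus_plus x y) G\<^sub>2"
proof -
  let ?g = "euler_genus_plus x y"
  note G1 = Gxy_oD(1)[OF 1] and G2 = Gxy_oD(1)[OF 2]
  have ops: "minor_operations x y G = minor_operations x y G\<^sub>1 \<union> minor_operations x y G\<^sub>2"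
    using s by (auto simp: minor_operations_def xy_sum_def)
  have g: "?g G = ?g G\<^sub>1 + ?g G\<^sub>2" by (rule euler_genus_plus_sum[OF G1 G2 s])
  have g1: "?g (apply_op \<mu> G) = ?g (apply_op \<mu> G\<^sub>1) + ?g G\<^sub>2" if "\<mu> \<in> minor_operations x y G\<^sub>1" for \<mu>
    by (rule euler_genus_plus_sum[OF apply_op_Gxy[OF G1 that] G2 xy_sum_apply_op[OF 1 2 s that]])
  have g2: "?g (apply_op \<mu> G) = ?g (apply_op \<mu> G\<^sub>2) + ?g G\<^sub>1" if "\<mu> \<in> minor_operations x y G\<^sub>2" for \<mu>
    by (rule euler_genus_plus_sum[OF apply_op_Gxy[OF G2 that] G1 xy_sum_apply_op[OF 2 1 xy_sum_commute[OF s] that]])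
  show ?thesis unfolding critical_def ops g by (simp add: ball_Un g1 g2)
qed

section \<open>Splitting along a vertex cut\<close>

lemma connected_iff_rtrancl:
  assumes "arcs_ends H \<subseteq> verts H \<times> verts H" "sym (arcs_ends H)"
  shows "Digraph_Component.connected H \<longleftrightarrow>
    verts H \<noteq> {} \<and> (\<forall>u\<in>verts H. \<forall>v\<in>verts H. (u, v) \<in> (arcs_ends H)\<^sup>*)"
proof -
  have "(arcs_ends H)\<^sup>s = arcs_ends H" using assms(2) by (auto simp: symcl_def sym_def)
  moreover have "(u, v) \<in> rtrancl_on (verts H) (arcs_ends H) \<longleftrightarrow> (u, v) \<in> (arcs_ends H)\<^sup>*"
    if "u \<in> verts H" "v \<in> verts H" for u v
  proof
    assume "(u, v) \<in> (arcs_ends H)\<^sup>*"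
    then show "(u, v) \<in> rtrancl_on (verts H) (arcs_ends H)"
      by (rule rtrancl_consistent_rtrancl_on) (use that assms(1) in auto)
  qed (rule rtrancl_on_rtranclI)
  ultimately show ?thesis unfolding connected_conv by auto
qed

lemma graph_connected_iff:
  assumes "pair_graph G"
  shows "graph_connected G \<longleftrightarrow> pverts G \<noteq> {} \<and> (\<forall>u\<in>pverts G. \<forall>v\<in>pverts G. (u, v) \<in> (parcs G)\<^sup>*)"
proof -
  have "sym (parcs G)" "parcs G \<subseteq> pverts G \<times> pverts G" using assms by (auto simp: pair_graph_iff sym_def)
  then show ?thesis using connected_iff_rtrancl[of "with_proj G"] by simp
qed

lemma induced_connected_iff:
  assumes "pair_graph G" "W \<subseteq> pverts G"
  shows "Digraph_Component.connected (with_proj G \<restriction> W) \<longleftrightarrow>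
    W \<noteq> {} \<and> (\<forall>u\<in>W. \<forall>v\<in>W. (u, v) \<in> (parcs G \<inter> W \<times> W)\<^sup>*)"
proof -
  have e: "arcs_ends (with_proj G \<restriction> W) = parcs G \<inter> W \<times> W"
    by (auto simp: arcs_ends_conv)
  have "sym (parcs G \<inter> W \<times> W)" using assms by (auto simp: pair_graph_iff sym_def)
  then show ?thesis using connected_iff_rtrancl[of "with_proj G \<restriction> W"] unfolding e by simp
qed

definition xy_bridge :: "'a \<Rightarrow> 'a \<Rightarrow> 'a pair_pre_digraph \<Rightarrow> 'a set \<Rightarrow> 'a pair_pre_digraph" where
  "xy_bridge x y G D = \<lparr>pverts = D \<union> {x, y}, parcs = parcs G \<inter> (D \<union> {x, y}) \<times> (D \<union> {x, y})\<rparr>"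

text \<open>In \<open>G\<close> without the terminal \<open>t\<close>, a walk from \<open>D\<close>
  to the other terminal \<open>s\<close> can leave \<open>D\<close> only at \<open>s\<close>, so up
  to there it runs inside the bridge. 2-connectivity supplies such walks for either
  terminal.\<close>

lemma bridge_connected:
  assumes G: "G \<in> Gxy_o x y" and tc: "two_connected G"
    and D: "D \<subseteq> pverts G - {x, y}" "D \<noteq> {}"
      "\<And>u v. (u, v) \<in> parcs G \<Longrightarrow> u \<in> D \<Longrightarrow> v \<in> D \<union> {x, y}"
  shows "xy_bridge x y G D \<in> Gxy_o x y" "graph_connected (xy_bridge x y G D)"
proof -
  note d = GxyD[OF Gxy_oD(1)[OF G]]
  let ?B = "xy_bridge x y G D"
  have pg: "pair_graph G" using Gxy_oD(1)[OF G] by (simp add: Gxy_def)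
  have "finite D" using D(1) d(1) finite_subset by blast
  then have pgB: "pair_graph ?B" unfolding pair_graph_iff using d by (auto simp: xy_bridge_def)
  then show "?B \<in> Gxy_o x y" using d(9) Gxy_oD(2)[OF G] by (auto simp: Gxy_o_def Gxy_def xy_bridge_def)
  have sB: "sym (parcs ?B)" using d(4) by (auto simp: sym_def xy_bridge_def)
  have sBs: "(v, u) \<in> (parcs ?B)\<^sup>*" if "(u, v) \<in> (parcs ?B)\<^sup>*" for u v
    using that sym_rtrancl[OF sB] by (meson symD)
  have reach: "(u, s) \<in> (parcs ?B)\<^sup>*" if st: "{s, t} = {x, y}" "s \<noteq> t" and u: "u \<in> D" for s t u
  proof (rule ccontr)
    assume non: "(u, s) \<notin> (parcs ?B)\<^sup>*"
    have st': "s \<in> {x, y}" "t \<in> {x, y}" "s \<in> pverts G" "t \<in> pverts G" using st d(7,8) by auto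
    let ?W = "pverts G - {t}"
    have "Digraph_Component.connected (with_proj G \<restriction> ?W)" using tc st'(4) by (simp add: two_connected_def)
    moreover have "u \<in> ?W" "s \<in> ?W" using u D(1) st st' by auto
    ultimately have "(u, s) \<in> (parcs G \<inter> ?W \<times> ?W)\<^sup>*" using induced_connected_iff[OF pg, of ?W] by blast
    then have "s \<in> {v \<in> D. (u, v) \<in> (parcs ?B)\<^sup>*}"
    proof (rule rtrancl_closed)
      show "u \<in> {v \<in> D. (u, v) \<in> (parcs ?B)\<^sup>*}" using u by simp
      fix a b assume ab: "(a, b) \<in> parcs G \<inter> ?W \<times> ?W" and a: "a \<in> {v \<in> D. (u, v) \<in> (parcs ?B)\<^sup>*}"
      have bD: "b \<in> D \<union> {x, y}" using D(3)[of a b] ab a by auto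
      then have "(a, b) \<in> parcs ?B" using ab a by (auto simp: xy_bridge_def)
      then have ub: "(u, b) \<in> (parcs ?B)\<^sup>*" using a by (auto intro: rtrancl_into_rtrancl)
      then have "b \<noteq> s" using non by auto
      moreover have "b \<noteq> t" using ab by auto
      ultimately have "b \<in> D" using bD st(1) by auto
      then show "b \<in> {v \<in> D. (u, v) \<in> (parcs ?B)\<^sup>*}" using ub by simp
    qed
    then show False using D(1) st' by auto
  qed
  have rx: "(u, x) \<in> (parcs ?B)\<^sup>*" if "u \<in> D" for u using reach[of x y u] d(9) that by auto
  have ry: "(u, y) \<in> (parcs ?B)\<^sup>*" if "u \<in> D" for u using reach[of y x u] d(9) that by auto
  obtain w where w: "w \<in> D" using D(2) by auto
  have tox: "(u, x) \<in> (parcs ?B)\<^sup>*" if "u \<in> D \<union> {x, y}" for u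
  proof -
    have "(y, x) \<in> (parcs ?B)\<^sup>*" using sBs[OF ry[OF w]] rx[OF w] by (rule rtrancl_trans)
    then show ?thesis using that rx by auto
  qed
  show "graph_connected ?B"
    unfolding graph_connected_iff[OF pgB]
  proof (intro conjI ballI)
    fix u v assume "u \<in> pverts ?B" "v \<in> pverts ?B"
    then have "(u, x) \<in> (parcs ?B)\<^sup>*" "(x, v) \<in> (parcs ?B)\<^sup>*" using tox sBs by (auto simp: xy_bridge_def)
    then show "(u, v) \<in> (parcs ?B)\<^sup>*" by (rule rtrancl_trans)
  qed (simp add: xy_bridge_def)
qed

text \<open>\<open>D\<close> is one component of \<open>G\<close> without \<open>x\<close> and
  \<open>y\<close>, and \<open>D'\<close> collects all the others. That \<open>D'\<close> itself may
  be disconnected does no harm, because each of its components is attached to both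
  terminals.\<close>

lemma vertex_cut_xy_sum:
  assumes G: "G \<in> Gxy_o x y" and tc: "two_connected G" and vc: "vertex_cut G {x, y}"
  obtains G\<^sub>1 G\<^sub>2 where "G\<^sub>1 \<in> Gxy_o x y" "G\<^sub>2 \<in> Gxy_o x y" "graph_connected G\<^sub>1" "graph_connected G\<^sub>2"
    "xy_sum x y G\<^sub>1 G\<^sub>2 G" "parcs G\<^sub>1 \<noteq> {}" "parcs G\<^sub>2 \<noteq> {}"
proof -
  note d = GxyD[OF Gxy_oD(1)[OF G]]
  have pg: "pair_graph G" using Gxy_oD(1)[OF G] by (simp add: Gxy_def)
  let ?W = "pverts G - {x, y}"
  let ?A = "parcs G \<inter> ?W \<times> ?W"
  have "?W \<noteq> {}" "\<not> Digraph_Component.connected (with_proj G \<restriction> ?W)" using vc by (auto simp: vertex_cut_def)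
  then obtain w z where wz: "w \<in> ?W" "z \<in> ?W" "(w, z) \<notin> ?A\<^sup>*" using induced_connected_iff[OF pg, of ?W] by blast
  define D where "D = ?A\<^sup>* `` {w}"
  define D' where "D' = ?W - D"
  have DW: "D \<subseteq> ?W" unfolding D_def by (rule rtrancl_Image_subset) (use wz in auto)
  have Dne: "D \<noteq> {}" "D' \<noteq> {}" using wz by (auto simp: D_def D'_def)
  have cl: "v \<in> D \<union> {x, y}" if "(u, v) \<in> parcs G" "u \<in> D" for u v
  proof (cases "v \<in> {x, y}")
    case False
    then have "(u, v) \<in> ?A" using that DW d(6) by auto
    then show ?thesis using that(2) by (auto simp: D_def intro: rtrancl_into_rtrancl)
  qed auto
  have cl': "v \<in> D' \<union> {x, y}" if "(u, v) \<in> parcs G" "u \<in> D'" for u v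
  proof -
    have "v \<notin> D" using cl[of v u] d(4)[OF that(1)] that(2) by (auto simp: D'_def)
    then show ?thesis using d(6)[OF that(1)] by (auto simp: D'_def)
  qed
  have B: "xy_bridge x y G D \<in> Gxy_o x y" "graph_connected (xy_bridge x y G D)"
    using bridge_connected[OF G tc DW Dne(1)] cl by blast+
  have D'W: "D' \<subseteq> ?W" by (auto simp: D'_def)
  have B': "xy_bridge x y G D' \<in> Gxy_o x y" "graph_connected (xy_bridge x y G D')"
    using bridge_connected[OF G tc D'W Dne(2)] cl' by blast+
  have ne: "parcs H \<noteq> {}" if "H \<in> Gxy_o x y" "graph_connected H" for H
  proof
    assume e: "parcs H = {}"
    note h = GxyD[OF Gxy_oD(1)[OF that(1)]]
    have "pair_graph H" using that(1) by (simp add: Gxy_o_def Gxy_def)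
    then have "(x, y) \<in> (parcs H)\<^sup>*" using that(2) h(7,8) by (simp add: graph_connected_iff)
    then show False using e h(9) by simp
  qed
  have "xy_sum x y (xy_bridge x y G D) (xy_bridge x y G D') G"
  proof -
    have V: "pverts G = (D \<union> {x, y}) \<union> (D' \<union> {x, y})" using DW d(7,8) by (auto simp: D'_def)
    have I: "(D \<union> {x, y}) \<inter> (D' \<union> {x, y}) = {x, y}" by (auto simp: D'_def)
    have "(u, v) \<in> parcs (xy_bridge x y G D) \<union> parcs (xy_bridge x y G D')" if uv: "(u, v) \<in> parcs G" for u v
    proof -
      have vu: "(v, u) \<in> parcs G" using d(4)[OF uv] .
      have "u \<in> D \<or> v \<in> D \<or> u \<in> D' \<or> v \<in> D'"
      proof (rule ccontr)
        assume "\<not> ?thesis"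
        then have "u \<in> {x, y}" "v \<in> {x, y}" using d(5,6)[OF uv] V by auto
        moreover have "u \<noteq> v" using uv d(3) by auto
        ultimately have "(x, y) \<in> parcs G" using uv vu by auto
        then show False using Gxy_oD(2)[OF G] by simp
      qed
      then have "(u, v) \<in> (D \<union> {x, y}) \<times> (D \<union> {x, y}) \<or> (u, v) \<in> (D' \<union> {x, y}) \<times> (D' \<union> {x, y})"
        using cl[OF uv] cl[OF vu] cl'[OF uv] cl'[OF vu] by blast
      then show ?thesis using uv unfolding xy_bridge_def by simp
    qed
    then have "parcs G \<subseteq> parcs (xy_bridge x y G D) \<union> parcs (xy_bridge x y G D')" by (rule subrelI)
    then have "parcs G = parcs (xy_bridge x y G D) \<union> parcs (xy_bridge x y G D')" unfolding xy_bridge_def by force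
    then show ?thesis using V I by (simp add: xy_sum_def xy_bridge_def)
  qed
  then show thesis using that[OF B(1) B'(1) B(2) B'(2)] ne[OF B] ne[OF B'] by blast
qed

lemma critical_genus_pos:
  assumes "G \<in> Gxy_o x y" "critical x y P G" "parcs G \<noteq> {}"
  shows "0 < P G"
proof -
  obtain u v where "(u, v) \<in> parcs G" using assms(3) by (metis ex_in_conv surj_pair)
  then have "Delete u v \<in> minor_operations x y G" by (auto simp: minor_operations_def)
  then show ?thesis using assms(2) unfolding critical_def by (metis gr_zeroI not_less_zero)
qed

theorem theorem5p9:
  fixes x y :: 'a
  shows
    "(\<forall>G\<^sub>1\<in>Gxy_o x y. \<forall>G\<^sub>2\<in>Gxy_o x y. \<forall>G.
        graph_connected G\<^sub>1 \<and> graph_connected G\<^sub>2 \<and> xy_sum x y G\<^sub>1 G\<^sub>2 G \<and>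
        G\<^sub>1 \<in> critical_class_o x y 0 (euler_genus_plus x y) \<and>
        G\<^sub>2 \<in> critical_class_o x y 1 (euler_genus_plus x y)
        \<longrightarrow> G \<in> critical_class_o x y 2 (euler_genus_plus x y)) \<and>
     (\<forall>G\<in>critical_class_o x y 2 (euler_genus_plus x y).
        two_connected G \<and> vertex_cut G {x, y}
        \<longrightarrow> (\<exists>G\<^sub>1\<in>Gxy_o x y. \<exists>G\<^sub>2\<in>Gxy_o x y.
              graph_connected G\<^sub>1 \<and> graph_connected G\<^sub>2 \<and>
              G\<^sub>1 \<in> critical_class_o x y 0 (euler_genus_plus x y) \<and>
              G\<^sub>2 \<in> critical_class_o x y 1 (euler_genus_plus x y) \<and>
              xy_sum x y G\<^sub>1 G\<^sub>2 G))"
proof (intro conjI ballI allI impI)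
  let ?g = "euler_genus_plus x y"
  fix G\<^sub>1 G\<^sub>2 G
  assume 1: "G\<^sub>1 \<in> Gxy_o x y" and 2: "G\<^sub>2 \<in> Gxy_o x y" and a: "graph_connected G\<^sub>1 \<and> graph_connected G\<^sub>2 \<and>
    xy_sum x y G\<^sub>1 G\<^sub>2 G \<and> G\<^sub>1 \<in> critical_class_o x y 0 ?g \<and> G\<^sub>2 \<in> critical_class_o x y 1 ?g"
  then have s: "xy_sum x y G\<^sub>1 G\<^sub>2 G" and c: "critical x y ?g G\<^sub>1" "critical x y ?g G\<^sub>2" "?g G\<^sub>1 = 1" "?g G\<^sub>2 = 2"
    by (auto simp: critical_class_o_def)
  note d1 = GxyD[OF Gxy_oD(1)[OF 1]] and d2 = GxyD[OF Gxy_oD(1)[OF 2]]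
  have "G \<in> Gxy_o x y"
    using s d1 d2 Gxy_oD(2)[OF 1] Gxy_oD(2)[OF 2] unfolding Gxy_o_def Gxy_def pair_graph_iff
    by (auto simp: xy_sum_def)
  moreover have "critical x y ?g G" using critical_sum[OF 1 2 s] c by simp
  moreover have "?g G = 3" using euler_genus_plus_sum[OF Gxy_oD(1)[OF 1] Gxy_oD(1)[OF 2] s] c by simp
  ultimately show "G \<in> critical_class_o x y 2 ?g" by (simp add: critical_class_o_def)
next
  let ?g = "euler_genus_plus x y"
  fix G assume "G \<in> critical_class_o x y 2 ?g" and a: "two_connected G \<and> vertex_cut G {x, y}"
  then have G: "G \<in> Gxy_o x y" "critical x y ?g G" "?g G = 3" by (auto simp: critical_class_o_def)
  obtain G\<^sub>1 G\<^sub>2 where H: "G\<^sub>1 \<in> Gxy_o x y" "G\<^sub>2 \<in> Gxy_o x y" "graph_connected G\<^sub>1" "graph_connected G\<^sub>2"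
    "xy_sum x y G\<^sub>1 G\<^sub>2 G" "parcs G\<^sub>1 \<noteq> {}" "parcs G\<^sub>2 \<noteq> {}"
    using vertex_cut_xy_sum[OF G(1)] a by blast
  have c: "critical x y ?g G\<^sub>1" "critical x y ?g G\<^sub>2" using critical_sum[OF H(1,2,5)] G(2) by auto
  have "?g G\<^sub>1 + ?g G\<^sub>2 = 3" using euler_genus_plus_sum[OF Gxy_oD(1)[OF H(1)] Gxy_oD(1)[OF H(2)] H(5)] G(3) by simp
  moreover have "0 < ?g G\<^sub>1" "0 < ?g G\<^sub>2" using critical_genus_pos H(1,2,6,7) c by metis+
  ultimately consider "?g G\<^sub>1 = 1" "?g G\<^sub>2 = 2" | "?g G\<^sub>1 = 2" "?g G\<^sub>2 = 1" by linarith
  then show "\<exists>G\<^sub>1\<in>Gxy_o x y. \<exists>G\<^sub>2\<in>Gxy_o x y. graph_connected G\<^sub>1 \<and> graph_connected G\<^sub>2 \<and>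
      G\<^sub>1 \<in> critical_class_o x y 0 ?g \<and> G\<^sub>2 \<in> critical_class_o x y 1 ?g \<and> xy_sum x y G\<^sub>1 G\<^sub>2 G"
  proof cases
    case 1
    then show ?thesis using H c by (intro bexI[of _ G\<^sub>1] bexI[of _ G\<^sub>2]) (auto simp: critical_class_o_def)
  next
    case 2
    then show ?thesis using H c xy_sum_commute[OF H(5)]
      by (intro bexI[of _ G\<^sub>2] bexI[of _ G\<^sub>1]) (auto simp: critical_class_o_def)
  qed
qed

end
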